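(* Let $n\ge 3$ be an integer and let $m>1$ be a real number. There do not exist a smooth, connected, complete, non-compact Riemannian manifold $(M^n,g)$ without boundary, smooth functions $f,\lambda:M\to\mathbb{R}$ and a point $q\in M$ satisfying all of the following: 1. $(M,g,f,\lambda)$ is a gradient generalized $m$-quasi-Einstein manifold, i.e. $\mathrm{Ric}+\mathrm{Hess} f-\frac1m\, df\otimes df=\lambda g$ on $M$; 2. the scalar curvature $R$ of $g$ is constant and $R\le 0$; 3. $\lambda>0$ everywhere on $M$; 4. the function $v=e^{-f/m}\lambda$ is bounded above on $M$; 5. there is a constant $C>0$ such that $\mathrm{Vol}(B(q,r))\le C r$ for all $r>0$.
   Context: $\mathrm{Ric}$ is the Ricci tensor of $g$, $R$ its scalar curvature (the trace of $\mathrm{Ric}$), and $\mathrm{Hess} f=\nabla df$ is the Hessian of $f$. $B(q,r)$ is the open geodesic ball of radius $r$ centered at $q$, and $\mathrm{Vol}$ is Riemannian volume. *)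

theory Defs
  imports "HOL-Analysis.Analysis"
begin

section \<open>Smooth maps between open subsets of Euclidean spaces\<close>

text \<open>These notions are only used on open sets.\<close>

fun Ck_on :: "nat \<Rightarrow> 'e::euclidean_space set \<Rightarrow> ('e \<Rightarrow> 'b::real_normed_vector) \<Rightarrow> bool" where
  "Ck_on 0 S f \<longleftrightarrow> continuous_on S f"
| "Ck_on (Suc k) S f \<longleftrightarrow> (\<forall>x\<in>S. f differentiable (at x)) \<and>
     (\<forall>v. Ck_on k S (\<lambda>x. frechet_derivative f (at x) v))"

definition smooth_on :: "'e::euclidean_space set \<Rightarrow> ('e \<Rightarrow> 'b::real_normed_vector) \<Rightarrow> bool" where
  "smooth_on S f \<longleftrightarrow> (\<forall>k. Ck_on k S f)"


section \<open>Smooth manifolds\<close>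

text \<open>The points of the manifold are the elements of a type \<open>'a\<close> carrying a Hausdorff, second
  countable topology. A chart is a pair of its domain and its coordinate map; the values of the
  coordinate map outside the domain are irrelevant. Chart images are open in \<open>\<real>\<^sup>n\<close>, so there is
  no boundary. The atlas need not be maximal.\<close>

type_synonym ('a, 'n) chart = "'a set \<times> ('a \<Rightarrow> real ^ 'n)"

definition chart_dom :: "('a, 'n::finite) chart \<Rightarrow> 'a set" where
  "chart_dom c = fst c"

definition coord :: "('a, 'n::finite) chart \<Rightarrow> 'a \<Rightarrow> real ^ 'n" where
  "coord c = snd c"

definition chart_inv :: "('a, 'n::finite) chart \<Rightarrow> real ^ 'n \<Rightarrow> 'a" where
  "chart_inv c = inv_into (chart_dom c) (coord c)"

definition chart_cod :: "('a, 'n::finite) chart \<Rightarrow> (real ^ 'n) set" where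
  "chart_cod c = coord c ` chart_dom c"

definition is_chart :: "('a::topological_space, 'n::finite) chart \<Rightarrow> bool" where
  "is_chart c \<longleftrightarrow> open (chart_dom c) \<and> open (chart_cod c) \<and>
     homeomorphism (chart_dom c) (chart_cod c) (coord c) (chart_inv c)"

locale smooth_manifold =
  fixes A :: "('a::{t2_space, second_countable_topology}, 'n::finite) chart set"
  assumes charts: "c \<in> A \<Longrightarrow> is_chart c"
    and cover: "(\<Union>c\<in>A. chart_dom c) = UNIV"
    and compatible: "c \<in> A \<Longrightarrow> c' \<in> A \<Longrightarrow>
          smooth_on (coord c ` (chart_dom c \<inter> chart_dom c')) (coord c' \<circ> chart_inv c)"

definition smooth_fun :: "('a, 'n::finite) chart set \<Rightarrow> ('a \<Rightarrow> real) \<Rightarrow> bool" where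
  "smooth_fun A f \<longleftrightarrow> (\<forall>c\<in>A. smooth_on (chart_cod c) (f \<circ> chart_inv c))"


section \<open>Riemannian metrics\<close>

text \<open>A covariant 2-tensor field is given by its component matrices: for a chart \<open>c\<close> of the atlas and
  \<open>x \<in> chart_cod c\<close>, the matrix \<open>g c x\<close> has the entries
  \<open>g(\<partial>\<^sub>i, \<partial>\<^sub>j)\<close> at the point with coordinates \<open>x\<close>. The values for other \<open>c\<close> and \<open>x\<close> are
  irrelevant.\<close>

type_synonym ('a, 'n) tensor2 = "('a, 'n) chart \<Rightarrow> real ^ 'n \<Rightarrow> real ^ 'n ^ 'n"

definition transition_jacobian ::
    "('a, 'n::finite) chart \<Rightarrow> ('a, 'n) chart \<Rightarrow> real ^ 'n \<Rightarrow> real ^ 'n ^ 'n" where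
  "transition_jacobian c c' x = matrix (frechet_derivative (coord c' \<circ> chart_inv c) (at x))"

locale riemannian_manifold = smooth_manifold A
  for A :: "('a::{t2_space, second_countable_topology}, 'n::finite) chart set" +
  fixes g :: "('a, 'n) tensor2"
  assumes metric_smooth: "c \<in> A \<Longrightarrow> smooth_on (chart_cod c) (g c)"
    and metric_symmetric: "c \<in> A \<Longrightarrow> x \<in> chart_cod c \<Longrightarrow> transpose (g c x) = g c x"
    and metric_pos_def: "c \<in> A \<Longrightarrow> x \<in> chart_cod c \<Longrightarrow> w \<noteq> 0 \<Longrightarrow> w \<bullet> (g c x *v w) > 0"
    and metric_tensorial: "c \<in> A \<Longrightarrow> c' \<in> A \<Longrightarrow> p \<in> chart_dom c \<inter> chart_dom c' \<Longrightarrow>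
          g c (coord c p) = transpose (transition_jacobian c c' (coord c p)) **
            g c' (coord c' p) ** transition_jacobian c c' (coord c p)"


section \<open>Curvature and Hessian in coordinates\<close>

text \<open>Here \<open>G\<close> is the component matrix of the metric and \<open>F\<close> the expression of a function in one
  chart.\<close>

definition pd :: "'n::finite \<Rightarrow> (real ^ 'n \<Rightarrow> real) \<Rightarrow> real ^ 'n \<Rightarrow> real" where
  "pd i F x = frechet_derivative F (at x) (axis i 1)"

text \<open>\<open>christoffel G k i j\<close> is \<open>\<Gamma>\<^sup>k\<close> with lower indices \<open>i\<close>, \<open>j\<close>, that is,
  \<open>\<nabla>\<^bsub>\<partial>\<^sub>i\<^esub> \<partial>\<^sub>j = \<Sum>k. christoffel G k i j \<cdot> \<partial>\<^sub>k\<close> for the Levi-Civita connection.\<close>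

definition christoffel ::
    "(real ^ 'n \<Rightarrow> real ^ 'n ^ 'n) \<Rightarrow> 'n::finite \<Rightarrow> 'n \<Rightarrow> 'n \<Rightarrow> real ^ 'n \<Rightarrow> real" where
  "christoffel G k i j x = (1/2) * (\<Sum>l\<in>UNIV. matrix_inv (G x) $ k $ l *
     (pd i (\<lambda>y. G y $ j $ l) x + pd j (\<lambda>y. G y $ i $ l) x - pd l (\<lambda>y. G y $ i $ j) x))"

text \<open>\<open>riemann G l k i j\<close> is the \<open>\<partial>\<^sub>l\<close>-component of
  \<open>R(\<partial>\<^sub>i, \<partial>\<^sub>j) \<partial>\<^sub>k = \<nabla>\<^sub>i \<nabla>\<^sub>j \<partial>\<^sub>k - \<nabla>\<^sub>j \<nabla>\<^sub>i \<partial>\<^sub>k\<close>, and the Ricci tensor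
  is the trace \<open>Ric(Y, Z) = tr (X \<mapsto> R(X, Y) Z)\<close>; round spheres have positive Ricci tensor.\<close>

definition riemann ::
    "(real ^ 'n \<Rightarrow> real ^ 'n ^ 'n) \<Rightarrow> 'n::finite \<Rightarrow> 'n \<Rightarrow> 'n \<Rightarrow> 'n \<Rightarrow> real ^ 'n \<Rightarrow> real" where
  "riemann G l k i j x =
     pd i (christoffel G l j k) x - pd j (christoffel G l i k) x
     + (\<Sum>s\<in>UNIV. christoffel G l i s x * christoffel G s j k x
                 - christoffel G l j s x * christoffel G s i k x)"

definition ricci :: "(real ^ 'n \<Rightarrow> real ^ 'n ^ 'n) \<Rightarrow> real ^ 'n \<Rightarrow> real ^ 'n ^ 'n::finite" where
  "ricci G x = (\<chi> j k. \<Sum>i\<in>UNIV. riemann G i k i j x)"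

definition scalar_curvature :: "(real ^ 'n \<Rightarrow> real ^ 'n ^ 'n) \<Rightarrow> real ^ 'n::finite \<Rightarrow> real" where
  "scalar_curvature G x = (\<Sum>j\<in>UNIV. \<Sum>k\<in>UNIV. matrix_inv (G x) $ j $ k * ricci G x $ j $ k)"

definition hessian ::
    "(real ^ 'n \<Rightarrow> real ^ 'n ^ 'n) \<Rightarrow> (real ^ 'n \<Rightarrow> real) \<Rightarrow> real ^ 'n \<Rightarrow> real ^ 'n ^ 'n::finite" where
  "hessian G F x = (\<chi> i j. pd i (pd j F) x - (\<Sum>k\<in>UNIV. christoffel G k i j x * pd k F x))"

definition d_tensor_d :: "(real ^ 'n \<Rightarrow> real) \<Rightarrow> real ^ 'n \<Rightarrow> real ^ 'n ^ 'n::finite" where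
  "d_tensor_d F x = (\<chi> i j. pd i F x * pd j F x)"


section \<open>Riemannian distance\<close>

definition C1_curve_on :: "('a::topological_space, 'n::finite) chart set \<Rightarrow> real \<Rightarrow> real \<Rightarrow>
    (real \<Rightarrow> 'a) \<Rightarrow> bool" where
  "C1_curve_on A a b \<gamma> \<longleftrightarrow> continuous_on {a..b} \<gamma> \<and>
     (\<forall>c\<in>A. \<exists>D. continuous_on {t\<in>{a..b}. \<gamma> t \<in> chart_dom c} D \<and>
        (\<forall>t\<in>{a..b}. \<gamma> t \<in> chart_dom c \<longrightarrow>
           ((coord c \<circ> \<gamma>) has_vector_derivative D t) (at t within {a..b})))"

text \<open>\<open>S\<close> is the set of division points; the curve is C1 up to the endpoints on each closed piece.\<close>

definition piecewise_C1_curve ::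
    "('a::topological_space, 'n::finite) chart set \<Rightarrow> (real \<Rightarrow> 'a) \<Rightarrow> bool" where
  "piecewise_C1_curve A \<gamma> \<longleftrightarrow> (\<exists>S. finite S \<and> {0, 1} \<subseteq> S \<and> S \<subseteq> {0..1} \<and>
     (\<forall>a\<in>S. \<forall>b\<in>S. a < b \<and> {a<..<b} \<inter> S = {} \<longrightarrow> C1_curve_on A a b \<gamma>))"

text \<open>The norm of the velocity does not depend on the chart used. The finitely many \<open>t\<close> at which the
  derivative may fail to exist do not affect the length.\<close>

definition speed :: "('a, 'n::finite) chart set \<Rightarrow> ('a, 'n) tensor2 \<Rightarrow> (real \<Rightarrow> 'a) \<Rightarrow> real \<Rightarrow> real" where
  "speed A g \<gamma> t =
     (let c = (SOME c. c \<in> A \<and> \<gamma> t \<in> chart_dom c);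
          w = vector_derivative (coord c \<circ> \<gamma>) (at t)
      in sqrt (w \<bullet> (g c (coord c (\<gamma> t)) *v w)))"

definition curve_length ::
    "('a, 'n::finite) chart set \<Rightarrow> ('a, 'n) tensor2 \<Rightarrow> (real \<Rightarrow> 'a) \<Rightarrow> real" where
  "curve_length A g \<gamma> = integral {0..1} (speed A g \<gamma>)"

definition rdist ::
    "('a::topological_space, 'n::finite) chart set \<Rightarrow> ('a, 'n) tensor2 \<Rightarrow> 'a \<Rightarrow> 'a \<Rightarrow> real" where
  "rdist A g p q = Inf {curve_length A g \<gamma> | \<gamma>. piecewise_C1_curve A \<gamma> \<and> \<gamma> 0 = p \<and> \<gamma> 1 = q}"

definition complete_riemannian ::
    "('a::topological_space, 'n::finite) chart set \<Rightarrow> ('a, 'n) tensor2 \<Rightarrow> bool" where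
  "complete_riemannian A g \<longleftrightarrow> Metric_space.mcomplete UNIV (rdist A g)"

definition geodesic_ball ::
    "('a::topological_space, 'n::finite) chart set \<Rightarrow> ('a, 'n) tensor2 \<Rightarrow> 'a \<Rightarrow> real \<Rightarrow> 'a set" where
  "geodesic_ball A g q r = Metric_space.mball UNIV (rdist A g) q r"


section \<open>Riemannian volume\<close>

text \<open>The unique Borel measure with density \<open>\<surd>(det g)\<close> with respect to Lebesgue measure
  in every chart.\<close>

definition is_riemannian_volume ::
    "('a::topological_space, 'n::finite) chart set \<Rightarrow> ('a, 'n) tensor2 \<Rightarrow> 'a measure \<Rightarrow> bool" where
  "is_riemannian_volume A g \<mu> \<longleftrightarrow> sets \<mu> = sets borel \<and>
     (\<forall>c\<in>A. \<forall>E\<in>sets borel. E \<subseteq> chart_dom c \<longrightarrow>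
        emeasure \<mu> E = (\<integral>\<^sup>+x\<in>coord c ` E. ennreal (sqrt (det (g c x))) \<partial>lborel))"

definition riemannian_volume ::
    "('a::topological_space, 'n::finite) chart set \<Rightarrow> ('a, 'n) tensor2 \<Rightarrow> 'a measure" where
  "riemannian_volume A g = (THE \<mu>. is_riemannian_volume A g \<mu>)"


section \<open>Gradient generalized quasi-Einstein manifolds\<close>

definition generalized_quasi_einstein :: "('a::{t2_space, second_countable_topology}, 'n::finite) chart set \<Rightarrow>
    ('a, 'n) tensor2 \<Rightarrow> real \<Rightarrow> ('a \<Rightarrow> real) \<Rightarrow> ('a \<Rightarrow> real) \<Rightarrow> bool" where
  "generalized_quasi_einstein A g m f lam \<longleftrightarrow>
     (\<forall>c\<in>A. \<forall>p\<in>chart_dom c. let x = coord c p; F = f \<circ> chart_inv c in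
        ricci (g c) x + hessian (g c) F x - (1/m) *\<^sub>R d_tensor_d F x = lam p *\<^sub>R g c x)"

definition constant_scalar_curvature ::
    "('a, 'n::finite) chart set \<Rightarrow> ('a, 'n) tensor2 \<Rightarrow> real \<Rightarrow> bool" where
  "constant_scalar_curvature A g R \<longleftrightarrow>
     (\<forall>c\<in>A. \<forall>x\<in>chart_cod c. scalar_curvature (g c) x = R)"

end

theory Submission
  imports Defs
begin

text \<open>Tracing the quasi-Einstein equation gives
  \<open>\<Delta>f - |\<nabla>f|\<^sup>2/m = \<rho>\<close> with \<open>\<rho> = n \<lambda> - R > 0\<close>. Let \<open>\<phi>\<close> be the cutoff function of
  the distance from \<open>q\<close> which is 1 on \<open>B(q,r)\<close>, 0 outside \<open>B(q,2r)\<close> and Lipschitz with constant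
  \<open>1/r\<close>. Testing with \<open>\<phi>\<^sup>2\<close> gives
  \<open>\<integral>\<phi>\<^sup>2\<rho> + (1/m)\<integral>\<phi>\<^sup>2|\<nabla>f|\<^sup>2 \<le> (8n/r) \<integral>\<phi>|\<nabla>f|\<close>, and Young's inequality bounds \<open>\<integral>\<phi>\<^sup>2\<rho>\<close> by
  a multiple of \<open>Vol(B(q,3r))/r\<^sup>2\<close>, which tends to 0 for linear volume growth, although
  \<open>\<integral>\<phi>\<^sup>2\<rho>\<close> increases with \<open>r\<close> and is positive. Completeness makes the support of \<open>\<phi>\<close> compact
  (Hopf-Rinow). Since \<open>\<phi>\<close> is only Lipschitz, the integration by parts is carried out on difference
  quotients: in a small chart, along a basis adapted to the metric at one point, so that the
  constant does not depend on the chart.\<close>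

section \<open>Change of variables for an arbitrary finite index type\<close>

text \<open>The function u = exp (-f/m) is positive with \<Delta>u = -(\<rho>/m) u < 0, so the claim
  is a form of parabolicity: linear volume growth admits no such function. Working with f = -m log u
  gives the term |\<nabla>f|^2/m the good sign, and this term absorbs the gradient on the right-hand
  side. No almost-everywhere derivative of the cutoff is formed: translation invariance of Lebesgue
  measure moves difference quotients from one factor to the other, and only the Lipschitz bound
  enters. That bound speaks of directions of unit length for the metric, so divergences are expanded
  along n such directions; the resulting factor n is harmless, because any bound of order 1/r will
  do. The constant 8 is 2 * 2 * 2: one factor from d(\<phi>^2) = 2 \<phi> d\<phi>, two from
  comparing the metric in a small chart with its value at the centre. Distance and volume are given
  by an infimum and a definite description, so the metric axioms, the topology, and existence and
  uniqueness of the measure have to be established before either can be used.\<close>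

text \<open>The change of variables theorem of the library needs a well-ordered index type, so it is
  transferred along a bijection with a well-ordered copy of the index type.\<close>

typedef ('n::finite) ordered_index = "{..<CARD('n)}"
  by (rule exI[of _ 0]) simp

setup_lifting type_definition_ordered_index

instantiation ordered_index :: (finite) linorder
begin
lift_definition less_eq_ordered_index :: "'a ordered_index \<Rightarrow> 'a ordered_index \<Rightarrow> bool" is "(\<le>)" .
lift_definition less_ordered_index :: "'a ordered_index \<Rightarrow> 'a ordered_index \<Rightarrow> bool" is "(<)" .
instance by standard (transfer; auto)+
end

instance ordered_index :: (finite) finite
proof
  have "(UNIV :: 'a ordered_index set) = Abs_ordered_index ` {..<CARD('a)}"
    by (metis type_definition.Abs_image type_definition_ordered_index)
  then show "finite (UNIV :: 'a ordered_index set)" by (metis finite_imageI finite_lessThan)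
qed

instance ordered_index :: (finite) wellorder
proof
  fix P :: "'a ordered_index \<Rightarrow> bool" and a
  assume step: "\<And>x. (\<And>y. y < x \<Longrightarrow> P y) \<Longrightarrow> P x"
  show "P a"
    by (induction "Rep_ordered_index a" arbitrary: a rule: less_induct)
       (use step in \<open>auto simp: less_ordered_index.rep_eq\<close>)
qed

text \<open>Any bijection will do, since determinants and Lebesgue measure are invariant under
  renaming the coordinates.\<close>

definition from_index :: "'n::finite ordered_index \<Rightarrow> 'n" where
  "from_index = (SOME e. bij e)"

lemma bij_from_index: "bij (from_index :: 'n::finite ordered_index \<Rightarrow> 'n)"
proof -
  have "card (UNIV :: 'n ordered_index set) = CARD('n)"
    using type_definition.card[OF type_definition_ordered_index] by simp
  then have "\<exists>e :: 'n ordered_index \<Rightarrow> 'n. bij e"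
    by (intro finite_same_card_bij) auto
  then show ?thesis unfolding from_index_def by (rule someI_ex)
qed

text \<open>Conjugation with \<open>e\<close> is a sign-preserving bijection between the
  permutations of the two index types; rows and columns are renamed together, so no sign
  appears.\<close>

lemma det_reindex:
  fixes B :: "real^'n::finite^'n" and e :: "'m::finite \<Rightarrow> 'n"
  assumes e: "bij e"
  shows "det (\<chi> i j. B $ e i $ e j) = det B"
proof -
  have inj: "inj e" using e by (rule bij_is_inj)
  have "(\<Sum>q | q permutes (UNIV :: 'n set). of_int (sign q) * (\<Prod>i\<in>UNIV. B $ i $ q i)) =
    (\<Sum>p | p permutes (UNIV :: 'm set). of_int (sign (map_permutation UNIV e p)) *
      (\<Prod>i\<in>UNIV. B $ i $ map_permutation UNIV e p i))"
    by (rule sum.reindex_bij_betw[symmetric],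
        rule bij_betwI[where g = "map_permutation UNIV (inv e)"])
       (use e in \<open>auto intro!: map_permutation_permutes map_permutation_compose_inv
          bij_imp_bij_inv simp: bij_is_inj bij_is_surj surj_f_inv_f\<close>)
  also have "\<dots> = (\<Sum>p | p permutes (UNIV :: 'm set). of_int (sign p) * (\<Prod>i\<in>UNIV. B $ e i $ e (p i)))"
  proof (rule sum.cong)
    fix p assume "p \<in> {p. p permutes (UNIV :: 'm set)}"
    then have "sign (map_permutation UNIV e p) = sign p"
      using inj by (intro sign_map_permutation) auto
    moreover have "(\<Prod>i\<in>UNIV. B $ i $ map_permutation UNIV e p i) =
        (\<Prod>i\<in>UNIV. B $ e i $ map_permutation UNIV e p (e i))"
      using e by (intro prod.reindex_bij_betw[symmetric])
    ultimately show "of_int (sign (map_permutation UNIV e p)) * (\<Prod>i\<in>UNIV. B $ i $ map_permutation UNIV e p i) =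
      of_int (sign p) * (\<Prod>i\<in>UNIV. B $ e i $ e (p i))"
      using inj by (simp add: map_permutation_apply)
  qed auto
  finally show ?thesis by (simp add: det_def)
qed

text \<open>The link between Lebesgue integrals of nonnegative functions, in which the volume is
  expressed, and gauge integrals, in which the change of variables is expressed.\<close>

lemma nn_integral_eq_iff_has_integral:
  fixes f :: "'e::euclidean_space \<Rightarrow> real"
  assumes "f \<in> borel_measurable borel" "\<And>x. 0 \<le> f x" "0 \<le> r"
  shows "(\<integral>\<^sup>+x. ennreal (f x) \<partial>lborel) = ennreal r \<longleftrightarrow> (f has_integral r) UNIV"
  using nn_integral_has_integral[OF assms(1,2) _ assms(3)] nn_integral_has_integral_lborel[OF assms(1,2)]
  by auto

text \<open>The transformed integrand \<open>k\<close> is a function of its own, tied to the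
  Jacobian formula only on \<open>S\<close>: its measurability can then come from a globally defined
  density.\<close>

lemma nn_integral_change_of_variables_wellorder:
  fixes T :: "real^'n::{finite,wellorder} \<Rightarrow> real^'n::_"
  assumes S: "S \<in> sets borel" and TS: "T ` S \<in> sets borel"
    and T: "\<And>x. x \<in> S \<Longrightarrow> (T has_derivative T' x) (at x within S)" and inj: "inj_on T S"
    and h: "h \<in> borel_measurable borel" "\<And>x. 0 \<le> h x"
    and k: "k \<in> borel_measurable borel" "\<And>x. 0 \<le> k x"
    and eq: "\<And>x. x \<in> S \<Longrightarrow> k x = \<bar>det (matrix (T' x))\<bar> * h (T x)"
  shows "(\<integral>\<^sup>+y\<in>T ` S. ennreal (h y) \<partial>lborel) = (\<integral>\<^sup>+x\<in>S. ennreal (k x) \<partial>lborel)"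
proof -
  define H where "H y = (if y \<in> T ` S then h y else 0)" for y
  define K where "K y = (if y \<in> S then k y else 0)" for y
  have Hm: "H \<in> borel_measurable borel" "0 \<le> H x" for x
    unfolding H_def using TS h by auto
  have Km: "K \<in> borel_measurable borel" "0 \<le> K x" for x
    unfolding K_def using S k by auto
  have Hi: "(\<integral>\<^sup>+y\<in>T ` S. ennreal (h y) \<partial>lborel) = (\<integral>\<^sup>+y. ennreal (H y) \<partial>lborel)"
    by (intro nn_integral_cong) (auto simp: H_def indicator_def)
  have Ki: "(\<integral>\<^sup>+x\<in>S. ennreal (k x) \<partial>lborel) = (\<integral>\<^sup>+x. ennreal (K x) \<partial>lborel)"
    by (intro nn_integral_cong) (auto simp: K_def indicator_def)
  have Sl: "S \<in> sets lebesgue" using S by auto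
  have "(k has_integral b) S \<longleftrightarrow> (h has_integral b) (T ` S)" for b
  proof -
    \<comment> \<open>The theorem applied here concerns vector-valued integrands, hence the
      embedding of the reals into \<open>real^1\<close>.\<close>
    have 1: "((\<lambda>x. \<bar>det (matrix (T' x))\<bar> *\<^sub>R vec (h (T x)) :: real^1) absolutely_integrable_on S \<and>
        integral S (\<lambda>x. \<bar>det (matrix (T' x))\<bar> *\<^sub>R vec (h (T x)) :: real^1) = vec b) \<longleftrightarrow>
      ((\<lambda>y. vec (h y) :: real^1) absolutely_integrable_on (T ` S) \<and> integral (T ` S) (\<lambda>y. vec (h y) :: real^1) = vec b)"
      using has_absolute_integral_change_of_variables[OF Sl T inj, of "\<lambda>y. vec (h y) :: real^1" "vec b"] by simp
    have 2: "((\<lambda>x. \<bar>det (matrix (T' x))\<bar> * h (T x)) absolutely_integrable_on S \<and>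
        integral S (\<lambda>x. \<bar>det (matrix (T' x))\<bar> * h (T x)) = b) \<longleftrightarrow>
      (h absolutely_integrable_on (T ` S) \<and> integral (T ` S) h = b)"
    proof -
      have v: "(\<lambda>x. \<bar>det (matrix (T' x))\<bar> *\<^sub>R vec (h (T x)) :: real^1) = (\<lambda>x. vec (\<bar>det (matrix (T' x))\<bar> * h (T x)))"
        by (simp add: vec_eq_iff fun_eq_iff)
      have w: "(f absolutely_integrable_on X \<and> integral X f = b) \<longleftrightarrow>
        ((\<lambda>x. vec (f x) :: real^1) absolutely_integrable_on X \<and> integral X (\<lambda>x. vec (f x) :: real^1) = vec b)" 
        for f X
      proof -
        have "(\<lambda>x. vec (f x) :: real^1) absolutely_integrable_on X \<longleftrightarrow> f absolutely_integrable_on X"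
          by (simp add: absolutely_integrable_on_1_iff o_def)
        moreover have "f absolutely_integrable_on X \<Longrightarrow> integral X (\<lambda>x. vec (f x) :: real^1) = vec b \<longleftrightarrow> integral X f = b"
          by (simp add: integral_on_1_eq o_def vec_eq_iff)
        ultimately show ?thesis by blast
      qed
      show ?thesis using 1 unfolding v w .
    qed
    have 3: "(f has_integral b) X \<longleftrightarrow> f absolutely_integrable_on X \<and> integral X f = b" if "\<And>x. x \<in> X \<Longrightarrow> 0 \<le> f x"
      for f :: "real^'n::_ \<Rightarrow> real" and X
      using nonnegative_absolutely_integrable_1[of f X] that by (auto simp: has_integral_iff absolutely_integrable_on_def)
    have "(k has_integral b) S \<longleftrightarrow> ((\<lambda>x. \<bar>det (matrix (T' x))\<bar> * h (T x)) has_integral b) S"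
      using eq by (intro has_integral_cong) auto
    then show ?thesis using 2 3[of S "\<lambda>x. \<bar>det (matrix (T' x))\<bar> * h (T x)"] 3[of "T ` S" h] h(2) by simp
  qed
  moreover have "(K has_integral b) UNIV \<longleftrightarrow> (k has_integral b) S" for b
    using has_integral_restrict_UNIV[of S k b] unfolding K_def by simp
  moreover have "(H has_integral b) UNIV \<longleftrightarrow> (h has_integral b) (T ` S)" for b
    using has_integral_restrict_UNIV[of "T ` S" h b] unfolding H_def by simp
  \<comment> \<open>Two elements of [0, \<infinity>] that equal the same finite values are equal;
    infinite integrals are thereby covered without a separate case.\<close>
  ultimately have "0 \<le> b \<Longrightarrow> (\<integral>\<^sup>+y. ennreal (H y) \<partial>lborel) = ennreal b \<longleftrightarrow> (\<integral>\<^sup>+y. ennreal (K y) \<partial>lborel) = ennreal b" for b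
    using nn_integral_eq_iff_has_integral[OF Hm, of b] nn_integral_eq_iff_has_integral[OF Km, of b] by simp
  then have "(\<integral>\<^sup>+y. ennreal (H y) \<partial>lborel) = (\<integral>\<^sup>+y. ennreal (K y) \<partial>lborel)"
    by (metis ennreal_cases)
  then show ?thesis using Hi Ki by simp
qed

definition reindex :: "('m \<Rightarrow> 'n) \<Rightarrow> real^'n::finite \<Rightarrow> real^'m::finite" where
  "reindex e x = (\<chi> i. x $ e i)"

lemma linear_reindex: "linear (reindex e)"
  by (rule linearI) (auto simp: reindex_def vec_eq_iff)

lemma reindex_inverse:
  assumes "bij e"
  shows "reindex (inv e) (reindex e x) = x" "reindex e (reindex (inv e) y) = y"
  using assms by (auto simp: reindex_def vec_eq_iff bij_is_inj bij_is_surj surj_f_inv_f)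

lemma reindex_measurable [measurable]: "reindex e \<in> borel_measurable borel"
  by (intro borel_measurable_continuous_onI linear_continuous_on linear_conv_bounded_linear[THEN iffD1] linear_reindex)

text \<open>Boxes pull back to boxes with permuted sides, and Lebesgue measure is determined by its
  values on boxes.\<close>

lemma distr_reindex_lborel:
  assumes e: "bij (e :: 'm::finite \<Rightarrow> 'n::finite)"
  shows "distr lborel borel (reindex e) = lborel"
proof (rule lborel_eqI[symmetric])
  fix l u :: "real^'m"
  assume le: "\<And>b. b \<in> Basis \<Longrightarrow> l \<bullet> b \<le> u \<bullet> b"
  have le': "l $ i \<le> u $ i" for i using le[of "axis i 1"] by (simp add: inner_axis axis_in_Basis_iff)
  have prodB: "(\<Prod>b\<in>Basis. x \<bullet> b) = (\<Prod>i\<in>UNIV. x $ i)" for x :: "real^'k::finite"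
  proof -
    have "inj (\<lambda>i::'k. axis i (1::real))" by (auto simp: inj_on_def axis_eq_axis)
    moreover have "(Basis :: (real^'k) set) = range (\<lambda>i. axis i 1)" by (auto simp: Basis_vec_def)
    ultimately show ?thesis
      using prod.reindex[of "\<lambda>i::'k. axis i (1::real)" UNIV "\<lambda>b. x \<bullet> b"] by (simp add: inner_axis o_def)
  qed
  have pre: "reindex e -` box l u = box (reindex (inv e) l) (reindex (inv e) u)"
    using e by (auto simp: mem_box_cart reindex_def bij_is_inj) (metis bij_inv_eq_iff e)+
  have "emeasure (distr lborel borel (reindex e)) (box l u) = emeasure lborel (reindex e -` box l u)"
    by (subst emeasure_distr) auto
  also have "\<dots> = (\<Prod>b\<in>Basis. (reindex (inv e) u - reindex (inv e) l) \<bullet> b)"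
    unfolding pre by (rule emeasure_lborel_box) (use le' in \<open>auto simp: Basis_vec_def inner_axis reindex_def\<close>)
  also have "\<dots> = (\<Prod>b\<in>Basis. (u - l) \<bullet> b)"
    unfolding prodB using prod.reindex_bij_betw[OF bij_imp_bij_inv[OF e], of "\<lambda>i. u $ i - l $ i"]
    by (simp add: reindex_def)
  finally show "emeasure (distr lborel borel (reindex e)) (box l u) = (\<Prod>b\<in>Basis. (u - l) \<bullet> b)" .
qed simp

text \<open>\<open>T\<close> is conjugated by the coordinate renaming, which preserves Lebesgue
  measure by \<open>distr_reindex_lborel\<close> and the Jacobian determinant by
  \<open>det_reindex\<close>.\<close>

lemma nn_integral_change_of_variables:
  fixes T :: "real^'n::finite \<Rightarrow> real^'n"
  assumes S: "S \<in> sets borel" and TS: "T ` S \<in> sets borel"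
    and T: "\<And>x. x \<in> S \<Longrightarrow> (T has_derivative T' x) (at x within S)" and inj: "inj_on T S"
    and h: "h \<in> borel_measurable borel" "\<And>x. 0 \<le> h x"
    and k: "k \<in> borel_measurable borel" "\<And>x. 0 \<le> k x"
    and eq: "\<And>x. x \<in> S \<Longrightarrow> k x = \<bar>det (matrix (T' x))\<bar> * h (T x)"
  shows "(\<integral>\<^sup>+y\<in>T ` S. ennreal (h y) \<partial>lborel) = (\<integral>\<^sup>+x\<in>S. ennreal (k x) \<partial>lborel)"
proof -
  define e where "e = (from_index :: 'n ordered_index \<Rightarrow> 'n)"
  have e: "bij e" unfolding e_def by (rule bij_from_index)
  have e': "bij (inv e)" by (rule bij_imp_bij_inv[OF e])
  define L where "L = (reindex (inv e) :: real^'n ordered_index \<Rightarrow> real^'n)"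
  define M where "M = (reindex e :: real^'n \<Rightarrow> real^'n ordered_index)"
  have MoL: "M (L x) = x" and LoM: "L (M y) = y" for x y
    using reindex_inverse[OF e] by (auto simp: L_def M_def)
  have lin: "linear L" "linear M" by (simp_all add: L_def M_def linear_reindex)
  have meas[measurable]: "L \<in> borel_measurable borel" "M \<in> borel_measurable borel" by (simp_all add: L_def M_def)
  have img: "M ` X = L -` X" for X by (force simp: MoL LoM image_iff)
  have pre: "(\<integral>\<^sup>+y\<in>X. ennreal (f y) \<partial>lborel) = (\<integral>\<^sup>+x\<in>M ` X. ennreal (f (L x)) \<partial>lborel)"
    if [measurable]: "f \<in> borel_measurable borel" "X \<in> sets borel" for f and X :: "(real^'n) set"
  proof -
    have "(\<integral>\<^sup>+y\<in>X. ennreal (f y) \<partial>lborel) = (\<integral>\<^sup>+y\<in>X. ennreal (f y) \<partial>(distr lborel borel L))"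
      unfolding L_def by (subst distr_reindex_lborel[OF e']) simp
    also have "\<dots> = (\<integral>\<^sup>+x. ennreal (f (L x)) * indicator X (L x) \<partial>lborel)"
      by (subst nn_integral_distr) auto
    also have "\<dots> = (\<integral>\<^sup>+x\<in>M ` X. ennreal (f (L x)) \<partial>lborel)"
      by (simp add: img indicator_def)
    finally show ?thesis .
  qed
  define T2 where "T2 = M \<circ> T \<circ> L"
  have sets_img: "M ` X \<in> sets borel" if "X \<in> sets borel" for X
    unfolding img using that measurable_sets_borel[OF meas(1)] by simp
  have "(\<integral>\<^sup>+y\<in>T2 ` (M ` S). ennreal (h (L y)) \<partial>lborel) = (\<integral>\<^sup>+x\<in>M ` S. ennreal (k (L x)) \<partial>lborel)"
  proof (rule nn_integral_change_of_variables_wellorder[where T' = "\<lambda>x. M \<circ> T' (L x) \<circ> L"])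
    show "M ` S \<in> sets borel" using S by (rule sets_img)
    have "T2 ` (M ` S) = M ` (T ` S)" by (auto simp: T2_def LoM image_iff)
    then show "T2 ` (M ` S) \<in> sets borel" using sets_img TS by simp
    show "(T2 has_derivative (M \<circ> T' (L x) \<circ> L)) (at x within M ` S)" if "x \<in> M ` S" for x
    proof -
      have x: "L x \<in> S" using that by (auto simp: LoM)
      have LS: "L ` M ` S = S" by (auto simp: LoM image_iff)
      have "(L has_derivative L) (at x within M ` S)" by (simp add: lin linear_imp_has_derivative)
      moreover have "(T has_derivative T' (L x)) (at (L x) within L ` M ` S)"
        unfolding LS by (rule T[OF x])
      ultimately have "(T \<circ> L has_derivative T' (L x) \<circ> L) (at x within M ` S)"
        by (rule diff_chain_within)
      then show ?thesis unfolding T2_def comp_assoc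
        by (rule diff_chain_within) (simp add: lin linear_imp_has_derivative)
    qed
    show "inj_on T2 (M ` S)"
    proof (rule inj_onI)
      fix x y assume "x \<in> M ` S" "y \<in> M ` S" "T2 x = T2 y"
      then show "x = y" using inj unfolding T2_def inj_on_def by (metis LoM MoL comp_apply imageE)
    qed
    show "(\<lambda>y. h (L y)) \<in> borel_measurable borel" "(\<lambda>x. k (L x)) \<in> borel_measurable borel"
      using h(1) k(1) by measurable
    show "k (L x) = \<bar>det (matrix (M \<circ> T' (L x) \<circ> L))\<bar> * h (L (T2 x))" if "x \<in> M ` S" for x
    proof -
      have x: "L x \<in> S" using that by (auto simp: LoM)
      have Lax: "L (axis j 1) = axis (e j) 1" for j
        using e by (auto simp: L_def reindex_def vec_eq_iff axis_def bij_is_inj) (metis bij_inv_eq_iff e)+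
      then have "matrix (M \<circ> T' (L x) \<circ> L) = (\<chi> i j. matrix (T' (L x)) $ e i $ e j)"
        unfolding matrix_def M_def reindex_def by (simp add: Lax)
      then have "det (matrix (M \<circ> T' (L x) \<circ> L)) = det (matrix (T' (L x)))"
        using det_reindex[OF e] by simp
      then show ?thesis using eq[OF x] by (simp add: T2_def LoM)
    qed
  qed (use h k in auto)
  moreover have "T2 ` (M ` S) = M ` (T ` S)" by (auto simp: T2_def LoM image_iff)
  ultimately show ?thesis using pre[OF h(1) TS] pre[OF k(1) S] by simp
qed

section \<open>Continuously differentiable functions of several variables\<close>

text \<open>Expressed through \<open>pd\<close>, the operator from which Christoffel symbols and
  Hessians are built, so that coordinate formulas can be differentiated directly.\<close>

definition C1_on :: "(real^'n::finite) set \<Rightarrow> (real^'n \<Rightarrow> real) \<Rightarrow> bool" where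
  "C1_on S f \<longleftrightarrow> (\<forall>x\<in>S. f differentiable (at x)) \<and> (\<forall>i. continuous_on S (pd i f))"

lemma frechet_derivative_eq_pd:
  assumes "f differentiable (at x)"
  shows "frechet_derivative f (at x) v = (\<Sum>i\<in>UNIV. v $ i * pd i f x)"
proof -
  have lin: "linear (frechet_derivative f (at x))"
    using assms by (rule linear_frechet_derivative)
  have "v = (\<Sum>i\<in>UNIV. v $ i *\<^sub>R axis i 1)"
    by (simp add: vec_eq_iff axis_def if_distrib cong: if_cong)
  then have "frechet_derivative f (at x) v = frechet_derivative f (at x) (\<Sum>i\<in>UNIV. v $ i *\<^sub>R axis i 1)"
    by simp
  also have "\<dots> = (\<Sum>i\<in>UNIV. v $ i * pd i f x)"
    by (simp add: linear_sum[OF lin] linear_scale[OF lin] pd_def)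
  finally show ?thesis .
qed

lemma has_derivative_pd:
  assumes "f differentiable (at x)"
  shows "(f has_derivative (\<lambda>v. \<Sum>i\<in>UNIV. v $ i * pd i f x)) (at x)"
proof -
  have "frechet_derivative f (at x) = (\<lambda>v. \<Sum>i\<in>UNIV. v $ i * pd i f x)"
    by (rule ext) (rule frechet_derivative_eq_pd[OF assms])
  moreover have "(f has_derivative frechet_derivative f (at x)) (at x)"
    using assms by (simp add: frechet_derivative_works)
  ultimately show ?thesis by simp
qed

lemma pd_eqI: "(f has_derivative f') (at x) \<Longrightarrow> pd i f x = f' (axis i 1)"
  using frechet_derivative_at[of f f' x] by (simp add: pd_def)

lemma C1_onI:
  assumes "\<And>x. x \<in> S \<Longrightarrow> (f has_derivative f' x) (at x)"
    and "\<And>i. continuous_on S (\<lambda>x. f' x (axis i 1))"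
  shows "C1_on S f"
  unfolding C1_on_def
proof (intro conjI ballI allI)
  show "f differentiable (at x)" if "x \<in> S" for x using assms(1)[OF that] by (auto simp: differentiable_def)
  show "continuous_on S (pd i f)" for i
    using assms(2)[of i] by (rule continuous_on_eq) (simp add: pd_eqI[OF assms(1)])
qed

lemma C1_onD:
  assumes "C1_on S f"
  shows "x \<in> S \<Longrightarrow> f differentiable (at x)" and "continuous_on S (pd i f)"
  using assms by (auto simp: C1_on_def)

lemma C1_on_has_derivative:
  "C1_on S f \<Longrightarrow> x \<in> S \<Longrightarrow> (f has_derivative (\<lambda>v. \<Sum>i\<in>UNIV. v $ i * pd i f x)) (at x)"
  by (intro has_derivative_pd C1_onD)

lemma C1_on_continuous: "C1_on S f \<Longrightarrow> continuous_on S f"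
  by (meson C1_onD(1) continuous_at_imp_continuous_on differentiable_imp_continuous_within)

lemma C1_on_Un:
  assumes "open S" "open T" "C1_on S f" "C1_on T f"
  shows "C1_on (S \<union> T) f"
  using assms unfolding C1_on_def by (auto intro: continuous_on_open_Un)

text \<open>Both sides are Hilbert choices over the same predicate, so they agree even where no
  derivative exists.\<close>

lemma pd_cong:
  assumes "open S" "x \<in> S" "\<And>y. y \<in> S \<Longrightarrow> f y = h y"
  shows "pd i f x = pd i h x"
proof -
  have "(f has_derivative D) (at x) \<longleftrightarrow> (h has_derivative D) (at x)" for D
    using assms has_derivative_transform_within_open[of f D x UNIV S h]
      has_derivative_transform_within_open[of h D x UNIV S f] by auto
  then show ?thesis by (simp add: pd_def frechet_derivative_def)
qed

lemma C1_on_cong: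
  assumes S: "open S" and f: "C1_on S f" and eq: "\<And>y. y \<in> S \<Longrightarrow> f y = h y"
  shows "C1_on S h"
proof (rule C1_onI)
  show "(h has_derivative (\<lambda>v. \<Sum>i\<in>UNIV. v $ i * pd i f x)) (at x)" if x: "x \<in> S" for x
    using C1_on_has_derivative[OF f x] by (rule has_derivative_transform_within_open[OF _ S x]) (simp add: eq)
  show "continuous_on S (\<lambda>x. \<Sum>j\<in>UNIV. axis i 1 $ j * pd j f x)" for i
    by (intro continuous_intros C1_onD[OF f])
qed

lemma C1_on_const: "C1_on S (\<lambda>_. c)"
  by (rule C1_onI[where f' = "\<lambda>_ _. 0"]) auto

lemma C1_on_coordinate: "C1_on S (\<lambda>x. x $ i)"
  by (rule C1_onI[where f' = "\<lambda>_ v. v $ i"]) (auto intro!: bounded_linear_imp_has_derivative)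

lemma C1_on_add: "C1_on S f \<Longrightarrow> C1_on S h \<Longrightarrow> C1_on S (\<lambda>x. f x + h x)"
  by (rule C1_onI, rule has_derivative_add[OF C1_on_has_derivative C1_on_has_derivative])
     (auto intro!: continuous_intros C1_onD)

lemma C1_on_mult: "C1_on S f \<Longrightarrow> C1_on S h \<Longrightarrow> C1_on S (\<lambda>x. f x * h x)"
  by (rule C1_onI, rule has_derivative_mult[OF C1_on_has_derivative C1_on_has_derivative])
     (assumption | intro continuous_intros C1_onD(2) C1_on_continuous)+

lemma C1_on_compose_real:
  assumes f: "C1_on S f" and u: "\<And>x. x \<in> S \<Longrightarrow> (u has_real_derivative u' (f x)) (at (f x))"
    and cont: "continuous_on (f ` S) u'"
  shows "C1_on S (\<lambda>x. u (f x))"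
proof (rule C1_onI)
  fix x assume x: "x \<in> S"
  show "((\<lambda>x. u (f x)) has_derivative (\<lambda>v. u' (f x) * (\<Sum>i\<in>UNIV. v $ i * pd i f x))) (at x)"
    using has_derivative_compose[OF C1_on_has_derivative[OF f x], of u "(*) (u' (f x))"] u[OF x]
    by (simp add: has_field_derivative_def)
next
  have "continuous_on S (\<lambda>x. u' (f x))"
    using continuous_on_compose2[OF cont C1_on_continuous[OF f]] by auto
  then show "continuous_on S (\<lambda>x. u' (f x) * (\<Sum>j\<in>UNIV. axis i 1 $ j * pd j f x))" for i
    by (intro continuous_intros C1_onD[OF f])
qed

lemma C1_on_compose_map:
  fixes T :: "real^'m::finite \<Rightarrow> real^'n::finite"
  assumes f: "C1_on U f" and T: "\<And>k. C1_on S (\<lambda>x. T x $ k)" and sub: "T ` S \<subseteq> U"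
  shows "C1_on S (\<lambda>x. f (T x))"
    and "x \<in> S \<Longrightarrow> pd i (\<lambda>x. f (T x)) x = (\<Sum>k\<in>UNIV. pd k f (T x) * pd i (\<lambda>x. T x $ k) x)"
proof -
  have der: "((\<lambda>x. f (T x)) has_derivative (\<lambda>v. \<Sum>k\<in>UNIV. (\<Sum>i\<in>UNIV. v $ i * pd i (\<lambda>x. T x $ k) x) * pd k f (T x))) (at x)"
    if x: "x \<in> S" for x
  proof -
    have "(T has_derivative (\<lambda>v. \<chi> k. \<Sum>i\<in>UNIV. v $ i * pd i (\<lambda>x. T x $ k) x)) (at x)"
      using C1_on_has_derivative[OF T x] 
      by (subst has_derivative_componentwise_within) (auto simp: Basis_vec_def inner_axis)
    moreover have "(f has_derivative (\<lambda>v. \<Sum>k\<in>UNIV. v $ k * pd k f (T x))) (at (T x))"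
      by (rule C1_on_has_derivative[OF f]) (use sub x in blast)
    ultimately show ?thesis using has_derivative_compose by fastforce
  qed
  have contT: "continuous_on S T"
    using C1_on_continuous[OF T] by (subst continuous_on_componentwise) (auto simp: Basis_vec_def inner_axis)
  have contf: "continuous_on S (\<lambda>x. pd k f (T x))" for k
    using continuous_on_compose2[OF C1_onD(2)[OF f] contT sub] .
  show "C1_on S (\<lambda>x. f (T x))"
    by (rule C1_onI, erule der) (intro continuous_intros C1_onD[OF T] contf)
  show "pd i (\<lambda>x. f (T x)) x = (\<Sum>k\<in>UNIV. pd k f (T x) * pd i (\<lambda>x. T x $ k) x)" if "x \<in> S"
    unfolding pd_eqI[OF der[OF that]]
    by (rule sum.cong[OF refl]) (simp add: axis_def if_distrib[of "\<lambda>u. u * _"] cong: if_cong)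
qed

lemma C1_on_sum: "(\<And>i. i \<in> I \<Longrightarrow> C1_on S (f i)) \<Longrightarrow> C1_on S (\<lambda>x. \<Sum>i\<in>I. f i x)"
  by (induction I rule: infinite_finite_induct) (auto intro: C1_on_const C1_on_add)

lemma C1_on_prod: "(\<And>i. i \<in> I \<Longrightarrow> C1_on S (f i)) \<Longrightarrow> C1_on S (\<lambda>x. \<Prod>i\<in>I. f i x)"
  by (induction I rule: infinite_finite_induct) (auto intro: C1_on_const C1_on_mult)

lemma C1_on_diff: "C1_on S f \<Longrightarrow> C1_on S h \<Longrightarrow> C1_on S (\<lambda>x. f x - h x)"
  using C1_on_add[OF _ C1_on_mult[OF C1_on_const[of S "-1"]], of f h] by simp

lemma C1_on_divide:
  assumes "C1_on S f" "C1_on S h" "\<And>x. x \<in> S \<Longrightarrow> h x \<noteq> 0"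
  shows "C1_on S (\<lambda>x. f x / h x)"
proof -
  have "C1_on S (\<lambda>x. inverse (h x))"
    by (rule C1_on_compose_real[where u' = "\<lambda>t. - (inverse t ^ Suc (Suc 0))", OF assms(2)])
      (rule DERIV_inverse, erule assms(3), auto intro!: continuous_intros simp: assms(3))
  from C1_on_mult[OF assms(1) this] show ?thesis by (simp add: divide_inverse)
qed

lemma C1_on_sqrt:
  assumes "C1_on S f" "\<And>x. x \<in> S \<Longrightarrow> f x > 0"
  shows "C1_on S (\<lambda>x. sqrt (f x))"
proof (rule C1_on_compose_real[where u' = "\<lambda>t. inverse (sqrt t) / 2", OF assms(1)])
  show "continuous_on (f ` S) (\<lambda>t. inverse (sqrt t) / 2)"
    by (intro continuous_intros) (use assms(2) in force)+
qed (use assms(2) in \<open>auto intro: DERIV_real_sqrt\<close>)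

lemma C1_on_det: "(\<And>i j. C1_on S (\<lambda>x. A x $ i $ j)) \<Longrightarrow> C1_on S (\<lambda>x. det (A x))"
  unfolding det_def by (intro C1_on_sum C1_on_mult C1_on_const C1_on_prod)

lemma pd_mult:
  assumes "f differentiable (at x)" "h differentiable (at x)"
  shows "pd i (\<lambda>y. f y * h y) x = f x * pd i h x + pd i f x * h x"
  using pd_eqI[OF has_derivative_mult[OF has_derivative_pd has_derivative_pd], OF assms, of i]
  by (simp add: axis_def if_distrib[of "\<lambda>u. u * _"] cong: if_cong)

lemma pd_sum:
  assumes "\<And>k. k \<in> I \<Longrightarrow> f k differentiable (at x)"
  shows "pd i (\<lambda>y. \<Sum>k\<in>I. f k y) x = (\<Sum>k\<in>I. pd i (f k) x)"
  using pd_eqI[OF has_derivative_sum[of I f "\<lambda>k v. \<Sum>i\<in>UNIV. v $ i * pd i (f k) x" "at x"], OF has_derivative_pd, OF assms, of i]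
  by (simp add: axis_def if_distrib[of "\<lambda>u. u * _"] cong: if_cong)

lemma pd_const: "pd i (\<lambda>_. c) x = 0"
  using pd_eqI[of "\<lambda>_. c" "\<lambda>_. 0" x i] by simp

section \<open>Derivatives of determinants and inverse matrices\<close>

text \<open>The determinant is linear in each row, so by the product rule one row at a time is
  differentiated.\<close>

lemma has_derivative_det:
  fixes B :: "'e::real_normed_vector \<Rightarrow> real^'n::finite^'n"
  assumes D: "\<And>a b. ((\<lambda>y. B y $ a $ b) has_derivative D a b) (at x)"
  shows "((\<lambda>y. det (B y)) has_derivative
    (\<lambda>v. \<Sum>a\<in>UNIV. det (\<chi> r. if r = a then (\<chi> b. D a b v) else B x $ r))) (at x)"
proof -
  have "((\<lambda>y. det (B y)) has_derivative
    (\<lambda>v. \<Sum>p | p permutes (UNIV :: 'n set). of_int (sign p) *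
        (\<Sum>a\<in>UNIV. D a (p a) v * (\<Prod>j\<in>UNIV - {a}. B x $ j $ p j)))) (at x)"
    unfolding det_def by (intro has_derivative_sum has_derivative_mult_right has_derivative_prod D)
  moreover have "(\<Sum>p | p permutes (UNIV :: 'n set). of_int (sign p) *
        (\<Sum>a\<in>UNIV. D a (p a) v * (\<Prod>j\<in>UNIV - {a}. B x $ j $ p j))) =
    (\<Sum>a\<in>UNIV. det (\<chi> r. if r = a then (\<chi> b. D a b v) else B x $ r))" for v
  proof -
    have "(\<Prod>i\<in>UNIV. (\<chi> r. if r = a then (\<chi> b. D a b v) else B x $ r) $ i $ p i) =
      D a (p a) v * (\<Prod>j\<in>UNIV - {a}. B x $ j $ p j)" for a p
      by (subst prod.remove[of UNIV a]) auto
    then show ?thesis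
      unfolding det_def by (simp add: sum_distrib_left) (rule sum.swap)
  qed
  ultimately show ?thesis by simp
qed

lemma matrix_inv_mult:
  fixes B :: "real^'n::finite^'n"
  assumes "det B \<noteq> 0"
  shows "B ** matrix_inv B = mat 1" "matrix_inv B ** B = mat 1"
  using assms someI_ex[of "\<lambda>B'. B ** B' = mat 1 \<and> B' ** B = mat 1"]
  by (auto simp: invertible_det_nz[symmetric] invertible_def matrix_inv_def)

text \<open>Cramer's rule for rows: with \<open>d\<close> written as a combination of the rows of
  \<open>B\<close>, only the coefficient of row \<open>a\<close> survives, and the vector of
  coefficients is \<open>d\<close> times the inverse matrix.\<close>

lemma det_replace_row:
  fixes B :: "real^'n::finite^'n"
  assumes "det B \<noteq> 0"
  shows "det (\<chi> r. if r = a then d else B $ r) = (\<Sum>b\<in>UNIV. d $ b * matrix_inv B $ b $ a) * det B"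
proof -
  define c where "c = d v* matrix_inv B"
  have "c v* B = d" unfolding c_def vector_matrix_mul_assoc matrix_inv_mult(2)[OF assms] by simp
  then have "(\<Sum>i\<in>UNIV. c $ i *s row i B) = d"
    by (auto simp: vec_eq_iff vector_matrix_mult_def row_def mult.commute)
  moreover have "row i B = B $ i" for i by (simp add: row_def vec_eq_iff)
  moreover have "c $ a = (\<Sum>b\<in>UNIV. d $ b * matrix_inv B $ b $ a)"
    by (simp add: c_def vector_matrix_mult_def mult.commute)
  ultimately show ?thesis
    using cramer_lemma_transpose[of a c B] by (simp cong: if_cong)
qed

text \<open>Jacobi's formula: the derivative of det B is det B times the trace of B^-1 dB.\<close>

lemma pd_det:
  assumes D: "\<And>a b. (\<lambda>y. B y $ a $ b) differentiable (at x)" and "det (B x) \<noteq> 0"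
  shows "pd i (\<lambda>y. det (B y)) x =
    (\<Sum>a\<in>UNIV. \<Sum>b\<in>UNIV. pd i (\<lambda>y. B y $ a $ b) x * matrix_inv (B x) $ b $ a) * det (B x)"
proof -
  have "((\<lambda>y. B y $ a $ b) has_derivative (\<lambda>v. \<Sum>i\<in>UNIV. v $ i * pd i (\<lambda>y. B y $ a $ b) x)) (at x)" for a b
    by (intro has_derivative_pd D)
  from pd_eqI[OF has_derivative_det, OF this, of i] show ?thesis
    by (simp add: det_replace_row[OF assms(2)] sum_distrib_right axis_def if_distrib[of "\<lambda>u. u * _"] cong: if_cong)
qed

text \<open>Cramer's rule applied to a unit vector. It exhibits the entries of the inverse as
  quotients of polynomials in the entries of \<open>B\<close>, whence the regularity of the inverse
  metric.\<close>

lemma matrix_inv_entry: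
  fixes B :: "real^'n::finite^'n"
  assumes "det B \<noteq> 0"
  shows "matrix_inv B $ k $ l = det (\<chi> i j. if j = k then axis l 1 $ i else B $ i $ j) / det B"
proof -
  have "B *v (matrix_inv B *v axis l 1) = axis l 1"
    by (simp add: matrix_vector_mul_assoc matrix_inv_mult(1)[OF assms])
  then have "matrix_inv B *v axis l 1 = (\<chi> k. det (\<chi> i j. if j = k then axis l 1 $ i else B $ i $ j) / det B)"
    by (simp only: cramer[OF assms])
  moreover have "(matrix_inv B *v axis l 1) $ k = matrix_inv B $ k $ l"
    by (simp add: matrix_vector_mult_def axis_def if_distrib cong: if_cong)
  ultimately show ?thesis by (simp only: vec_lambda_beta)
qed

lemma C1_on_matrix_inv:
  assumes "open S" and B: "\<And>a b. C1_on S (\<lambda>x. B x $ a $ b)" and nz: "\<And>x. x \<in> S \<Longrightarrow> det (B x) \<noteq> 0"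
  shows "C1_on S (\<lambda>x. matrix_inv (B x) $ k $ l)"
proof -
  have "C1_on S (\<lambda>x. det (\<chi> i j. if j = k then axis l 1 $ i else B x $ i $ j) / det (B x))"
  proof (intro C1_on_divide C1_on_det nz B)
    show "C1_on S (\<lambda>x. (\<chi> i j. if j = k then axis l 1 $ i else B x $ i $ j) $ i $ j)" for i j
      by (cases "j = k") (simp_all add: C1_on_const B)
  qed
  then show ?thesis
    by (rule C1_on_cong[OF \<open>open S\<close>]) (simp add: matrix_inv_entry nz)
qed

text \<open>The product rule applied to B B^-1 = 1, multiplied from the left by B^-1, gives d(B^-1)
  = - B^-1 (dB) B^-1.\<close>

lemma pd_matrix_inv:
  assumes S: "open S" and B: "\<And>a b. C1_on S (\<lambda>x. B x $ a $ b)" and nz: "\<And>x. x \<in> S \<Longrightarrow> det (B x) \<noteq> 0"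
    and x: "x \<in> S"
  shows "pd i (\<lambda>y. matrix_inv (B y) $ k $ l) x =
    - (\<Sum>a\<in>UNIV. \<Sum>b\<in>UNIV. matrix_inv (B x) $ k $ a * pd i (\<lambda>y. B y $ a $ b) x * matrix_inv (B x) $ b $ l)"
proof -
  define h where "h k l y = matrix_inv (B y) $ k $ l" for k l y
  have h: "C1_on S (h k l)" for k l unfolding h_def[abs_def] by (rule C1_on_matrix_inv[OF S B nz])
  have Bh: "(\<Sum>b\<in>UNIV. B y $ a $ b * h b l y) = (if a = l then 1 else 0)" if "y \<in> S" for y a l
    using arg_cong[OF matrix_inv_mult(1)[OF nz[OF that]], of "\<lambda>M. M $ a $ l"]
    by (simp add: matrix_matrix_mult_def h_def mat_def)
  have hB: "(\<Sum>a\<in>UNIV. h k a x * B x $ a $ b) = (if k = b then 1 else 0)" for k b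
    using arg_cong[OF matrix_inv_mult(2)[OF nz[OF x]], of "\<lambda>M. M $ k $ b"]
    by (simp add: matrix_matrix_mult_def h_def mat_def)
  have 0: "(\<Sum>b\<in>UNIV. B x $ a $ b * pd i (h b l) x + pd i (\<lambda>y. B y $ a $ b) x * h b l x) = 0" for a
  proof -
    have "0 = pd i (\<lambda>y. \<Sum>b\<in>UNIV. B y $ a $ b * h b l y) x"
      using pd_cong[where i = i, OF S x Bh] by (simp add: pd_const)
    also have "\<dots> = (\<Sum>b\<in>UNIV. B x $ a $ b * pd i (h b l) x + pd i (\<lambda>y. B y $ a $ b) x * h b l x)"
      by (simp add: pd_sum pd_mult differentiable_mult C1_onD(1)[OF B x] C1_onD(1)[OF h x])
    finally show ?thesis by simp
  qed
  have "0 = (\<Sum>a\<in>UNIV. h k a x * (\<Sum>b\<in>UNIV. B x $ a $ b * pd i (h b l) x + pd i (\<lambda>y. B y $ a $ b) x * h b l x))"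
    by (simp add: 0)
  also have "\<dots> = (\<Sum>a\<in>UNIV. \<Sum>b\<in>UNIV. h k a x * B x $ a $ b * pd i (h b l) x)
      + (\<Sum>a\<in>UNIV. \<Sum>b\<in>UNIV. h k a x * pd i (\<lambda>y. B y $ a $ b) x * h b l x)"
    by (simp add: sum.distrib sum_distrib_left distrib_left mult.assoc)
  also have "(\<Sum>a\<in>UNIV. \<Sum>b\<in>UNIV. h k a x * B x $ a $ b * pd i (h b l) x) =
      (\<Sum>b\<in>UNIV. (\<Sum>a\<in>UNIV. h k a x * B x $ a $ b) * pd i (h b l) x)"
    by (subst sum.swap) (simp add: sum_distrib_right)
  also have "\<dots> = pd i (h k l) x"
    unfolding hB by (simp add: if_distrib[of "\<lambda>u. u * _"] cong: if_cong)
  finally show ?thesis by (simp add: h_def[abs_def])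
qed

section \<open>The Laplacian in divergence form\<close>

text \<open>The index calculation for the trace of the Christoffel symbols, with \<open>h\<close>
  for the inverse metric, \<open>dG i a b\<close> for the derivatives of the metric and
  \<open>F\<close> for the components of a differential. By symmetry of \<open>h\<close> the first
  two terms of the Christoffel symbol contribute equally and match the derivative of the inverse
  metric; the third matches the derivative of the volume density.\<close>

lemma laplacian_index_identity:
  fixes h :: "'n::finite \<Rightarrow> 'n \<Rightarrow> real"
  assumes h: "\<And>i j. h i j = h j i"
  shows "(\<Sum>i\<in>UNIV. \<Sum>j\<in>UNIV. h i j * (\<Sum>k\<in>UNIV. (1/2 * (\<Sum>l\<in>UNIV. h k l * (dG i j l + dG j i l - dG l i j))) * F k)) =
    (\<Sum>i\<in>UNIV. \<Sum>j\<in>UNIV. \<Sum>a\<in>UNIV. \<Sum>b\<in>UNIV. h i a * dG i a b * h b j * F j)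
    - 1/2 * (\<Sum>i\<in>UNIV. \<Sum>j\<in>UNIV. (\<Sum>a\<in>UNIV. \<Sum>b\<in>UNIV. dG i a b * h b a) * h i j * F j)"
proof -
  define S1 where "S1 = (\<Sum>i\<in>UNIV. \<Sum>j\<in>UNIV. \<Sum>k\<in>UNIV. \<Sum>l\<in>UNIV. h i j * h k l * dG i j l * F k)"
  define S2 where "S2 = (\<Sum>i\<in>UNIV. \<Sum>j\<in>UNIV. \<Sum>k\<in>UNIV. \<Sum>l\<in>UNIV. h i j * h k l * dG j i l * F k)"
  define S3 where "S3 = (\<Sum>i\<in>UNIV. \<Sum>j\<in>UNIV. \<Sum>k\<in>UNIV. \<Sum>l\<in>UNIV. h i j * h k l * dG l i j * F k)"
  have "(\<Sum>i\<in>UNIV. \<Sum>j\<in>UNIV. h i j * (\<Sum>k\<in>UNIV. (1/2 * (\<Sum>l\<in>UNIV. h k l * (dG i j l + dG j i l - dG l i j))) * F k)) =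
    (\<Sum>i\<in>UNIV. \<Sum>j\<in>UNIV. \<Sum>k\<in>UNIV. \<Sum>l\<in>UNIV. 1/2 * (h i j * h k l * dG i j l * F k)
      + 1/2 * (h i j * h k l * dG j i l * F k) - 1/2 * (h i j * h k l * dG l i j * F k))"
    unfolding sum_distrib_left sum_distrib_right by (simp add: algebra_simps)
  also have "\<dots> = 1/2 * S1 + 1/2 * S2 - 1/2 * S3"
    unfolding S1_def S2_def S3_def by (simp add: sum.distrib sum_subtractf sum_distrib_left)
  also have "S2 = S1"
  proof -
    have "S2 = (\<Sum>j\<in>UNIV. \<Sum>i\<in>UNIV. \<Sum>k\<in>UNIV. \<Sum>l\<in>UNIV. h i j * h k l * dG j i l * F k)"
      unfolding S2_def by (rule sum.swap)
    also have "\<dots> = S1"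
      unfolding S1_def
    proof (intro sum.cong refl)
      fix i j k l show "h j i * h k l * dG i j l * F k = h i j * h k l * dG i j l * F k" using h[of j i] by (simp only: mult_ac)
    qed
    finally show ?thesis .
  qed
  also have "S1 = (\<Sum>i\<in>UNIV. \<Sum>k\<in>UNIV. \<Sum>j\<in>UNIV. \<Sum>l\<in>UNIV. h i j * dG i j l * h l k * F k)"
  proof -
    have "S1 = (\<Sum>i\<in>UNIV. \<Sum>k\<in>UNIV. \<Sum>j\<in>UNIV. \<Sum>l\<in>UNIV. h i j * h k l * dG i j l * F k)"
      unfolding S1_def by (rule sum.cong[OF refl], rule sum.swap)
    also have "\<dots> = (\<Sum>i\<in>UNIV. \<Sum>k\<in>UNIV. \<Sum>j\<in>UNIV. \<Sum>l\<in>UNIV. h i j * dG i j l * h l k * F k)"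
    proof (intro sum.cong refl)
      fix i j k l show "h i j * h k l * dG i j l * F k = h i j * dG i j l * h l k * F k" using h[of l k] by (simp only: mult_ac)
    qed
    finally show ?thesis .
  qed
  also have "S3 = (\<Sum>l\<in>UNIV. \<Sum>k\<in>UNIV. (\<Sum>i\<in>UNIV. \<Sum>j\<in>UNIV. dG l i j * h j i) * h l k * F k)"
  proof -
    have "S3 = (\<Sum>i\<in>UNIV. \<Sum>j\<in>UNIV. \<Sum>l\<in>UNIV. \<Sum>k\<in>UNIV. h i j * h k l * dG l i j * F k)"
      unfolding S3_def by (rule sum.cong[OF refl], rule sum.cong[OF refl], rule sum.swap)
    also have "\<dots> = (\<Sum>i\<in>UNIV. \<Sum>l\<in>UNIV. \<Sum>j\<in>UNIV. \<Sum>k\<in>UNIV. h i j * h k l * dG l i j * F k)"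
      by (rule sum.cong[OF refl], rule sum.swap)
    also have "\<dots> = (\<Sum>l\<in>UNIV. \<Sum>i\<in>UNIV. \<Sum>j\<in>UNIV. \<Sum>k\<in>UNIV. h i j * h k l * dG l i j * F k)"
      by (rule sum.swap)
    also have "\<dots> = (\<Sum>l\<in>UNIV. \<Sum>i\<in>UNIV. \<Sum>k\<in>UNIV. \<Sum>j\<in>UNIV. h i j * h k l * dG l i j * F k)"
      by (rule sum.cong[OF refl], rule sum.cong[OF refl], rule sum.swap)
    also have "\<dots> = (\<Sum>l\<in>UNIV. \<Sum>k\<in>UNIV. \<Sum>i\<in>UNIV. \<Sum>j\<in>UNIV. h i j * h k l * dG l i j * F k)"
      by (rule sum.cong[OF refl], rule sum.swap)
    also have "\<dots> = (\<Sum>l\<in>UNIV. \<Sum>k\<in>UNIV. (\<Sum>i\<in>UNIV. \<Sum>j\<in>UNIV. dG l i j * h j i) * h l k * F k)"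
      unfolding sum_distrib_right
    proof (intro sum.cong refl)
      fix l k i j show "h i j * h k l * dG l i j * F k = dG l i j * h j i * h l k * F k"
        using h[of j i] h[of l k] by (simp only: mult_ac)
    qed
    finally show ?thesis .
  qed
  finally show ?thesis by simp
qed

text \<open>A metric in the coordinates of a single chart. First derivatives of its entries suffice,
  because the Hessian involves the metric only through Christoffel symbols.\<close>

locale euclidean_metric =
  fixes S :: "(real^'n::finite) set" and G :: "real^'n \<Rightarrow> real^'n^'n"
  assumes S: "open S" and G: "\<And>a b. C1_on S (\<lambda>x. G x $ a $ b)"
    and sym: "\<And>x. x \<in> S \<Longrightarrow> transpose (G x) = G x"
    and pos_def: "\<And>x w. x \<in> S \<Longrightarrow> w \<noteq> 0 \<Longrightarrow> w \<bullet> (G x *v w) > 0"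
begin


lemma det_nz: "x \<in> S \<Longrightarrow> det (G x) \<noteq> 0"
proof
  assume x: "x \<in> S" and "det (G x) = 0"
  then obtain w where "w \<noteq> 0" "G x *v w = 0"
    using invertible_det_nz[of "G x"] by (auto simp: invertible_left_inverse matrix_left_invertible_ker)
  with pos_def[OF x, of w] show False by simp
qed

text \<open>On the segment from the identity to \<open>G x\<close> the matrices stay positive
  definite, so the determinant never vanishes and keeps the sign it has at the identity.\<close>

lemma det_pos:
  assumes x: "x \<in> S"
  shows "det (G x) > 0"
proof -
  define P where "P t = (1 - t) *\<^sub>R mat 1 + t *\<^sub>R G x" for t
  have nz: "det (P t) \<noteq> 0" if t: "0 \<le> t" "t \<le> 1" for t
  proof
    assume "det (P t) = 0"
    then obtain w where w: "w \<noteq> 0" "P t *v w = 0"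
      using invertible_det_nz[of "P t"] by (auto simp: invertible_left_inverse matrix_left_invertible_ker)
    have "0 = w \<bullet> (P t *v w)" by (simp add: w)
    also have "\<dots> = (1 - t) * (w \<bullet> w) + t * (w \<bullet> (G x *v w))"
      by (simp add: P_def matrix_vector_mult_add_rdistrib scaleR_matrix_vector_assoc[symmetric] inner_add_right)
    also have "\<dots> > 0"
    proof (cases "t = 0")
      case False
      then have "t * (w \<bullet> (G x *v w)) > 0" using pos_def[OF x w(1)] t by simp
      then show ?thesis using t by (intro add_nonneg_pos) auto
    qed (use w in auto)
    finally show False by simp
  qed
  have cont: "continuous_on {0..1} (\<lambda>t. det (P t))"
    unfolding det_def P_def by (intro continuous_intros)
  show ?thesis
  proof (rule ccontr)
    assume "\<not> ?thesis"
    then have "det (P 1) \<le> 0" "0 \<le> det (P 0)" by (auto simp: P_def)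
    then obtain t where "0 \<le> t" "t \<le> 1" "det (P t) = 0"
      using IVT2'[of "\<lambda>t. det (P t)" 1 0 0] cont by auto
    with nz show False by auto
  qed
qed

abbreviation h where "h i j x \<equiv> matrix_inv (G x) $ i $ j"

lemma h_C1: "C1_on S (h i j)"
  by (rule C1_on_matrix_inv[OF S G det_nz])

lemma G_sym: "x \<in> S \<Longrightarrow> G x $ i $ j = G x $ j $ i"
  using arg_cong[OF sym, of x "\<lambda>M. M $ j $ i"] by (simp add: transpose_def)

lemma h_sym:
  assumes x: "x \<in> S"
  shows "h i j x = h j i x"
proof -
  note inv = matrix_inv_mult[OF det_nz[OF x]]
  have "G x ** transpose (matrix_inv (G x)) = transpose (matrix_inv (G x) ** G x)"
    by (simp add: matrix_transpose_mul sym[OF x])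
  then have "G x ** transpose (matrix_inv (G x)) = mat 1" by (simp add: inv transpose_mat)
  then have "matrix_inv (G x) ** (G x ** transpose (matrix_inv (G x))) = matrix_inv (G x)" by simp
  then have "transpose (matrix_inv (G x)) = matrix_inv (G x)"
    unfolding matrix_mul_assoc inv by simp
  from arg_cong[OF this, of "\<lambda>M. M $ j $ i"] show ?thesis by (simp add: transpose_def)
qed

definition vol where "vol x = sqrt (det (G x))"

lemma vol_pos: "x \<in> S \<Longrightarrow> vol x > 0"
  by (simp add: vol_def det_pos)

lemma vol_C1: "C1_on S vol"
  unfolding vol_def[abs_def] by (intro C1_on_sqrt C1_on_det G det_pos)

lemma pd_vol:
  assumes x: "x \<in> S"
  shows "pd i vol x = 1/2 * vol x * (\<Sum>a\<in>UNIV. \<Sum>b\<in>UNIV. pd i (\<lambda>y. G y $ a $ b) x * h b a x)"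
proof -
  have "pd i (\<lambda>y. det (G y)) x = pd i (\<lambda>y. vol y * vol y) x"
    by (rule pd_cong[OF S x]) (use det_pos in \<open>auto simp: vol_def less_imp_le\<close>)
  also have "\<dots> = 2 * vol x * pd i vol x"
    by (simp add: pd_mult C1_onD(1)[OF vol_C1 x])
  finally have "2 * vol x * pd i vol x = (\<Sum>a\<in>UNIV. \<Sum>b\<in>UNIV. pd i (\<lambda>y. G y $ a $ b) x * h b a x) * (vol x * vol x)"
    using det_pos[OF x] by (simp add: pd_det C1_onD(1)[OF G x] det_nz[OF x] vol_def)
  then show ?thesis using vol_pos[OF x] by (simp add: field_simps)
qed

text \<open>Component \<open>i\<close> of the volume density times the gradient of \<open>F\<close>:
  the vector density whose plain coordinate divergence is the volume density times the
  Laplacian.\<close>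

definition flux where "flux F i x = vol x * (\<Sum>j\<in>UNIV. h i j x * pd j F x)"

lemma flux_C1:
  assumes "\<And>j. C1_on S (pd j F)"
  shows "C1_on S (flux F i)"
  unfolding flux_def[abs_def] by (intro C1_on_mult C1_on_sum vol_C1 h_C1 assms)

text \<open>By the product rule, the derivatives of the inverse metric
  (\<open>pd_matrix_inv\<close>) and of the volume density (\<open>pd_vol\<close>) appear;
  \<open>laplacian_index_identity\<close> recombines them into the Christoffel term of the
  Hessian.\<close>

theorem divergence_flux:
  assumes F: "\<And>j. C1_on S (pd j F)" and x: "x \<in> S"
  shows "(\<Sum>i\<in>UNIV. pd i (flux F i) x) = vol x * (\<Sum>i\<in>UNIV. \<Sum>j\<in>UNIV. h i j x * hessian G F x $ i $ j)"
proof -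
  define dG where "dG i a b = pd i (\<lambda>y. G y $ a $ b) x" for i a b
  define H where "H i j = h i j x" for i j
  define D where "D j = pd j F x" for j
  define DD where "DD i j = pd i (pd j F) x" for i j
  define T where "T i = (\<Sum>a\<in>UNIV. \<Sum>b\<in>UNIV. dG i a b * H b a)" for i
  have dG: "dG i a b = dG i b a" for i a b
    unfolding dG_def by (rule pd_cong[OF S x]) (rule G_sym)
  note diff = C1_onD(1)[OF vol_C1 x] C1_onD(1)[OF h_C1 x] C1_onD(1)[OF F x]
  have "pd i (flux F i) x = (\<Sum>j\<in>UNIV. vol x * (H i j * DD i j))
    - (\<Sum>j\<in>UNIV. vol x * (\<Sum>a\<in>UNIV. \<Sum>b\<in>UNIV. H i a * dG i a b * H b j * D j))
    + (\<Sum>j\<in>UNIV. vol x * (1/2 * (T i * H i j * D j)))" for i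
  proof -
    have "pd i (flux F i) x = vol x * (\<Sum>j\<in>UNIV. h i j x * pd i (pd j F) x + pd i (h i j) x * pd j F x)
        + pd i vol x * (\<Sum>j\<in>UNIV. h i j x * pd j F x)"
      unfolding flux_def[abs_def] by (simp add: pd_mult pd_sum diff differentiable_mult differentiable_sum)
    moreover have "pd i (h i j) x = - (\<Sum>a\<in>UNIV. \<Sum>b\<in>UNIV. H i a * dG i a b * H b j)" for j
      unfolding H_def dG_def by (rule pd_matrix_inv[OF S G det_nz x])
    moreover have "pd i vol x = 1/2 * vol x * T i" unfolding pd_vol[OF x] T_def dG_def H_def ..
    ultimately show ?thesis
      by (simp add: H_def[symmetric] D_def[symmetric] DD_def[symmetric] sum.distrib sum_distrib_left sum_distrib_right
          distrib_left sum_negf mult_ac sum_subtractf right_diff_distrib sum_divide_distrib)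
  qed
  then have "(\<Sum>i\<in>UNIV. pd i (flux F i) x) = vol x * (\<Sum>i\<in>UNIV. \<Sum>j\<in>UNIV. H i j * DD i j)
    - vol x * ((\<Sum>i\<in>UNIV. \<Sum>j\<in>UNIV. \<Sum>a\<in>UNIV. \<Sum>b\<in>UNIV. H i a * dG i a b * H b j * D j)
      - 1/2 * (\<Sum>i\<in>UNIV. \<Sum>j\<in>UNIV. T i * H i j * D j))"
    by (simp add: sum.distrib sum_subtractf sum_distrib_left right_diff_distrib)
  also have "(\<Sum>i\<in>UNIV. \<Sum>j\<in>UNIV. \<Sum>a\<in>UNIV. \<Sum>b\<in>UNIV. H i a * dG i a b * H b j * D j)
      - 1/2 * (\<Sum>i\<in>UNIV. \<Sum>j\<in>UNIV. T i * H i j * D j) =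
    (\<Sum>i\<in>UNIV. \<Sum>j\<in>UNIV. H i j * (\<Sum>k\<in>UNIV. christoffel G k i j x * D k))"
    unfolding T_def using laplacian_index_identity[of H dG D] h_sym[OF x]
    by (simp add: H_def christoffel_def dG_def)
  finally show ?thesis
    by (simp add: hessian_def H_def DD_def D_def sum_subtractf right_diff_distrib)
qed

end

section \<open>Integration by parts against functions with controlled difference quotients\<close>

text \<open>The quadratic form attains a positive minimum on the unit sphere; homogeneity does the
  rest.\<close>

lemma pos_def_bound:
  fixes B :: "real^'n::finite^'n"
  assumes "\<And>w. w \<noteq> 0 \<Longrightarrow> w \<bullet> (B *v w) > 0"
  obtains \<mu> where "\<mu> > 0" "\<And>w. \<mu> * (norm w)\<^sup>2 \<le> w \<bullet> (B *v w)"
proof -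
  have cont: "continuous_on (sphere 0 1) (\<lambda>w. w \<bullet> (B *v w))"
    by (intro continuous_intros)
  obtain w0 :: "real^'n" where w0: "w0 \<in> sphere 0 1" "\<And>w. w \<in> sphere 0 1 \<Longrightarrow> w0 \<bullet> (B *v w0) \<le> w \<bullet> (B *v w)"
    using continuous_attains_inf[OF _ _ cont] by auto
  have "w0 \<noteq> 0" using w0(1) by auto
  then have pos: "w0 \<bullet> (B *v w0) > 0" by (rule assms)
  have "w0 \<bullet> (B *v w0) * (norm w)\<^sup>2 \<le> w \<bullet> (B *v w)" for w
  proof (cases "w = 0")
    case False
    have "w0 \<bullet> (B *v w0) \<le> (w /\<^sub>R norm w) \<bullet> (B *v (w /\<^sub>R norm w))"
      using False by (intro w0) auto
    also have "\<dots> = (w \<bullet> (B *v w)) / (norm w)\<^sup>2"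
      by (simp add: matrix_vector_mult_scaleR power2_eq_square divide_inverse)
    finally show ?thesis using False by (simp add: field_simps)
  qed simp
  with pos show thesis by (rule that)
qed

text \<open>An Auerbach basis of the norm given by \<open>B\<close>, obtained by maximising the determinant.\<close>

lemma auerbach_basis:
  fixes B :: "real^'n::finite^'n"
  assumes pos: "\<And>w. w \<noteq> 0 \<Longrightarrow> w \<bullet> (B *v w) > 0"
  obtains E L :: "real^'n^'n" where "\<And>a. E $ a \<bullet> (B *v E $ a) \<le> 1"
    "\<And>a y. \<bar>(L *v y) $ a\<bar> \<le> sqrt (y \<bullet> (B *v y))"
    "\<And>y. y = (\<Sum>a\<in>UNIV. (L *v y) $ a *\<^sub>R E $ a)"
proof -
  obtain \<mu> where \<mu>: "\<mu> > 0" "\<And>w. \<mu> * (norm w)\<^sup>2 \<le> w \<bullet> (B *v w)" using pos_def_bound[of B] pos by blast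
  define X where "X = {E :: real^'n^'n. \<forall>a. E $ a \<bullet> (B *v E $ a) \<le> 1}"
  have "closed X"
  proof -
    have "closed {E :: real^'n^'n. E $ a \<bullet> (B *v E $ a) \<le> 1}" for a
      by (intro closed_Collect_le continuous_intros linear_continuous_on_compose[OF _ matrix_vector_mul_linear])
    then show ?thesis unfolding X_def by (intro closed_Collect_all) auto
  qed
  moreover have "bounded X"
  proof -
    have "norm E \<le> (\<Sum>a\<in>(UNIV::'n set). sqrt (1 / \<mu>))" if "E \<in> X" for E
    proof -
      have "norm E \<le> (\<Sum>a\<in>UNIV. norm (E $ a))" unfolding norm_vec_def by (rule L2_set_le_sum) simp
      also have "\<dots> \<le> (\<Sum>a\<in>(UNIV::'n set). sqrt (1 / \<mu>))"
      proof (rule sum_mono)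
        fix a
        have "\<mu> * (norm (E $ a))\<^sup>2 \<le> 1" using \<mu>(2)[of "E $ a"] that by (auto simp: X_def intro: order_trans)
        then have "(norm (E $ a))\<^sup>2 \<le> 1 / \<mu>" using \<mu>(1) by (simp add: field_simps)
        then show "norm (E $ a) \<le> sqrt (1 / \<mu>)" by (rule real_le_rsqrt)
      qed
      finally show ?thesis .
    qed
    then show ?thesis by (auto simp: bounded_iff)
  qed
  ultimately have "compact X" by (simp add: compact_eq_bounded_closed)
  moreover have "X \<noteq> {}" by (auto simp: X_def intro!: exI[of _ 0])
  moreover have "continuous_on X det" unfolding det_def by (intro continuous_intros)
  ultimately obtain E where E: "E \<in> X" "\<And>E'. E' \<in> X \<Longrightarrow> det E' \<le> det E"
    using continuous_attains_sup by metis
  have detE: "det E > 0"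
  proof -
    \<comment> \<open>\<open>b\<close> bounds the form on all coordinate vectors, so the identity
      scaled by 1 / sqrt b competes in \<open>X\<close> and the maximal determinant is
      positive.\<close>
    define b where "b = (\<Sum>a\<in>UNIV. \<bar>axis a 1 \<bullet> (B *v axis a 1)\<bar>) + 1"
    have b: "b > 0" unfolding b_def by (intro add_nonneg_pos sum_nonneg) auto
    have "(1 / sqrt b) *\<^sub>R mat 1 \<in> X"
    proof -
      have row: "(mat 1 :: real^'n^'n) $ a = axis a 1" for a
        by (simp add: vec_eq_iff mat_def axis_def)
      have "axis a 1 \<bullet> (B *v axis a 1) \<le> b" for a
        using member_le_sum[of a UNIV "\<lambda>a. \<bar>axis a 1 \<bullet> (B *v axis a 1)\<bar>"] by (simp add: b_def)
      then show ?thesis using b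
        by (auto simp: X_def row matrix_vector_mult_scaleR field_simps)
    qed
    from E(2)[OF this] have "det ((1 / sqrt b) *\<^sub>R mat 1 :: real^'n^'n) \<le> det E" .
    moreover have "det ((1 / sqrt b) *\<^sub>R mat 1 :: real^'n^'n) = (1 / sqrt b) ^ CARD('n)"
    proof -
      have "(1 / sqrt b) *\<^sub>R mat 1 = matrix ((*\<^sub>R) (1 / sqrt b) :: real^'n \<Rightarrow> real^'n)"
        by (auto simp: vec_eq_iff matrix_def mat_def axis_def)
      then show ?thesis by simp
    qed
    ultimately show ?thesis using b by (smt (verit) divide_pos_pos real_sqrt_gt_zero zero_less_power)
  qed
  define L where "L = transpose (matrix_inv E)"
  have L: "(L *v y) $ a * det E = det (\<chi> r. if r = a then y else E $ r)" for y a
    using det_replace_row[of E a y] detE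
    by (simp add: L_def matrix_vector_mult_def transpose_def mult.commute)
  \<comment> \<open>Exchanging row \<open>a\<close> for \<open>y\<close> multiplies the determinant
    by coordinate \<open>a\<close> of \<open>y\<close>, and the determinant was already
    maximal.\<close>
  have le1: "(L *v y) $ a \<le> 1" if "y \<bullet> (B *v y) \<le> 1" for y a
  proof -
    have "(\<chi> r. if r = a then y else E $ r) \<in> X" using that E(1) by (auto simp: X_def)
    from E(2)[OF this] show ?thesis using detE unfolding L[symmetric] by simp
  qed
  show thesis
  proof (rule that)
    show "E $ a \<bullet> (B *v E $ a) \<le> 1" for a using E(1) by (auto simp: X_def)
    show "\<bar>(L *v y) $ a\<bar> \<le> sqrt (y \<bullet> (B *v y))" for a y
    proof (cases "y = 0")
      case False
      define s where "s = sqrt (y \<bullet> (B *v y))"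
      have s: "s > 0" "s * s = y \<bullet> (B *v y)" using pos[OF False] by (auto simp: s_def)
      have 1: "(y /\<^sub>R s) \<bullet> (B *v (y /\<^sub>R s)) = 1" "(- y /\<^sub>R s) \<bullet> (B *v (- y /\<^sub>R s)) = 1"
        using s mult_pos_pos[OF s(1) s(1)]
        by (simp_all add: matrix_vector_mult_scaleR field_simps linear_neg[OF matrix_vector_mul_linear])
      have "(L *v (y /\<^sub>R s)) $ a \<le> 1" "(L *v (- y /\<^sub>R s)) $ a \<le> 1"
        using le1 1 by (metis order_refl)+
      then show ?thesis using s(1) unfolding s_def[symmetric]
        by (simp add: matrix_vector_mult_scaleR field_simps abs_le_iff linear_neg[OF matrix_vector_mul_linear])
    qed simp
    show "y = (\<Sum>a\<in>UNIV. (L *v y) $ a *\<^sub>R E $ a)" for y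
    proof -
      have "y = (y v* matrix_inv E) v* E"
        using detE by (simp add: vector_matrix_mul_assoc matrix_inv_mult)
      also have "\<dots> = (\<Sum>a\<in>UNIV. (L *v y) $ a *\<^sub>R E $ a)"
        by (simp add: L_def vec_eq_iff vector_matrix_mult_def matrix_vector_mult_def transpose_def mult.commute)
      finally show ?thesis .
    qed
  qed
qed

lemma integrable_compact_support:
  fixes f :: "'e::euclidean_space \<Rightarrow> real"
  assumes "f \<in> borel_measurable borel" "compact K" "\<And>x. x \<notin> K \<Longrightarrow> f x = 0" "\<And>x. x \<in> K \<Longrightarrow> \<bar>f x\<bar> \<le> C"
  shows "integrable lborel f"
proof (rule Bochner_Integration.integrable_bound[where f = "\<lambda>x. C * indicator K x"])
  show "integrable lborel (\<lambda>x. C * indicator K x)"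
    using assms(2) emeasure_compact_finite[of K]
    by (intro integrable_mult_right integrable_real_indicator) (auto intro!: borel_compact)
  show "AE x in lborel. norm (f x) \<le> norm (C * indicator K x)"
    using assms(3,4) by (intro always_eventually allI) (force simp: indicator_def)
qed (use assms(1) in auto)

lemma lborel_integral_translation:
  fixes f :: "'e::euclidean_space \<Rightarrow> real"
  assumes "f \<in> borel_measurable borel"
  shows "(\<integral>x. f (c + x) \<partial>lborel) = (\<integral>x. f x \<partial>lborel)"
proof -
  have "(\<integral>x. f x \<partial>lborel) = (\<integral>x. f x \<partial>(distr lborel borel ((+) c)))"
    by (simp add: lborel_distr_plus)
  also have "\<dots> = (\<integral>x. f (c + x) \<partial>lborel)"
    by (rule integral_distr) (use assms in auto)
  finally show ?thesis by simp
qed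

text \<open>The derivative of \<open>F\<close> is the limit of difference quotients, and translation
  invariance of Lebesgue measure shifts these onto \<open>H\<close>, of which no derivative is
  assumed. The function \<open>a\<close> bounds the difference quotients of \<open>H\<close> up to
  an error \<open>b\<close> times the step length, which disappears in the limit.\<close>

lemma integral_directional_derivative_bound:
  fixes F H a :: "'e::euclidean_space \<Rightarrow> real"
  assumes F: "\<And>x. (F has_derivative F' x) (at x)" and F': "continuous_on UNIV (\<lambda>x. F' x E)"
    and K: "compact K" "\<And>x. x \<notin> K \<Longrightarrow> F x = 0"
    and H: "H \<in> borel_measurable borel" "\<And>x. \<bar>H x\<bar> \<le> M"
    and a: "a \<in> borel_measurable borel" "\<And>x. \<bar>a x\<bar> \<le> M'"
    and t0: "t0 > 0" and dq: "\<And>x t. x \<in> K \<Longrightarrow> \<bar>t\<bar> \<le> t0 \<Longrightarrow> \<bar>H (x + t *\<^sub>R E) - H x\<bar> \<le> \<bar>t\<bar> * (a x + b * \<bar>t\<bar>)"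
  shows "\<bar>\<integral>x. H x * F' x E \<partial>lborel\<bar> \<le> (\<integral>x. a x * \<bar>F x\<bar> \<partial>lborel)"
proof -
  have contF: "continuous_on UNIV F"
    using F by (auto intro!: has_derivative_continuous continuous_at_imp_continuous_on)
  have F'0: "F' x E = 0" if "x \<notin> K" for x
  proof -
    have "(F has_derivative (\<lambda>_. 0)) (at x)"
      by (rule has_derivative_transform_within_open[of "\<lambda>_. 0" _ _ _ "- K"])
         (use K that in \<open>auto simp: compact_imp_closed open_Compl\<close>)
    then show ?thesis using has_derivative_unique[OF F] by metis
  qed
  obtain C where C: "\<And>x. \<bar>F' x E\<bar> \<le> C"
  proof -
    have "bounded ((\<lambda>x. F' x E) ` K)"
      using F' K(1) by (intro compact_imp_bounded compact_continuous_image) (auto intro: continuous_on_subset)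
    then obtain C where "\<And>x. x \<in> K \<Longrightarrow> \<bar>F' x E\<bar> \<le> C" by (auto simp: bounded_iff)
    then have "\<bar>F' x E\<bar> \<le> max C 0" for x using F'0[of x] by (cases "x \<in> K") force+
    then show thesis by (rule that)
  qed
  obtain CF where CF: "\<And>x. \<bar>F x\<bar> \<le> CF" and CF0: "0 \<le> CF"
  proof -
    have "bounded (F ` K)"
      using contF K(1) by (intro compact_imp_bounded compact_continuous_image) (auto intro: continuous_on_subset)
    then obtain C where "\<And>x. x \<in> K \<Longrightarrow> \<bar>F x\<bar> \<le> C" by (auto simp: bounded_iff)
    then have "\<bar>F x\<bar> \<le> max C 0" for x using K(2)[of x] by (cases "x \<in> K") force+
    then show thesis by (rule that) simp
  qed
  have Fm[measurable]: "F \<in> borel_measurable borel" "(\<lambda>x. F' x E) \<in> borel_measurable borel"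
    using contF F' by (auto intro: borel_measurable_continuous_onI)
  note [measurable] = H(1) a(1)
  have M0: "0 \<le> M" "0 \<le> C" "0 \<le> M'" using H(2) C a(2) by (meson abs_ge_zero order_trans)+
  have mvt: "\<bar>F (x + t *\<^sub>R E) - F x\<bar> \<le> \<bar>t\<bar> * C" for x t
  proof -
    have "((\<lambda>s. F (x + s *\<^sub>R E)) has_field_derivative F' (x + s *\<^sub>R E) E) (at s)" for s
    proof -
      have "((\<lambda>s. F (x + s *\<^sub>R E)) has_derivative (\<lambda>r. F' (x + s *\<^sub>R E) (r *\<^sub>R E))) (at s)"
        by (rule has_derivative_compose[OF _ F]) (auto intro!: derivative_eq_intros)
      then show ?thesis
        using linear_scale[OF has_derivative_linear[OF F]] by (simp add: has_field_derivative_def mult_commute_abs)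
    qed
    then have "norm (F (x + t *\<^sub>R E) - F (x + 0 *\<^sub>R E)) \<le> C * norm (t - 0)"
      using C by (intro field_differentiable_bound[of UNIV "\<lambda>s. F (x + s *\<^sub>R E)" _ C t 0]) auto
    then show ?thesis by (simp add: mult.commute)
  qed
  \<comment> \<open>Steps tending to 0 that stay within the range in which the bound
    \<open>dq\<close> is available.\<close>
  define tk where "tk k = t0 / real (Suc k)" for k
  have tk: "0 < tk k" "tk k \<le> t0" for k using t0 by (auto simp: tk_def field_simps)
  have tk0: "tk \<longlonglongrightarrow> 0" unfolding tk_def by real_asymp
  obtain r where r: "K \<subseteq> cball 0 r" using compact_imp_bounded[OF K(1)] by (auto simp: bounded_iff subset_iff)
  \<comment> \<open>All translates of the support by admissible steps lie in the ball of this
    radius, so one dominating function serves for all \<open>k\<close>.\<close>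
  define R where "R = r + t0 * norm E"
  have out: "F (x + t *\<^sub>R E) = 0" if "norm x > R" "\<bar>t\<bar> \<le> t0" for x t
  proof (rule K(2), rule)
    assume "x + t *\<^sub>R E \<in> K"
    then have "norm (x + t *\<^sub>R E) \<le> r" using r by auto
    moreover have "norm x \<le> norm (x + t *\<^sub>R E) + norm (t *\<^sub>R E)" by (metis add_diff_cancel_right' norm_triangle_ineq4)
    moreover have "norm (t *\<^sub>R E) \<le> t0 * norm E" using that(2) by (simp add: mult_right_mono)
    ultimately show False using that(1) by (simp add: R_def)
  qed
  define Q where "Q k = (\<integral>x. H x * ((F (x + tk k *\<^sub>R E) - F x) / tk k) \<partial>lborel)" for k
  have lim: "Q \<longlonglongrightarrow> (\<integral>x. H x * F' x E \<partial>lborel)"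
    unfolding Q_def
  proof (rule integral_dominated_convergence[where w = "\<lambda>x. M * C * indicator (cball 0 R) x"])
    show "integrable lborel (\<lambda>x. M * C * indicator (cball 0 R) x :: real)"
      using emeasure_compact_finite[OF compact_cball, of 0 R]
      by (intro integrable_mult_right integrable_real_indicator) auto
    show "AE x in lborel. (\<lambda>k. H x * ((F (x + tk k *\<^sub>R E) - F x) / tk k)) \<longlonglongrightarrow> H x * F' x E"
    proof (intro always_eventually allI tendsto_mult tendsto_const)
      fix x
      have "((\<lambda>s. F (x + s *\<^sub>R E)) has_field_derivative F' x E) (at 0)"
      proof -
        have "((\<lambda>s. F (x + s *\<^sub>R E)) has_derivative (\<lambda>r. F' (x + 0 *\<^sub>R E) (r *\<^sub>R E))) (at 0)"
          by (rule has_derivative_compose[OF _ F]) (auto intro!: derivative_eq_intros)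
        then show ?thesis
          using linear_scale[OF has_derivative_linear[OF F]] by (simp add: has_field_derivative_def mult_commute_abs)
      qed
      then have "((\<lambda>s. (F (x + s *\<^sub>R E) - F x) / s) \<longlongrightarrow> F' x E) (at 0)"
        by (simp add: DERIV_def)
      moreover have "filterlim tk (at 0) sequentially"
        using tk0 tk(1) by (intro filterlim_atI) (auto intro!: always_eventually simp: less_imp_neq[symmetric])
      ultimately show "(\<lambda>k. (F (x + tk k *\<^sub>R E) - F x) / tk k) \<longlonglongrightarrow> F' x E"
        by (rule filterlim_compose)
    qed
    show "AE x in lborel. norm (H x * ((F (x + tk k *\<^sub>R E) - F x) / tk k)) \<le> M * C * indicator (cball 0 R) x" for k
    proof (intro always_eventually allI)
      fix x
      show "norm (H x * ((F (x + tk k *\<^sub>R E) - F x) / tk k)) \<le> M * C * indicator (cball 0 R) x"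
      proof (cases "norm x \<le> R")
        case True
        have "\<bar>F (x + tk k *\<^sub>R E) - F x\<bar> / tk k \<le> C"
          using mvt[of x "tk k"] tk[of k] by (simp add: field_simps)
        then have "\<bar>H x\<bar> * (\<bar>F (x + tk k *\<^sub>R E) - F x\<bar> / tk k) \<le> M * C"
          using H(2)[of x] tk[of k] M0 by (intro mult_mono) auto
        then show ?thesis using True tk[of k] by (simp add: abs_mult)
      next
        case False
        then show ?thesis using out[of x "tk k"] out[of x 0] tk[of k] t0 by simp
      qed
    qed
  qed measurable
  have intF: "integrable lborel (\<lambda>x. u x * F x)" if [measurable]: "u \<in> borel_measurable borel" and u: "\<And>x. \<bar>u x\<bar> \<le> Mu" for u Mu
  proof (rule integrable_compact_support[OF _ K(1), where C = "Mu * CF"])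
    show "\<bar>u x * F x\<bar> \<le> Mu * CF" if "x \<in> K" for x
      unfolding abs_mult using u CF by (intro mult_mono) (auto intro: order_trans[OF abs_ge_zero u])
  qed (use K(2) in auto)
  have int_abs: "integrable lborel (\<lambda>x. u x * \<bar>F x\<bar>)" if [measurable]: "u \<in> borel_measurable borel" and u: "\<And>x. \<bar>u x\<bar> \<le> Mu" for u Mu
  proof (rule integrable_compact_support[OF _ K(1), where C = "Mu * CF"])
    show "\<bar>u x * \<bar>F x\<bar>\<bar> \<le> Mu * CF" if "x \<in> K" for x
      unfolding abs_mult abs_idempotent using u CF by (intro mult_mono) (auto intro: order_trans[OF abs_ge_zero u])
  qed (use K(2) in auto)
  have bound: "\<bar>Q k\<bar> \<le> (\<integral>x. a x * \<bar>F x\<bar> \<partial>lborel) + b * tk k * (\<integral>x. \<bar>F x\<bar> \<partial>lborel)" for k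
  proof -
    let ?t = "tk k"
    have i1: "integrable lborel (\<lambda>x. H x * F (x + ?t *\<^sub>R E))"
    proof (rule integrable_compact_support[of _ "cball 0 R" "M * CF"])
      show "H x * F (x + ?t *\<^sub>R E) = 0" if "x \<notin> cball 0 R" for x
        using that out[of x ?t] tk[of k] by auto
      show "\<bar>H x * F (x + ?t *\<^sub>R E)\<bar> \<le> M * CF" for x
        unfolding abs_mult using H(2) CF M0 by (intro mult_mono) auto
    qed auto
    have i2: "integrable lborel (\<lambda>x. H x * F x)" using H by (intro intF)
    have i3: "integrable lborel (\<lambda>x. H (x - ?t *\<^sub>R E) * F x)"
      using H(2) by (intro intF) auto
    \<comment> \<open>The substitution turns the forward difference of \<open>F\<close> into a
      backward difference of \<open>H\<close>, to which \<open>dq\<close> applies with the step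
      negated.\<close>
    have "(\<integral>x. H x * F (x + ?t *\<^sub>R E) \<partial>lborel) = (\<integral>x. H (x - ?t *\<^sub>R E) * F x \<partial>lborel)"
      using lborel_integral_translation[of "\<lambda>x. H (x - ?t *\<^sub>R E) * F x" "?t *\<^sub>R E"]
      by (simp add: add.commute)
    then have "Q k = ((\<integral>x. H (x - ?t *\<^sub>R E) * F x \<partial>lborel) - (\<integral>x. H x * F x \<partial>lborel)) / ?t"
      unfolding Q_def using i1 i2 by (simp add: right_diff_distrib diff_divide_distrib)
    also have "\<dots> = (\<integral>x. (H (x - ?t *\<^sub>R E) - H x) / ?t * F x \<partial>lborel)"
      using i2 i3 by (simp add: left_diff_distrib diff_divide_distrib)
    finally have "\<bar>Q k\<bar> \<le> (\<integral>x. \<bar>(H (x - ?t *\<^sub>R E) - H x) / ?t * F x\<bar> \<partial>lborel)"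
      by (metis integral_abs_bound)
    also have "\<dots> \<le> (\<integral>x. a x * \<bar>F x\<bar> + b * ?t * \<bar>F x\<bar> \<partial>lborel)"
    proof (rule integral_mono)
      show "integrable lborel (\<lambda>x. \<bar>(H (x - ?t *\<^sub>R E) - H x) / ?t * F x\<bar>)"
        using i2 i3 by (intro integrable_abs) (simp add: left_diff_distrib diff_divide_distrib)
      show "integrable lborel (\<lambda>x. a x * \<bar>F x\<bar> + b * ?t * \<bar>F x\<bar>)"
        using a by (intro Bochner_Integration.integrable_add int_abs[of _ M'] int_abs[of _ "\<bar>b * ?t\<bar>"]) auto
      show "\<bar>(H (x - ?t *\<^sub>R E) - H x) / ?t * F x\<bar> \<le> a x * \<bar>F x\<bar> + b * ?t * \<bar>F x\<bar>" for x
      proof (cases "x \<in> K")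
        case True
        have "\<bar>H (x - ?t *\<^sub>R E) - H x\<bar> \<le> ?t * (a x + b * ?t)"
          using dq[OF True, of "- ?t"] tk[of k] by simp
        then have "\<bar>(H (x - ?t *\<^sub>R E) - H x) / ?t\<bar> \<le> a x + b * ?t"
          using tk(1)[of k] by (simp add: abs_divide pos_divide_le_eq mult.commute)
        then show ?thesis unfolding abs_mult distrib_right[symmetric] by (intro mult_right_mono) auto
      qed (use K(2) in simp)
    qed
    also have "\<dots> = (\<integral>x. a x * \<bar>F x\<bar> \<partial>lborel) + b * tk k * (\<integral>x. \<bar>F x\<bar> \<partial>lborel)"
      using a int_abs[of a M'] int_abs[of "\<lambda>_. 1" 1] by simp
    finally show ?thesis .
  qed
  have "(\<lambda>k. \<bar>Q k\<bar>) \<longlonglongrightarrow> \<bar>\<integral>x. H x * F' x E \<partial>lborel\<bar>"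
    using lim by (rule tendsto_rabs)
  moreover have "(\<lambda>k. (\<integral>x. a x * \<bar>F x\<bar> \<partial>lborel) + b * tk k * (\<integral>x. \<bar>F x\<bar> \<partial>lborel)) \<longlonglongrightarrow>
      (\<integral>x. a x * \<bar>F x\<bar> \<partial>lborel) + b * 0 * (\<integral>x. \<bar>F x\<bar> \<partial>lborel)"
    by (intro tendsto_intros tk0)
  ultimately show ?thesis
    using LIMSEQ_le bound by (metis (no_types, lifting) add.right_neutral mult_zero_left mult_zero_right)
qed

text \<open>The field is expanded as a sum of F_k E_k in a basis of vectors of
  \<open>B\<close>-length at most 1 whose coordinate functions satisfy |F_k| \<le> |Y|; its
  divergence is the sum of the derivatives of F_k along E_k, and each of the n directions
  contributes one copy of the bound. The hypothesis \<open>dq\<close> is restricted to such vectors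
  because this is what a Lipschitz condition for a Riemannian distance can deliver.\<close>

lemma integral_divergence_bound:
  fixes Y :: "'n::finite \<Rightarrow> real^'n \<Rightarrow> real" and H a :: "real^'n \<Rightarrow> real" and B :: "real^'n^'n"
  assumes B: "\<And>w. w \<noteq> 0 \<Longrightarrow> w \<bullet> (B *v w) > 0"
    and Y: "\<And>i. C1_on UNIV (Y i)"
    and K: "compact K" "\<And>i x. x \<notin> K \<Longrightarrow> Y i x = 0"
    and H: "H \<in> borel_measurable borel" "\<And>x. \<bar>H x\<bar> \<le> M"
    and a: "a \<in> borel_measurable borel" "\<And>x. 0 \<le> a x" "\<And>x. a x \<le> M'"
    and t0: "t0 > 0" and dq: "\<And>x t E. x \<in> K \<Longrightarrow> \<bar>t\<bar> \<le> t0 \<Longrightarrow> E \<bullet> (B *v E) \<le> 1 \<Longrightarrow>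
      \<bar>H (x + t *\<^sub>R E) - H x\<bar> \<le> \<bar>t\<bar> * (a x + b * \<bar>t\<bar>)"
  shows "\<bar>\<integral>x. H x * (\<Sum>i\<in>UNIV. pd i (Y i) x) \<partial>lborel\<bar> \<le>
    CARD('n) * (\<integral>x. a x * sqrt ((\<chi> i. Y i x) \<bullet> (B *v (\<chi> i. Y i x))) \<partial>lborel)"
proof -
  obtain E L :: "real^'n^'n" where E: "\<And>a. E $ a \<bullet> (B *v E $ a) \<le> 1"
    and L: "\<And>a y. \<bar>(L *v y) $ a\<bar> \<le> sqrt (y \<bullet> (B *v y))"
    and EL: "\<And>y. y = (\<Sum>a\<in>UNIV. (L *v y) $ a *\<^sub>R E $ a)"
    using auerbach_basis[of B] B by blast
  define F where "F k x = (L *v (\<chi> i. Y i x)) $ k" for k x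
  define N where "N x = sqrt ((\<chi> i. Y i x) \<bullet> (B *v (\<chi> i. Y i x)))" for x
  have F_C1: "C1_on UNIV (F k)" for k
    unfolding F_def[abs_def] matrix_vector_mult_def by (simp add: C1_on_sum C1_on_mult C1_on_const Y)
  have F0: "F k x = 0" if "x \<notin> K" for k x
    using K(2)[OF that] by (simp add: F_def matrix_vector_mult_def)
  have contY: "continuous_on UNIV (\<lambda>x. \<chi> i. Y i x)"
    by (intro continuous_on_vec_lambda C1_on_continuous Y)
  have contN: "continuous_on UNIV N"
    unfolding N_def by (intro continuous_intros contY linear_continuous_on_compose[OF _ matrix_vector_mul_linear])
  have N0: "N x = 0" if "x \<notin> K" for x using K(2)[OF that] by (simp add: N_def zero_vec_def[symmetric])
  obtain CN where CN: "\<And>x. x \<in> K \<Longrightarrow> \<bar>N x\<bar> \<le> CN"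
  proof -
    have "bounded (N ` K)"
      using contN K(1) by (intro compact_imp_bounded compact_continuous_image) (auto intro: continuous_on_subset)
    then show thesis using that by (auto simp: bounded_iff)
  qed
  have aM: "\<bar>a x\<bar> \<le> M'" for x using a(2,3)[of x] by simp
  have contF': "continuous_on UNIV (\<lambda>x. \<Sum>i\<in>UNIV. v $ i * pd i (F k) x)" for k v
    by (intro continuous_intros C1_onD(2)[OF F_C1])
  have Nm: "N \<in> borel_measurable borel" using contN by (rule borel_measurable_continuous_onI)
  have Fm: "F k \<in> borel_measurable borel" for k
    using C1_on_continuous[OF F_C1] by (rule borel_measurable_continuous_onI)
  have int_aN: "integrable lborel (\<lambda>x. a x * N x)"
  proof (rule integrable_compact_support[OF _ K(1), where C = "M' * CN"])
    show "\<bar>a x * N x\<bar> \<le> M' * CN" if "x \<in> K" for x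
      unfolding abs_mult using aM CN[OF that] order_trans[OF abs_ge_zero aM] by (intro mult_mono) auto
  qed (use N0 Nm a(1) in auto)
  have FN: "\<bar>F k x\<bar> \<le> N x" for k x
    unfolding F_def N_def by (rule L)
  have int_aF: "integrable lborel (\<lambda>x. a x * \<bar>F k x\<bar>)" for k
    by (rule Bochner_Integration.integrable_bound[OF int_aN])
       (use Fm a FN in \<open>auto intro!: always_eventually mult_left_mono simp: abs_mult order_trans[OF FN abs_ge_self]\<close>)
  have div: "(\<Sum>i\<in>UNIV. pd i (Y i) x) = (\<Sum>k\<in>UNIV. \<Sum>i\<in>UNIV. E $ k $ i * pd i (F k) x)" for x
  proof -
    have "Y i = (\<lambda>x. \<Sum>k\<in>UNIV. E $ k $ i * F k x)" for i
    proof
      fix x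
      have "(\<chi> i. Y i x) $ i = (\<Sum>k\<in>UNIV. F k x *\<^sub>R E $ k) $ i"
        unfolding F_def using EL[of "\<chi> i. Y i x"] by (rule arg_cong)
      then show "Y i x = (\<Sum>k\<in>UNIV. E $ k $ i * F k x)" by (simp add: mult.commute)
    qed
    then have "pd i (Y i) x = pd i (\<lambda>x. \<Sum>k\<in>UNIV. E $ k $ i * F k x) x" for i by simp
    also have "pd i (\<lambda>x. \<Sum>k\<in>UNIV. E $ k $ i * F k x) x = (\<Sum>k\<in>UNIV. E $ k $ i * pd i (F k) x)" for i
      using C1_onD(1)[OF F_C1] by (simp add: pd_sum pd_mult pd_const differentiable_mult)
    finally have eq: "(\<Sum>i\<in>UNIV. pd i (Y i) x) = (\<Sum>i\<in>UNIV. \<Sum>k\<in>UNIV. E $ k $ i * pd i (F k) x)" by simp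
    show ?thesis unfolding eq by (rule sum.swap)
  qed
  have pdF0: "pd i (F k) x = 0" if "x \<notin> K" for i k x
  proof -
    have "pd i (F k) x = pd i (\<lambda>_. 0) x"
      by (rule pd_cong[of "- K"]) (use that K(1) F0 in \<open>auto simp: compact_imp_closed open_Compl\<close>)
    then show ?thesis by (simp add: pd_const)
  qed
  have int_k: "integrable lborel (\<lambda>x. H x * (\<Sum>i\<in>UNIV. E $ k $ i * pd i (F k) x))" for k
  proof -
    have "bounded ((\<lambda>x. \<Sum>i\<in>UNIV. E $ k $ i * pd i (F k) x) ` K)"
      using contF' K(1) by (intro compact_imp_bounded compact_continuous_image) (auto intro: continuous_on_subset)
    then obtain C where C: "\<And>x. x \<in> K \<Longrightarrow> \<bar>\<Sum>i\<in>UNIV. E $ k $ i * pd i (F k) x\<bar> \<le> C" by (auto simp: bounded_iff)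
    show ?thesis
    proof (rule integrable_compact_support[OF _ K(1), where C = "M * C"])
      show "\<bar>H x * (\<Sum>i\<in>UNIV. E $ k $ i * pd i (F k) x)\<bar> \<le> M * C" if "x \<in> K" for x
        unfolding abs_mult using H(2) C[OF that] order_trans[OF abs_ge_zero H(2)] by (intro mult_mono) auto
      show "(\<lambda>x. H x * (\<Sum>i\<in>UNIV. E $ k $ i * pd i (F k) x)) \<in> borel_measurable borel"
        using H(1) borel_measurable_continuous_onI[OF contF'] by (rule borel_measurable_times)
    qed (simp add: pdF0)
  qed
  have bound: "\<bar>\<integral>x. H x * (\<Sum>i\<in>UNIV. E $ k $ i * pd i (F k) x) \<partial>lborel\<bar> \<le> (\<integral>x. a x * N x \<partial>lborel)" for k
  proof -
    have "\<bar>\<integral>x. H x * (\<Sum>i\<in>UNIV. E $ k $ i * pd i (F k) x) \<partial>lborel\<bar> \<le> (\<integral>x. a x * \<bar>F k x\<bar> \<partial>lborel)"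
    proof (rule integral_directional_derivative_bound[where F' = "\<lambda>x v. \<Sum>i\<in>UNIV. v $ i * pd i (F k) x" and K = K and b = b])
      show "(F k has_derivative (\<lambda>v. \<Sum>i\<in>UNIV. v $ i * pd i (F k) x)) (at x)" for x
        by (intro C1_on_has_derivative[OF F_C1]) simp
      show "\<bar>H (x + t *\<^sub>R E $ k) - H x\<bar> \<le> \<bar>t\<bar> * (a x + b * \<bar>t\<bar>)" if "x \<in> K" "\<bar>t\<bar> \<le> t0" for x t
        using dq[OF that E] .
    qed (use contF' K F0 H a aM t0 in auto)
    also have "\<dots> \<le> (\<integral>x. a x * N x \<partial>lborel)"
      using int_aF int_aN FN a(2) by (intro integral_mono mult_left_mono) auto
    finally show ?thesis .
  qed
  have "(\<integral>x. H x * (\<Sum>i\<in>UNIV. pd i (Y i) x) \<partial>lborel) =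
      (\<Sum>k\<in>UNIV. \<integral>x. H x * (\<Sum>i\<in>UNIV. E $ k $ i * pd i (F k) x) \<partial>lborel)"
    unfolding div sum_distrib_left[of "H _" _ UNIV, symmetric]
    by (subst Bochner_Integration.integral_sum[symmetric]) (use int_k in \<open>auto simp: sum_distrib_left\<close>)
  also have "\<bar>\<dots>\<bar> \<le> (\<Sum>k\<in>(UNIV::'n set). \<integral>x. a x * N x \<partial>lborel)"
    using bound by (intro order_trans[OF sum_abs] sum_mono)
  finally show ?thesis by (simp add: N_def)
qed

section \<open>Smooth maps in coordinates\<close>

text \<open>The bounded linear map \<open>L\<close> stands for the projection to a component or a
  matrix entry, which reduces vector- and matrix-valued smoothness to the real-valued
  \<open>C1_on\<close>.\<close>

lemma Ck_on_C1_linear: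
  fixes f :: "real^'n::finite \<Rightarrow> 'b::real_normed_vector"
  assumes f: "Ck_on (Suc 0) S f" and L: "bounded_linear L"
  shows "C1_on S (\<lambda>x. L (f x))"
proof (rule C1_onI)
  show "((\<lambda>x. L (f x)) has_derivative (\<lambda>v. L (frechet_derivative f (at x) v))) (at x)" if "x \<in> S" for x
  proof -
    have "(f has_derivative frechet_derivative f (at x)) (at x)"
      using f that by (auto simp: frechet_derivative_works)
    then show ?thesis by (rule bounded_linear.has_derivative[OF L])
  qed
  show "continuous_on S (\<lambda>x. L (frechet_derivative f (at x) (axis i 1)))" for i
    using f by (intro bounded_linear.continuous_on[OF L]) auto
qed

lemma smooth_on_C1_linear: "smooth_on S f \<Longrightarrow> bounded_linear L \<Longrightarrow> C1_on S (\<lambda>x. L (f x))"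
  for f :: "real^'n::finite \<Rightarrow> 'b::real_normed_vector"
  by (rule Ck_on_C1_linear) (simp_all only: smooth_on_def)

lemma smooth_on_C1: "smooth_on S F \<Longrightarrow> C1_on S F" for F :: "real^'n::finite \<Rightarrow> real"
  using smooth_on_C1_linear[OF _ bounded_linear_ident] by blast

lemma smooth_on_pd_C1:
  fixes F :: "real^'n::finite \<Rightarrow> real"
  assumes "smooth_on S F" shows "C1_on S (pd i F)"
proof -
  have "Ck_on (Suc (Suc 0)) S F" using assms by (simp only: smooth_on_def)
  then have "Ck_on (Suc 0) S (\<lambda>x. frechet_derivative F (at x) (axis i 1))" by simp
  from Ck_on_C1_linear[OF this bounded_linear_ident] show ?thesis by (simp add: pd_def[abs_def])
qed

text \<open>A C1 step function, 0 for t \<le> 0 and 1 for t \<ge> 1. The square of the positive part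
  is C1, and applying it twice flattens both ends.\<close>

definition clamp :: "real \<Rightarrow> real" where
  "clamp t = 1 - (max 0 (1 - (max 0 t)\<^sup>2))\<^sup>2"

lemma DERIV_max0_square: "((\<lambda>t. (max 0 t)\<^sup>2) has_real_derivative 2 * max 0 t) (at t)"
proof -
  consider "t > 0" | "t < 0" | "t = 0" by linarith
  then show ?thesis
  proof cases
    case 1
    have "((\<lambda>t. t\<^sup>2) has_real_derivative 2 * max 0 t) (at t)"
      using 1 by (auto intro!: derivative_eq_intros)
    then show ?thesis
      by (rule has_field_derivative_transform_within_open[of _ _ t "{0<..}"]) (use 1 in auto)
  next
    case 2
    have "((\<lambda>_. 0) has_real_derivative 2 * max 0 t) (at t)" using 2 by simp
    then show ?thesis
      by (rule has_field_derivative_transform_within_open[of _ _ t "{..<0}"]) (use 2 in auto)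
  next
    case 3
    have "((\<lambda>t::real. (max 0 t)\<^sup>2 / t) \<longlongrightarrow> 0) (at 0)"
    proof -
      have "(max 0 t)\<^sup>2 / t = max 0 t" for t :: real
        by (cases "t = 0") (auto simp: max_def power2_eq_square)
      moreover have "((\<lambda>t::real. max 0 t) \<longlongrightarrow> max 0 0) (at 0)" by (intro tendsto_intros)
      ultimately show ?thesis by simp
    qed
    then show ?thesis using 3 by (simp add: DERIV_def)
  qed
qed

lemma clamp_facts: "0 \<le> clamp t" "clamp t \<le> 1" "t \<le> 0 \<Longrightarrow> clamp t = 0" "1 \<le> t \<Longrightarrow> clamp t = 1"
proof -
  have "(max 0 (1 - (max 0 t)\<^sup>2))\<^sup>2 \<le> 1" by (intro power_le_one) auto
  then show "0 \<le> clamp t" "clamp t \<le> 1" by (auto simp: clamp_def)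
  show "t \<le> 0 \<Longrightarrow> clamp t = 0" by (simp add: clamp_def)
  assume "1 \<le> t"
  then have "1 \<le> t\<^sup>2" by (rule one_le_power)
  then show "clamp t = 1" using \<open>1 \<le> t\<close> by (simp add: clamp_def)
qed

lemma DERIV_clamp: "(clamp has_real_derivative 4 * max 0 (1 - (max 0 t)\<^sup>2) * max 0 t) (at t)"
proof -
  have 1: "((\<lambda>t. 1 - (max 0 t)\<^sup>2) has_real_derivative - (2 * max 0 t)) (at t)"
    using DERIV_diff[OF DERIV_const DERIV_max0_square] by simp
  have "((\<lambda>t. 1 - (max 0 (1 - (max 0 t)\<^sup>2))\<^sup>2) has_real_derivative 0 - 2 * max 0 (1 - (max 0 t)\<^sup>2) * - (2 * max 0 t)) (at t)"
    by (intro DERIV_diff DERIV_const DERIV_chain2[OF DERIV_max0_square 1])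
  then show ?thesis by (simp add: clamp_def[abs_def] mult.assoc)
qed

text \<open>Here \<open>w\<close> is a covector and \<open>v\<close> a vector. The form is
  nonnegative at z - (b / q) v, where \<open>z\<close> is the vector dual to \<open>w\<close>,
  \<open>b\<close> the pairing of \<open>w\<close> with \<open>v\<close>, and \<open>q\<close> the
  squared length of \<open>v\<close>.\<close>

lemma (in euclidean_metric) cauchy_schwarz:
  assumes x: "x \<in> S"
  shows "(w \<bullet> v)\<^sup>2 \<le> (w \<bullet> (matrix_inv (G x) *v w)) * (v \<bullet> (G x *v v))"
proof (cases "v = 0")
  case False
  define z where "z = matrix_inv (G x) *v w"
  have Gz: "G x *v z = w" by (simp add: z_def matrix_vector_mul_assoc matrix_inv_mult det_nz[OF x])
  have symm: "u1 \<bullet> (G x *v u2) = u2 \<bullet> (G x *v u1)" for u1 u2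
    using dot_lmul_matrix[of u1 "G x" u2] sym[OF x] by (metis inner_commute transpose_matrix_vector)
  define q where "q = v \<bullet> (G x *v v)"
  define b where "b = w \<bullet> v"
  have q: "q > 0" unfolding q_def using pos_def[OF x False] .
  have "0 \<le> (z - (b / q) *\<^sub>R v) \<bullet> (G x *v (z - (b / q) *\<^sub>R v))"
    using pos_def[OF x, of "z - (b / q) *\<^sub>R v"] by (cases "z - (b / q) *\<^sub>R v = 0") auto
  also have "\<dots> = w \<bullet> z - 2 * (b / q) * b + (b / q)\<^sup>2 * q"
  proof -
    have e: "z \<bullet> (G x *v v) = b" "v \<bullet> w = b" "v \<bullet> (G x *v v) = q" "z \<bullet> w = w \<bullet> z"
      using symm[of z v] by (simp_all add: Gz b_def q_def inner_commute)
    show ?thesis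
      by (simp add: matrix_vector_mult_diff_distrib matrix_vector_mult_scaleR Gz
        inner_diff_left inner_diff_right e power2_eq_square)
  qed
  also have "\<dots> = w \<bullet> z - b\<^sup>2 / q" using q by (simp add: field_simps power2_eq_square)
  finally have "b\<^sup>2 \<le> w \<bullet> z * q" using q by (simp add: field_simps)
  then show ?thesis by (simp add: b_def q_def z_def)
qed simp

lemma inner_transpose: "v \<bullet> (transpose J *v w) = (J *v v) \<bullet> w" for J :: "real^'n::finite^'m::finite"
  by (metis dot_lmul_matrix inner_commute transpose_matrix_vector)

lemma inner_vector_matrix_mult: "v \<bullet> (w v* J) = (J *v v) \<bullet> w" for J :: "real^'n::finite^'m::finite"
  by (metis inner_transpose transpose_matrix_vector)

section \<open>Charts and transition maps of the atlas\<close>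

context smooth_manifold
begin

lemma chart_facts:
  assumes "c \<in> A"
  shows open_dom: "open (chart_dom c)" and open_cod: "open (chart_cod c)"
    and cont_coord: "continuous_on (chart_dom c) (coord c)"
    and cont_inv: "continuous_on (chart_cod c) (chart_inv c)"
    and inv_coord: "p \<in> chart_dom c \<Longrightarrow> chart_inv c (coord c p) = p"
    and coord_inv: "x \<in> chart_cod c \<Longrightarrow> coord c (chart_inv c x) = x"
    and coord_in: "p \<in> chart_dom c \<Longrightarrow> coord c p \<in> chart_cod c"
    and inv_in: "x \<in> chart_cod c \<Longrightarrow> chart_inv c x \<in> chart_dom c"
  using charts[OF assms] by (auto simp: is_chart_def homeomorphism_def chart_cod_def)

lemma chart_image_eq:
  assumes "c \<in> A"
  shows "coord c ` (chart_dom c \<inter> U) = chart_cod c \<inter> chart_inv c -` U"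
  using chart_facts[OF assms] by (force simp: chart_cod_def)

lemma chart_inv_image_eq:
  assumes "c \<in> A" "X \<subseteq> chart_cod c"
  shows "chart_inv c ` X = chart_dom c \<inter> coord c -` X"
  using assms(2) chart_facts[OF assms(1)] by (force simp: image_iff)

lemma open_chart_image: "c \<in> A \<Longrightarrow> open U \<Longrightarrow> open (coord c ` (chart_dom c \<inter> U))"
  unfolding chart_image_eq using continuous_open_preimage[OF cont_inv open_cod] by blast

lemma open_chart_inv_image: "c \<in> A \<Longrightarrow> X \<subseteq> chart_cod c \<Longrightarrow> open X \<Longrightarrow> open (chart_inv c ` X)"
  unfolding chart_inv_image_eq using continuous_open_preimage[OF cont_coord open_dom] by blast

lemma transition_C1:
  assumes "c \<in> A" "c' \<in> A"
  shows "C1_on (coord c ` (chart_dom c \<inter> chart_dom c')) (\<lambda>x. coord c' (chart_inv c x) $ k)"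
  using smooth_on_C1_linear[OF compatible[OF assms] bounded_linear_vec_nth] by simp

lemma transition_differentiable:
  assumes "c \<in> A" "c' \<in> A" "x \<in> coord c ` (chart_dom c \<inter> chart_dom c')"
  shows "(coord c' \<circ> chart_inv c) differentiable (at x)"
proof -
  have "Ck_on (Suc 0) (coord c ` (chart_dom c \<inter> chart_dom c')) (coord c' \<circ> chart_inv c)"
    using compatible[OF assms(1,2)] by (simp only: smooth_on_def)
  then show ?thesis using assms(3) by auto
qed

lemma transition_jacobian_works:
  assumes "c \<in> A" "c' \<in> A" "x \<in> coord c ` (chart_dom c \<inter> chart_dom c')"
  shows "((coord c' \<circ> chart_inv c) has_derivative (\<lambda>v. transition_jacobian c c' x *v v)) (at x)"
proof -
  have d: "(coord c' \<circ> chart_inv c has_derivative frechet_derivative (coord c' \<circ> chart_inv c) (at x)) (at x)"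
    using transition_differentiable[OF assms] by (simp add: frechet_derivative_works)
  then show ?thesis
    unfolding transition_jacobian_def using matrix_vector_mul(2)[OF has_derivative_linear[OF d]] d by simp
qed

lemma transition_jacobian_entry:
  assumes "c \<in> A" "c' \<in> A" "x \<in> coord c ` (chart_dom c \<inter> chart_dom c')"
  shows "transition_jacobian c c' x $ k $ i = pd i (\<lambda>x. coord c' (chart_inv c x) $ k) x"
proof -
  have "((\<lambda>x. coord c' (chart_inv c x) $ k) has_derivative (\<lambda>v. (transition_jacobian c c' x *v v) $ k)) (at x)"
    using bounded_linear.has_derivative[OF bounded_linear_vec_nth transition_jacobian_works[OF assms]] by simp
  from pd_eqI[OF this, of i] show ?thesis
    by (simp add: matrix_vector_mult_def axis_def if_distrib cong: if_cong)
qed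

text \<open>The same choice as in \<open>speed\<close>, so that the speed of a curve unfolds into a
  statement about this chart.\<close>

definition chart_at :: "'a \<Rightarrow> ('a, 'n) chart" where
  "chart_at p = (SOME c. c \<in> A \<and> p \<in> chart_dom c)"

lemma chart_at: "chart_at p \<in> A" "p \<in> chart_dom (chart_at p)"
proof -
  have "\<exists>c. c \<in> A \<and> p \<in> chart_dom c" using cover by blast
  then have "chart_at p \<in> A \<and> p \<in> chart_dom (chart_at p)" unfolding chart_at_def by (rule someI_ex)
  then show "chart_at p \<in> A" "p \<in> chart_dom (chart_at p)" by auto
qed

section \<open>Continuously differentiable functions on the manifold\<close>

definition C1_fun :: "('a \<Rightarrow> real) \<Rightarrow> bool" where
  "C1_fun u \<longleftrightarrow> (\<forall>c\<in>A. C1_on (chart_cod c) (u \<circ> chart_inv c))"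

lemma C1_funD: "C1_fun u \<Longrightarrow> c \<in> A \<Longrightarrow> C1_on (chart_cod c) (\<lambda>x. u (chart_inv c x))"
  by (auto simp: C1_fun_def o_def)

lemma C1_fun_const: "C1_fun (\<lambda>_. k)"
  by (simp add: C1_fun_def o_def C1_on_const)

lemma C1_fun_add: "C1_fun u \<Longrightarrow> C1_fun v \<Longrightarrow> C1_fun (\<lambda>p. u p + v p)"
  by (simp add: C1_fun_def o_def C1_on_add)

lemma C1_fun_diff: "C1_fun u \<Longrightarrow> C1_fun v \<Longrightarrow> C1_fun (\<lambda>p. u p - v p)"
  by (simp add: C1_fun_def o_def C1_on_diff)

lemma C1_fun_mult: "C1_fun u \<Longrightarrow> C1_fun v \<Longrightarrow> C1_fun (\<lambda>p. u p * v p)"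
  by (simp add: C1_fun_def o_def C1_on_mult)

lemma smooth_fun_C1: "smooth_fun A u \<Longrightarrow> C1_fun u"
  by (simp add: smooth_fun_def C1_fun_def smooth_on_C1)

lemma continuous_via_charts:
  assumes "\<And>c. c \<in> A \<Longrightarrow> continuous_on (chart_cod c) (\<lambda>x. u (chart_inv c x))"
  shows "continuous_on UNIV u"
proof (rule continuous_at_imp_continuous_on, intro ballI)
  fix p :: 'a
  let ?c = "chart_at p"
  have "continuous_on (chart_dom ?c) (\<lambda>p. u (chart_inv ?c (coord ?c p)))"
    by (rule continuous_on_compose2[OF assms[OF chart_at(1)] cont_coord[OF chart_at(1)]])
       (auto simp: coord_in[OF chart_at(1)])
  then have "continuous_on (chart_dom ?c) u"
    by (rule continuous_on_eq) (simp add: inv_coord[OF chart_at(1)])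
  then show "isCont u p"
    using continuous_on_eq_continuous_at[OF open_dom[OF chart_at(1)]] chart_at(2) by blast
qed

lemma C1_fun_continuous: "C1_fun u \<Longrightarrow> continuous_on UNIV u"
  by (rule continuous_via_charts) (rule C1_on_continuous[OF C1_funD])

text \<open>Despite the name these are the components of the differential, a covector; the inverse
  metric enters only in \<open>gpair\<close>.\<close>

definition gradv :: "('a, 'n) chart \<Rightarrow> ('a \<Rightarrow> real) \<Rightarrow> 'a \<Rightarrow> real ^ 'n" where
  "gradv c u p = (\<chi> i. pd i (u \<circ> chart_inv c) (coord c p))"

text \<open>The chain rule: covectors pull back by the transposed Jacobian.\<close>

lemma gradv_transition:
  assumes u: "C1_fun u" and c: "c \<in> A" "c' \<in> A" "p \<in> chart_dom c" "p \<in> chart_dom c'"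
  shows "gradv c u p = transpose (transition_jacobian c c' (coord c p)) *v gradv c' u p"
proof -
  let ?S = "coord c ` (chart_dom c \<inter> chart_dom c')"
  have p: "coord c p \<in> ?S" using c by auto
  have S: "open ?S" using open_chart_image[OF c(1) open_dom[OF c(2)]] .
  have sub: "(\<lambda>x. coord c' (chart_inv c x)) ` ?S \<subseteq> chart_cod c'"
    using inv_coord[OF c(1)] coord_in[OF c(2)] by auto
  have "pd i (u \<circ> chart_inv c) (coord c p) =
    (\<Sum>k\<in>UNIV. pd k (u \<circ> chart_inv c') (coord c' p) * transition_jacobian c c' (coord c p) $ k $ i)" for i
  proof -
    have "pd i (u \<circ> chart_inv c) (coord c p) =
        pd i (\<lambda>x. (u \<circ> chart_inv c') (coord c' (chart_inv c x))) (coord c p)"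
      by (rule pd_cong[OF S p]) (auto simp: inv_coord[OF c(1)] inv_coord[OF c(2)])
    also have "\<dots> = (\<Sum>k\<in>UNIV. pd k (u \<circ> chart_inv c') (coord c' (chart_inv c (coord c p))) *
        pd i (\<lambda>x. coord c' (chart_inv c x) $ k) (coord c p))"
      by (rule C1_on_compose_map(2)[OF _ transition_C1[OF c(1,2)] sub p])
         (use u c(2) in \<open>auto simp: C1_fun_def o_def\<close>)
    finally show ?thesis
      using c by (simp add: transition_jacobian_entry[OF c(1,2) p] inv_coord)
  qed
  then show ?thesis
    by (simp add: vec_eq_iff gradv_def matrix_vector_mult_def transpose_def mult.commute)
qed

text \<open>The function is C1 in every chart: on the overlap with \<open>c\<close> it is a C1
  function of the coordinates of \<open>c\<close>, and off the compact, hence closed, set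
  \<open>K\<close> it vanishes; these two open sets cover the chart.\<close>

lemma bump_function:
  assumes U: "open U" "p \<in> U" "p \<in> chart_dom c" and c: "c \<in> A"
  obtains H W K where "C1_fun H" "\<And>q. 0 \<le> H q" "\<And>q. H q \<le> 1" "open W" "p \<in> W" "\<And>q. q \<in> W \<Longrightarrow> H q = 1"
    "compact K" "K \<subseteq> U \<inter> chart_dom c" "\<And>q. q \<notin> K \<Longrightarrow> H q = 0"
proof -
  define x0 where "x0 = coord c p"
  have "open (coord c ` (chart_dom c \<inter> U))" using open_chart_image[OF c U(1)] .
  moreover have "x0 \<in> coord c ` (chart_dom c \<inter> U)" using U by (auto simp: x0_def)
  ultimately obtain \<delta> where \<delta>: "\<delta> > 0" "cball x0 \<delta> \<subseteq> coord c ` (chart_dom c \<inter> U)"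
    by (meson open_contains_cball)
  have cod: "cball x0 \<delta> \<subseteq> chart_cod c" using \<delta>(2) by (auto simp: chart_cod_def)
  \<comment> \<open>The argument of \<open>clamp\<close> is at least 1 within distance \<delta> / 2
    of \<open>x0\<close> and negative from distance \<delta> on. The squared distance is a
    polynomial in the coordinates and thus also differentiable at \<open>x0\<close>.\<close>
  define b where "b x = clamp (2 - 4 / \<delta>\<^sup>2 * (\<Sum>i\<in>UNIV. (x $ i - x0 $ i) * (x $ i - x0 $ i)))" for x
  have b_eq: "b x = clamp (2 - 4 / \<delta>\<^sup>2 * (dist x0 x)\<^sup>2)" for x
    by (simp add: b_def dist_norm norm_minus_commute[of x0] power2_norm_eq_inner inner_vec_def)
  have b_C1: "C1_on S b" for S
    unfolding b_def[abs_def]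
  proof (rule C1_on_compose_real[where u = clamp and u' = "\<lambda>t. 4 * max 0 (1 - (max 0 t)\<^sup>2) * max 0 t"])
    show "C1_on S (\<lambda>x. 2 - 4 / \<delta>\<^sup>2 * (\<Sum>i\<in>UNIV. (x $ i - x0 $ i) * (x $ i - x0 $ i)))"
      by (intro C1_on_diff C1_on_mult C1_on_sum C1_on_const C1_on_coordinate)
    show "continuous_on X (\<lambda>t. 4 * max 0 (1 - (max 0 t)\<^sup>2) * max 0 t)" for X :: "real set"
      by (intro continuous_intros)
  qed (rule DERIV_clamp)
  define H where "H q = (if q \<in> chart_dom c then b (coord c q) else 0)" for q
  define K where "K = chart_inv c ` cball x0 \<delta>"
  define W where "W = chart_inv c ` ball x0 (\<delta> / 2)"
  have "compact K" unfolding K_def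
    using cont_inv[OF c] cod by (intro compact_continuous_image) (auto intro: continuous_on_subset)
  moreover have K: "K \<subseteq> U \<inter> chart_dom c"
    using \<delta>(2) inv_coord[OF c] by (fastforce simp: K_def)
  moreover have H0: "H q = 0" if "q \<notin> K" for q
  proof (cases "q \<in> chart_dom c")
    case True
    have "coord c q \<notin> cball x0 \<delta>" using that inv_coord[OF c True] by (force simp: K_def)
    then have "\<delta>\<^sup>2 \<le> (dist x0 (coord c q))\<^sup>2" using \<delta>(1) by (intro power_mono) auto
    then have "4 / \<delta>\<^sup>2 * \<delta>\<^sup>2 \<le> 4 / \<delta>\<^sup>2 * (dist x0 (coord c q))\<^sup>2"
      by (rule mult_left_mono) simp
    then have "2 - 4 / \<delta>\<^sup>2 * (dist x0 (coord c q))\<^sup>2 \<le> 0" using \<delta>(1) by simp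
    then show ?thesis using clamp_facts(3) by (simp add: H_def b_eq)
  qed (simp add: H_def)
  moreover have "open W"
  proof -
    have "ball x0 (\<delta> / 2) \<subseteq> cball x0 \<delta>" using \<delta>(1) by (intro order_trans[OF ball_subset_cball] subset_cball) simp
    then show ?thesis unfolding W_def using cod by (intro open_chart_inv_image c) auto
  qed
  moreover have "p \<in> W" unfolding W_def x0_def
    using \<delta>(1) inv_coord[OF c U(3)] by (intro image_eqI[of _ _ "coord c p"]) auto
  moreover have "H q = 1" if q: "q \<in> W" for q
  proof -
    obtain x where xb: "q = chart_inv c x" "x \<in> ball x0 (\<delta> / 2)" using q unfolding W_def by blast
    then have x: "q = chart_inv c x" "dist x0 x < \<delta> / 2" by auto
    then have "x \<in> cball x0 \<delta>" using \<delta>(1) by simp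
    then have xc: "x \<in> chart_cod c" using cod by blast
    have "(dist x0 x)\<^sup>2 \<le> (\<delta> / 2)\<^sup>2" using x(2) by (intro power_mono) auto
    then have "1 \<le> 2 - 4 / \<delta>\<^sup>2 * (dist x0 x)\<^sup>2" using \<delta>(1) by (simp add: field_simps power2_eq_square)
    then show ?thesis using clamp_facts(4) xc by (simp add: H_def b_eq x(1) inv_in[OF c] coord_inv[OF c])
  qed
  moreover have "C1_fun H"
    unfolding C1_fun_def o_def
  proof
    fix c' assume c': "c' \<in> A"
    let ?S = "coord c' ` (chart_dom c' \<inter> chart_dom c)" and ?S' = "coord c' ` (chart_dom c' \<inter> - K)"
    have open_S: "open ?S" "open ?S'"
      using open_chart_image[OF c'] open_dom[OF c] compact_imp_closed[OF \<open>compact K\<close>] by auto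
    have "C1_on ?S (\<lambda>x. b (coord c (chart_inv c' x)))"
      by (rule C1_on_compose_map(1)[OF b_C1[of UNIV] transition_C1[OF c' c]]) simp
    then have "C1_on ?S (\<lambda>x. H (chart_inv c' x))"
      by (rule C1_on_cong[OF open_S(1)]) (auto simp: H_def inv_coord[OF c'])
    moreover have "C1_on ?S' (\<lambda>x. H (chart_inv c' x))"
      by (rule C1_on_cong[OF open_S(2) C1_on_const[of _ 0]]) (auto simp: H0 inv_coord[OF c'])
    ultimately have "C1_on (?S \<union> ?S') (\<lambda>x. H (chart_inv c' x))"
      by (rule C1_on_Un[OF open_S])
    moreover have "?S \<union> ?S' = chart_cod c'" using K by (auto simp: chart_cod_def)
    ultimately show "C1_on (chart_cod c') (\<lambda>x. H (chart_inv c' x))" by simp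
  qed
  moreover have "0 \<le> H q" "H q \<le> 1" for q using clamp_facts by (auto simp: H_def b_def)
  ultimately show thesis using that by blast
qed

end

section \<open>The Riemannian inner product of gradients\<close>

context riemannian_manifold
begin

lemma euclidean_metric_chart:
  assumes c: "c \<in> A"
  shows "euclidean_metric (chart_cod c) (g c)"
proof
  show "C1_on (chart_cod c) (\<lambda>x. g c x $ a $ b)" for a b
    by (rule smooth_on_C1_linear[OF metric_smooth[OF c], of "\<lambda>M. M $ a $ b"])
       (rule bounded_linear_compose[OF bounded_linear_vec_nth bounded_linear_vec_nth])
qed (use open_cod[OF c] metric_symmetric[OF c] metric_pos_def[OF c] in auto)

definition gnorm :: "('a, 'n) chart \<Rightarrow> real^'n \<Rightarrow> real^'n \<Rightarrow> real" where
  "gnorm c x v = sqrt (v \<bullet> (g c x *v v))"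

lemma gnorm_nonneg:
  assumes "c \<in> A" "x \<in> chart_cod c" shows "0 \<le> v \<bullet> (g c x *v v)" "0 \<le> gnorm c x v"
  using metric_pos_def[OF assms, of v] by (auto simp: gnorm_def) (cases "v = 0"; simp)+

lemma gnorm_transition:
  assumes c: "c \<in> A" "c' \<in> A" "p \<in> chart_dom c" "p \<in> chart_dom c'"
  shows "gnorm c (coord c p) v = gnorm c' (coord c' p) (transition_jacobian c c' (coord c p) *v v)"
  using metric_tensorial[OF c(1,2), of p] c
  by (simp add: gnorm_def matrix_vector_mul_assoc[symmetric] inner_vector_matrix_mult)

lemma continuous_on_gnorm:
  assumes "c \<in> A" "continuous_on T \<xi>" "\<xi> ` T \<subseteq> chart_cod c" "continuous_on T v"
  shows "continuous_on T (\<lambda>t. gnorm c (\<xi> t) (v t))"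
proof -
  interpret euclidean_metric "chart_cod c" "g c" by (rule euclidean_metric_chart[OF assms(1)])
  have cv: "continuous_on T (\<lambda>t. v t $ a)" for a
    using assms(4) by (intro continuous_intros)
  have cg: "continuous_on T (\<lambda>t. g c (\<xi> t) $ a $ b)" for a b
    using continuous_on_compose2[OF C1_on_continuous[OF G] assms(2,3)] .
  have "continuous_on T (\<lambda>t. \<Sum>a\<in>UNIV. v t $ a * (\<Sum>b\<in>UNIV. g c (\<xi> t) $ a $ b * v t $ b))"
    by (intro continuous_on_sum continuous_on_mult cg cv)
  then show ?thesis
    using continuous_on_real_sqrt by (simp add: gnorm_def inner_vec_def matrix_vector_mult_def)
qed

text \<open>The inner product of the gradients of \<open>u\<close> and \<open>v\<close>, computed as
  the inverse metric applied to the two differentials in a chosen chart.\<close>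

definition gpair :: "('a \<Rightarrow> real) \<Rightarrow> ('a \<Rightarrow> real) \<Rightarrow> 'a \<Rightarrow> real" where
  "gpair u v p = (let c = chart_at p in
     gradv c u p \<bullet> (matrix_inv (g c (coord c p)) *v gradv c v p))"

text \<open>Independence of the chart: G = J^T G' J implies J G^-1 J^T = G'^-1, which accounts for
  the factors J^T picked up by the two differentials.\<close>

lemma gpair_eq:
  assumes u: "C1_fun u" "C1_fun v" and c: "c \<in> A" "p \<in> chart_dom c"
  shows "gpair u v p = gradv c u p \<bullet> (matrix_inv (g c (coord c p)) *v gradv c v p)"
proof -
  define c' where "c' = chart_at p"
  have c': "c' \<in> A" "p \<in> chart_dom c'" by (simp_all add: c'_def chart_at)
  define J where "J = transition_jacobian c c' (coord c p)"
  define G where "G = g c (coord c p)"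
  define G' where "G' = g c' (coord c' p)"
  have GJ: "G = transpose J ** G' ** J"
    unfolding G_def G'_def J_def using metric_tensorial[OF c(1) c'(1)] c c' by blast
  have nz: "det G \<noteq> 0" "det G' \<noteq> 0"
    unfolding G_def G'_def using euclidean_metric.det_nz[OF euclidean_metric_chart] coord_in c c' by blast+
  have nzJ: "det J \<noteq> 0" using nz(1) by (auto simp: GJ det_mul)
  have JI: "matrix_inv (transpose J) ** transpose J = mat 1"
    using nzJ by (intro matrix_inv_mult) simp
  have "transpose J ** (G' ** (J ** matrix_inv G ** transpose J)) = (transpose J ** G' ** J) ** matrix_inv G ** transpose J"
    by (simp add: matrix_mul_assoc)
  also have "\<dots> = transpose J" unfolding GJ[symmetric] by (simp add: matrix_inv_mult(1)[OF nz(1)])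
  finally have "matrix_inv (transpose J) ** (transpose J ** (G' ** (J ** matrix_inv G ** transpose J))) = mat 1"
    by (simp add: JI)
  then have "G' ** (J ** matrix_inv G ** transpose J) = mat 1"
    unfolding matrix_mul_assoc JI by simp
  then have "matrix_inv G' ** (G' ** (J ** matrix_inv G ** transpose J)) = matrix_inv G'" by simp
  then have inv: "J ** matrix_inv G ** transpose J = matrix_inv G'"
    unfolding matrix_mul_assoc[of _ G'] matrix_inv_mult(2)[OF nz(2)] by simp
  have grad: "gradv c w p = transpose J *v gradv c' w p" if "C1_fun w" for w
    unfolding J_def by (rule gradv_transition[OF that c(1) c'(1) c(2) c'(2)])
  have "gradv c u p \<bullet> (matrix_inv G *v gradv c v p) =
      gradv c' u p \<bullet> ((J ** matrix_inv G ** transpose J) *v gradv c' v p)"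
    unfolding grad[OF u(1)] grad[OF u(2)]
    by (simp add: matrix_vector_mul_assoc[symmetric] transpose_matrix_vector dot_lmul_matrix)
  then show ?thesis unfolding inv by (simp add: gpair_def Let_def c'_def G_def G'_def)
qed

lemma gpair_continuous:
  assumes u: "C1_fun u" "C1_fun v"
  shows "continuous_on UNIV (gpair u v)"
proof (rule continuous_via_charts)
  fix c assume c: "c \<in> A"
  interpret euclidean_metric "chart_cod c" "g c" by (rule euclidean_metric_chart[OF c])
  have "continuous_on (chart_cod c) (\<lambda>x. \<Sum>i\<in>UNIV. pd i (u \<circ> chart_inv c) x * (\<Sum>j\<in>UNIV. h i j x * pd j (v \<circ> chart_inv c) x))"
    by (intro continuous_intros C1_on_continuous[OF h_C1] C1_onD(2)) (use u c in \<open>auto simp: C1_fun_def\<close>)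
  then show "continuous_on (chart_cod c) (\<lambda>x. gpair u v (chart_inv c x))"
    by (rule continuous_on_eq)
       (simp add: gpair_eq[OF u c] inv_in[OF c] gradv_def coord_inv[OF c] inner_vec_def matrix_vector_mult_def)
qed

lemma gpair_add: "C1_fun u1 \<Longrightarrow> C1_fun u2 \<Longrightarrow> gpair (\<lambda>p. u1 p + u2 p) v p = gpair u1 v p + gpair u2 v p"
proof -
  assume u: "C1_fun u1" "C1_fun u2"
  let ?c = "chart_at p"
  have "gradv ?c (\<lambda>p. u1 p + u2 p) p = gradv ?c u1 p + gradv ?c u2 p"
  proof -
    have "pd i (\<lambda>x. u1 (chart_inv ?c x) + u2 (chart_inv ?c x)) (coord ?c p) =
      pd i (\<lambda>x. u1 (chart_inv ?c x)) (coord ?c p) + pd i (\<lambda>x. u2 (chart_inv ?c x)) (coord ?c p)" for i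
      using has_derivative_add[OF C1_on_has_derivative[OF C1_funD[OF u(1)]] C1_on_has_derivative[OF C1_funD[OF u(2)]],
          OF chart_at(1) coord_in[OF chart_at] chart_at(1) coord_in[OF chart_at], THEN pd_eqI, of i]
      by (simp add: axis_def if_distrib[of "\<lambda>u. u * _"] cong: if_cong)
    then show ?thesis by (simp add: gradv_def vec_eq_iff o_def)
  qed
  then show ?thesis by (simp add: gpair_def Let_def inner_add_left)
qed

lemma gpair_local:
  assumes "open W" "p \<in> W" "\<And>q. q \<in> W \<Longrightarrow> u q = k"
  shows "gpair u v p = 0"
proof -
  let ?c = "chart_at p"
  have "pd i (u \<circ> chart_inv ?c) (coord ?c p) = 0" for i
  proof -
    have "pd i (u \<circ> chart_inv ?c) (coord ?c p) = pd i (\<lambda>_. k) (coord ?c p)"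
    proof (rule pd_cong[OF open_chart_image[OF chart_at(1) assms(1)]])
      show "coord ?c p \<in> coord ?c ` (chart_dom ?c \<inter> W)" using assms(2) chart_at(2) by blast
      show "(u \<circ> chart_inv ?c) y = k" if "y \<in> coord ?c ` (chart_dom ?c \<inter> W)" for y
        using that assms(3) by (auto simp: inv_coord[OF chart_at(1)])
    qed
    then show ?thesis by (simp add: pd_const)
  qed
  then have "gradv ?c u p = 0" by (simp add: gradv_def vec_eq_iff)
  then show ?thesis by (simp add: gpair_def Let_def)
qed

lemma gradv_cauchy_schwarz:
  assumes u: "C1_fun u" and c: "c \<in> A" "p \<in> chart_dom c"
  shows "\<bar>gradv c u p \<bullet> v\<bar> \<le> sqrt (gpair u u p) * gnorm c (coord c p) v"
proof -
  interpret euclidean_metric "chart_cod c" "g c" by (rule euclidean_metric_chart[OF c(1)])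
  have "\<bar>gradv c u p \<bullet> v\<bar> = sqrt ((gradv c u p \<bullet> v)\<^sup>2)" by simp
  also have "\<dots> \<le> sqrt (gpair u u p * (v \<bullet> (g c (coord c p) *v v)))"
    unfolding gpair_eq[OF u u c] by (intro real_sqrt_le_mono cauchy_schwarz coord_in[OF c])
  finally show ?thesis by (simp add: gnorm_def real_sqrt_mult)
qed

lemma gpair_nonneg: "C1_fun u \<Longrightarrow> 0 \<le> gpair u u p"
proof -
  interpret euclidean_metric "chart_cod (chart_at p)" "g (chart_at p)"
    by (rule euclidean_metric_chart[OF chart_at(1)])
  have x: "coord (chart_at p) p \<in> chart_cod (chart_at p)" by (rule coord_in[OF chart_at])
  define w where "w = gradv (chart_at p) u p"
  define z where "z = matrix_inv (g (chart_at p) (coord (chart_at p) p)) *v w"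
  have "g (chart_at p) (coord (chart_at p) p) *v z = w"
    by (simp add: z_def matrix_vector_mul_assoc matrix_inv_mult det_nz[OF x])
  then have "w \<bullet> z = z \<bullet> (g (chart_at p) (coord (chart_at p) p) *v z)" by (simp add: inner_commute)
  also have "\<dots> \<ge> 0" using gnorm_nonneg[OF chart_at(1) x] by simp
  finally show ?thesis by (simp add: gpair_def Let_def w_def z_def)
qed

text \<open>A bounded gradient makes the function Lipschitz for the distance. Applied to bump
  functions, this yields lower bounds for the distance.\<close>

lemma gradient_bounded:
  assumes u: "C1_fun u" and K: "compact K" "\<And>q. q \<notin> K \<Longrightarrow> u q = 0"
  obtains C where "0 \<le> C" "\<And>p. sqrt (gpair u u p) \<le> C"
proof -
  have "continuous_on UNIV (\<lambda>p. sqrt (gpair u u p))"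
    by (intro continuous_intros gpair_continuous u)
  then have "bounded ((\<lambda>p. sqrt (gpair u u p)) ` K)"
    using K(1) by (intro compact_imp_bounded compact_continuous_image) (auto intro: continuous_on_subset)
  then obtain C where C: "\<And>p. p \<in> K \<Longrightarrow> \<bar>sqrt (gpair u u p)\<bar> \<le> C" by (auto simp: bounded_iff)
  have "sqrt (gpair u u p) \<le> max C 0" for p
  proof (cases "p \<in> K")
    case False
    have "gpair u u p = 0"
      by (rule gpair_local[of "- K" _ _ 0]) (use K False in \<open>auto simp: compact_imp_closed open_Compl\<close>)
    then show ?thesis by simp
  qed (use C in force)
  then show thesis by (intro that[of "max C 0"]) auto
qed

end

section \<open>Curves and their length\<close>

lemma C1_curve_on_subinterval:
  assumes "C1_curve_on A a b \<gamma>" "a \<le> a'" "b' \<le> b"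
  shows "C1_curve_on A a' b' \<gamma>"
  unfolding C1_curve_on_def
proof (intro conjI ballI)
  have sub: "{a'..b'} \<subseteq> {a..b}" using assms by auto
  show "continuous_on {a'..b'} \<gamma>" using assms(1) sub by (auto simp: C1_curve_on_def intro: continuous_on_subset)
  fix c assume "c \<in> A"
  then obtain D where D: "continuous_on {t\<in>{a..b}. \<gamma> t \<in> chart_dom c} D"
    "\<And>t. t \<in> {a..b} \<Longrightarrow> \<gamma> t \<in> chart_dom c \<Longrightarrow> ((coord c \<circ> \<gamma>) has_vector_derivative D t) (at t within {a..b})"
    using assms(1) unfolding C1_curve_on_def by blast
  show "\<exists>D. continuous_on {t\<in>{a'..b'}. \<gamma> t \<in> chart_dom c} D \<and>
      (\<forall>t\<in>{a'..b'}. \<gamma> t \<in> chart_dom c \<longrightarrow> ((coord c \<circ> \<gamma>) has_vector_derivative D t) (at t within {a'..b'}))"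
    using D sub by (intro exI[of _ D] conjI ballI impI)
      (blast intro: continuous_on_subset has_vector_derivative_within_subset)+
qed

lemma C1_curve_on_cong:
  assumes "C1_curve_on A a b \<gamma>" "\<And>t. t \<in> {a..b} \<Longrightarrow> \<gamma>' t = \<gamma> t"
  shows "C1_curve_on A a b \<gamma>'"
proof -
  have "{t\<in>{a..b}. \<gamma>' t \<in> chart_dom c} = {t\<in>{a..b}. \<gamma> t \<in> chart_dom c}" for c
    using assms(2) by auto
  moreover have "continuous_on {a..b} \<gamma>' \<longleftrightarrow> continuous_on {a..b} \<gamma>"
    using assms(2) by (intro continuous_on_cong) auto
  moreover have "((coord c \<circ> \<gamma>') has_vector_derivative D) (at t within {a..b})"
    if "((coord c \<circ> \<gamma>) has_vector_derivative D) (at t within {a..b})" "t \<in> {a..b}" for c D t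
    using that(1) by (rule has_vector_derivative_transform[OF that(2), rotated]) (simp add: assms(2))
  ultimately show ?thesis using assms(1,2) unfolding C1_curve_on_def by (metis (mono_tags, lifting))
qed

lemma C1_curve_on_affine:
  fixes \<phi> :: "real \<Rightarrow> real"
  assumes \<gamma>: "C1_curve_on A a b \<gamma>" and \<phi>: "\<And>s. \<phi> s = \<alpha> + \<beta> * s" "\<phi> ` {a'..b'} \<subseteq> {a..b}"
  shows "C1_curve_on A a' b' (\<gamma> \<circ> \<phi>)"
  unfolding C1_curve_on_def
proof (intro conjI ballI)
  have d\<phi>: "(\<phi> has_vector_derivative \<beta>) (at s within X)" for s X
  proof -
    have "((\<lambda>s. \<alpha> + \<beta> * s) has_vector_derivative \<beta>) (at s within X)"
      by (auto intro!: derivative_eq_intros simp: has_vector_derivative_def)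
    moreover have "\<phi> = (\<lambda>s. \<alpha> + \<beta> * s)" using \<phi>(1) by auto
    ultimately show ?thesis by simp
  qed
  have c\<phi>: "continuous_on X \<phi>" for X
    using d\<phi> by (meson continuous_on_eq_continuous_within has_vector_derivative_continuous)
  show "continuous_on {a'..b'} (\<gamma> \<circ> \<phi>)"
    using \<gamma> \<phi>(2) by (intro continuous_on_compose c\<phi>) (auto simp: C1_curve_on_def intro: continuous_on_subset)
  fix c assume "c \<in> A"
  then obtain D where D: "continuous_on {t\<in>{a..b}. \<gamma> t \<in> chart_dom c} D"
    "\<And>t. t \<in> {a..b} \<Longrightarrow> \<gamma> t \<in> chart_dom c \<Longrightarrow> ((coord c \<circ> \<gamma>) has_vector_derivative D t) (at t within {a..b})"
    using \<gamma> unfolding C1_curve_on_def by blast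
  show "\<exists>D. continuous_on {t\<in>{a'..b'}. (\<gamma> \<circ> \<phi>) t \<in> chart_dom c} D \<and>
      (\<forall>t\<in>{a'..b'}. (\<gamma> \<circ> \<phi>) t \<in> chart_dom c \<longrightarrow>
        ((coord c \<circ> (\<gamma> \<circ> \<phi>)) has_vector_derivative D t) (at t within {a'..b'}))"
  proof (intro exI[of _ "\<lambda>s. \<beta> *\<^sub>R D (\<phi> s)"] conjI ballI impI)
    show "continuous_on {t\<in>{a'..b'}. (\<gamma> \<circ> \<phi>) t \<in> chart_dom c} (\<lambda>s. \<beta> *\<^sub>R D (\<phi> s))"
      using \<phi>(2) by (intro continuous_intros continuous_on_compose2[OF D(1) c\<phi>]) (auto simp: image_subset_iff)
    fix t assume t: "t \<in> {a'..b'}" "(\<gamma> \<circ> \<phi>) t \<in> chart_dom c"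
    have "((coord c \<circ> \<gamma>) has_vector_derivative D (\<phi> t)) (at (\<phi> t) within \<phi> ` {a'..b'})"
    proof (rule has_vector_derivative_within_subset[OF D(2) \<phi>(2)])
      show "\<phi> t \<in> {a..b}" using t(1) \<phi>(2) by blast
    qed (use t(2) in simp)
    from vector_diff_chain_within[OF d\<phi> this]
    show "((coord c \<circ> (\<gamma> \<circ> \<phi>)) has_vector_derivative \<beta> *\<^sub>R D (\<phi> t)) (at t within {a'..b'})"
      by (simp add: o_def)
  qed
qed

lemma piecewise_C1_curveE:
  assumes "piecewise_C1_curve A \<gamma>"
  obtains S where "finite S" "{0, 1} \<subseteq> S" "S \<subseteq> {0..1}"
    "\<And>a b. a \<in> S \<Longrightarrow> b \<in> S \<Longrightarrow> a < b \<Longrightarrow> {a<..<b} \<inter> S = {} \<Longrightarrow> C1_curve_on A a b \<gamma>"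
proof -
  from assms obtain S where S: "finite S \<and> {0, 1} \<subseteq> S \<and> S \<subseteq> {0..1} \<and>
     (\<forall>a\<in>S. \<forall>b\<in>S. a < b \<and> {a<..<b} \<inter> S = {} \<longrightarrow> C1_curve_on A a b \<gamma>)"
    unfolding piecewise_C1_curve_def by (elim exE)
  show thesis
  proof (rule that[of S])
    show "C1_curve_on A a b \<gamma>" if "a \<in> S" "b \<in> S" "a < b" "{a<..<b} \<inter> S = {}" for a b
      using S that by simp
  qed (use S in simp_all)
qed

context riemannian_manifold
begin

text \<open>The derivative within \<open>{a..b}\<close> is one-sided at the endpoints, which makes
  this function continuous up to them, whereas \<open>speed\<close> takes the two-sided derivative,
  which need not exist there. The two agree in the interior, so their integrals coincide.\<close>

definition speed_on :: "real \<Rightarrow> real \<Rightarrow> (real \<Rightarrow> 'a) \<Rightarrow> real \<Rightarrow> real" where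
  "speed_on a b \<gamma> t = gnorm (chart_at (\<gamma> t)) (coord (chart_at (\<gamma> t)) (\<gamma> t))
     (vector_derivative (coord (chart_at (\<gamma> t)) \<circ> \<gamma>) (at t within {a..b}))"

lemma speed_eq: "speed A g \<gamma> t = gnorm (chart_at (\<gamma> t)) (coord (chart_at (\<gamma> t)) (\<gamma> t))
     (vector_derivative (coord (chart_at (\<gamma> t)) \<circ> \<gamma>) (at t))"
  by (simp add: speed_def chart_at_def gnorm_def Let_def)

lemma speed_cong:
  assumes "open U" "t \<in> U" "\<And>s. s \<in> U \<Longrightarrow> \<gamma> s = \<gamma>' s"
  shows "speed A g \<gamma> t = speed A g \<gamma>' t"
proof -
  have "\<gamma> t = \<gamma>' t" using assms by auto
  moreover have "vector_derivative (f \<circ> \<gamma>) (at t) = vector_derivative (f \<circ> \<gamma>') (at t)" for f :: "'a \<Rightarrow> real^'n"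
    using eventually_nhds_in_open[OF assms(1,2)]
    by (intro vector_derivative_cong_eq) (auto elim!: eventually_mono simp: assms(3))
  ultimately show ?thesis by (simp add: speed_eq)
qed

context
  fixes a b :: real and \<gamma> :: "real \<Rightarrow> 'a"
  assumes ab: "a < b" and \<gamma>: "C1_curve_on A a b \<gamma>"
begin

abbreviation vel where "vel c t \<equiv> vector_derivative (coord c \<circ> \<gamma>) (at t within {a..b})"

lemma vel_works:
  assumes "c \<in> A" "t \<in> {a..b}" "\<gamma> t \<in> chart_dom c"
  shows "((coord c \<circ> \<gamma>) has_vector_derivative vel c t) (at t within {a..b})"
  using \<gamma> assms vector_derivative_within_closed_interval[OF ab assms(2)] unfolding C1_curve_on_def by metis

lemma vel_continuous:
  assumes "c \<in> A"
  shows "continuous_on {t\<in>{a..b}. \<gamma> t \<in> chart_dom c} (vel c)"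
proof -
  obtain D where D: "continuous_on {t\<in>{a..b}. \<gamma> t \<in> chart_dom c} D"
    "\<And>t. t \<in> {a..b} \<Longrightarrow> \<gamma> t \<in> chart_dom c \<Longrightarrow> ((coord c \<circ> \<gamma>) has_vector_derivative D t) (at t within {a..b})"
    using \<gamma> assms unfolding C1_curve_on_def by blast
  show ?thesis using D(1)
    by (rule continuous_on_eq) (auto simp: vector_derivative_within_closed_interval[OF ab _ D(2)])
qed

lemma curve_continuous: "continuous_on {a..b} \<gamma>"
  using \<gamma> by (simp add: C1_curve_on_def)

lemma curve_eventually_in:
  assumes "t \<in> {a..b}" "open U" "\<gamma> t \<in> U"
  shows "\<forall>\<^sub>F s in at t within {a..b}. \<gamma> s \<in> U"
  using curve_continuous assms unfolding continuous_on_def by (blast intro: topological_tendstoD)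

lemma compose_curve_derivative:
  fixes f :: "'a \<Rightarrow> 'b::real_normed_vector"
  assumes c: "c \<in> A" "t \<in> {a..b}" "\<gamma> t \<in> chart_dom c"
    and f: "((\<lambda>x. f (chart_inv c x)) has_derivative f') (at (coord c (\<gamma> t)))"
  shows "((\<lambda>s. f (\<gamma> s)) has_vector_derivative f' (vel c t)) (at t within {a..b})"
proof -
  have "((coord c \<circ> \<gamma>) has_derivative (\<lambda>h. h *\<^sub>R vel c t)) (at t within {a..b})"
    using vel_works[OF c] by (simp add: has_vector_derivative_def)
  then have "((\<lambda>s. f (chart_inv c ((coord c \<circ> \<gamma>) s))) has_derivative (\<lambda>h. f' (h *\<^sub>R vel c t))) (at t within {a..b})"
    using f by (intro has_derivative_compose[of "coord c \<circ> \<gamma>" _ _ _ "\<lambda>x. f (chart_inv c x)"]) auto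
  moreover have "\<forall>\<^sub>F s in at t within {a..b}. f (chart_inv c ((coord c \<circ> \<gamma>) s)) = f (\<gamma> s)"
    using curve_eventually_in[OF c(2) open_dom[OF c(1)] c(3)]
    by (rule eventually_mono) (simp add: inv_coord[OF c(1)])
  ultimately have "((\<lambda>s. f (\<gamma> s)) has_derivative (\<lambda>h. f' (h *\<^sub>R vel c t))) (at t within {a..b})"
    by (rule has_derivative_transform_eventually) (use c in \<open>auto simp: inv_coord[OF c(1)]\<close>)
  then show ?thesis
    using linear_scale[OF has_derivative_linear[OF f]] by (simp add: has_vector_derivative_def)
qed

lemma vel_transition:
  assumes c: "c \<in> A" "c' \<in> A" "t \<in> {a..b}" "\<gamma> t \<in> chart_dom c" "\<gamma> t \<in> chart_dom c'"
  shows "vel c' t = transition_jacobian c c' (coord c (\<gamma> t)) *v vel c t"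
proof -
  have "((\<lambda>x. coord c' (chart_inv c x)) has_derivative (*v) (transition_jacobian c c' (coord c (\<gamma> t)))) (at (coord c (\<gamma> t)))"
    using transition_jacobian_works[OF c(1,2), of "coord c (\<gamma> t)"] c by (auto simp: o_def)
  from compose_curve_derivative[OF c(1,3,4) this] show ?thesis
    using vector_derivative_within_closed_interval[OF ab c(3)] by (simp add: o_def)
qed

lemma speed_on_eq:
  assumes c: "c \<in> A" "t \<in> {a..b}" "\<gamma> t \<in> chart_dom c"
  shows "speed_on a b \<gamma> t = gnorm c (coord c (\<gamma> t)) (vel c t)"
  unfolding speed_on_def vel_transition[OF chart_at(1) c(1,2) chart_at(2) c(3)]
  using gnorm_transition[OF chart_at(1) c(1) chart_at(2) c(3)]
    vel_transition[OF c(1) chart_at(1) c(2,3) chart_at(2)]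
    vel_transition[OF chart_at(1) c(1,2) chart_at(2) c(3)] by metis

lemma speed_on_nonneg: "0 \<le> speed_on a b \<gamma> t"
  unfolding speed_on_def by (rule gnorm_nonneg(2)[OF chart_at(1) coord_in[OF chart_at]])

text \<open>The definition picks a new chart at every parameter; near a given \<open>t\<close> a
  single chart serves, by \<open>speed_on_eq\<close>.\<close>

lemma speed_on_continuous: "continuous_on {a..b} (speed_on a b \<gamma>)"
  unfolding continuous_on_eq_continuous_within
proof
  fix t assume t: "t \<in> {a..b}"
  define c where "c = chart_at (\<gamma> t)"
  have c: "c \<in> A" "\<gamma> t \<in> chart_dom c" by (simp_all add: c_def chart_at)
  define T where "T = {t\<in>{a..b}. \<gamma> t \<in> chart_dom c}"
  have "openin (top_of_set {a..b}) ({a..b} \<inter> \<gamma> -` chart_dom c)"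
    using curve_continuous open_dom[OF c(1)] by (rule continuous_openin_preimage_gen)
  moreover have "T = {a..b} \<inter> \<gamma> -` chart_dom c" by (auto simp: T_def)
  ultimately obtain U where U: "open U" "T = {a..b} \<inter> U" by (auto simp: openin_open)
  have "continuous_on T (\<lambda>t. gnorm c ((coord c \<circ> \<gamma>) t) (vel c t))"
  proof (rule continuous_on_gnorm[OF c(1)])
    show "continuous_on T (coord c \<circ> \<gamma>)"
      using curve_continuous cont_coord[OF c(1)]
      by (intro continuous_on_compose) (auto simp: T_def intro: continuous_on_subset)
    show "(coord c \<circ> \<gamma>) ` T \<subseteq> chart_cod c" by (auto simp: T_def coord_in[OF c(1)])
    show "continuous_on T (vel c)" unfolding T_def by (rule vel_continuous[OF c(1)])
  qed
  then have "continuous_on T (speed_on a b \<gamma>)"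
    by (rule continuous_on_eq) (auto simp: T_def speed_on_eq[OF c(1)])
  then have "continuous (at t within T) (speed_on a b \<gamma>)"
    using t c by (auto simp: continuous_on_eq_continuous_within T_def)
  moreover have "at t within T = at t within {a..b}"
    by (rule at_within_nhd[of _ U]) (use t c U in \<open>auto simp: T_def\<close>)
  ultimately show "continuous (at t within {a..b}) (speed_on a b \<gamma>)" by simp
qed

lemma speed_interior:
  assumes "t \<in> {a<..<b}" shows "speed A g \<gamma> t = speed_on a b \<gamma> t"
  using assms by (simp add: speed_eq speed_on_def at_within_Icc_at)

lemma coord_curve_differentiable:
  assumes "t \<in> {a<..<b}" "c \<in> A" "\<gamma> t \<in> chart_dom c"
  shows "(coord c \<circ> \<gamma>) differentiable (at t)"
  using vel_works[OF assms(2) _ assms(3)] assms(1)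
  by (auto simp: at_within_Icc_at has_vector_derivative_def differentiable_def)

lemma speed_has_integral: "(speed A g \<gamma> has_integral integral {a..b} (speed_on a b \<gamma>)) {a..b}"
proof (rule has_integral_spike_finite[of "{a, b}"])
  show "(speed_on a b \<gamma> has_integral integral {a..b} (speed_on a b \<gamma>)) {a..b}"
    by (intro integrable_integral integrable_continuous_interval speed_on_continuous)
qed (auto simp: speed_interior)

lemma speed_integral_eq: "integral {a..b} (speed A g \<gamma>) = integral {a..b} (speed_on a b \<gamma>)"
  using speed_has_integral by (rule integral_unique)

lemma speed_integrable: "speed A g \<gamma> integrable_on {a..b}"
  using speed_has_integral by blast

lemma speed_integral_nonneg: "0 \<le> integral {a..b} (speed A g \<gamma>)"
  unfolding speed_integral_eq
  by (intro integral_nonneg integrable_continuous_interval speed_on_continuous speed_on_nonneg)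

text \<open>The fundamental theorem of calculus along the curve, with the derivative estimated by
  Cauchy-Schwarz.\<close>

lemma C1_fun_curve_bound:
  assumes u: "C1_fun u" and C: "\<And>p. sqrt (gpair u u p) \<le> C"
  shows "\<bar>u (\<gamma> b) - u (\<gamma> a)\<bar> \<le> C * integral {a..b} (speed A g \<gamma>)"
proof -
  define u' where "u' t = gradv (chart_at (\<gamma> t)) u (\<gamma> t) \<bullet> vel (chart_at (\<gamma> t)) t" for t
  have "((\<lambda>s. u (\<gamma> s)) has_vector_derivative u' t) (at t within {a..b})" if t: "t \<in> {a..b}" for t
  proof -
    let ?c = "chart_at (\<gamma> t)"
    have "((\<lambda>x. u (chart_inv ?c x)) has_derivative (\<lambda>v. gradv ?c u (\<gamma> t) \<bullet> v)) (at (coord ?c (\<gamma> t)))"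
      using C1_on_has_derivative[OF C1_funD[OF u chart_at(1)] coord_in[OF chart_at]]
      by (simp add: gradv_def inner_vec_def mult.commute o_def)
    from compose_curve_derivative[OF chart_at(1) t chart_at(2) this] show ?thesis by (simp add: u'_def)
  qed
  then have ftc: "(u' has_integral u (\<gamma> b) - u (\<gamma> a)) {a..b}"
    using ab by (intro fundamental_theorem_of_calculus) auto
  have "norm (integral {a..b} u') \<le> integral {a..b} (\<lambda>t. C * speed_on a b \<gamma> t)"
  proof (rule integral_norm_bound_integral)
    show "u' integrable_on {a..b}" using ftc by blast
    show "(\<lambda>t. C * speed_on a b \<gamma> t) integrable_on {a..b}"
      by (intro integrable_continuous_interval continuous_intros speed_on_continuous)
    fix t
    have "\<bar>u' t\<bar> \<le> sqrt (gpair u u (\<gamma> t)) * speed_on a b \<gamma> t"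
      unfolding u'_def speed_on_def by (rule gradv_cauchy_schwarz[OF u chart_at])
    also have "\<dots> \<le> C * speed_on a b \<gamma> t" by (rule mult_right_mono[OF C speed_on_nonneg])
    finally show "norm (u' t) \<le> C * speed_on a b \<gamma> t" by simp
  qed
  then show ?thesis using ftc by (simp add: integral_unique speed_integral_eq)
qed

end

text \<open>Under an affine substitution the speed is multiplied by |\<beta>| and the length of the
  parameter interval is divided by it. At the finitely many points of \<open>S\<close> the curve may
  have a corner, which does not affect the integral.\<close>

lemma speed_affine_has_integral:
  fixes \<phi> :: "real \<Rightarrow> real"
  assumes \<phi>: "\<And>s. \<phi> s = \<alpha> + \<beta> * s" "\<beta> \<noteq> 0" "\<phi> ` {a'..b'} = {a..b}"
    and S: "finite S" "\<And>t. t \<in> {a..b} - S \<Longrightarrow> (coord (chart_at (\<gamma> t)) \<circ> \<gamma>) differentiable (at t)"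
    and i: "(speed A g \<gamma> has_integral i) {a..b}"
  shows "(speed A g (\<gamma> \<circ> \<phi>) has_integral i) {a'..b'}"
proof -
  have "((\<lambda>s. speed A g \<gamma> (\<beta> *\<^sub>R s + \<alpha>)) has_integral (1 / (\<bar>\<beta>\<bar> ^ DIM(real))) *\<^sub>R i)
      ((\<lambda>x. (1 / \<beta>) *\<^sub>R x + - ((1 / \<beta>) *\<^sub>R \<alpha>)) ` cbox a b)"
    using i \<phi>(2) by (intro has_integral_affinity) auto
  moreover have "(\<lambda>x. (1 / \<beta>) *\<^sub>R x + - ((1 / \<beta>) *\<^sub>R \<alpha>)) ` cbox a b = {a'..b'}"
  proof -
    have "(\<lambda>x. (1 / \<beta>) *\<^sub>R x + - ((1 / \<beta>) *\<^sub>R \<alpha>)) ` \<phi> ` {a'..b'} = {a'..b'}"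
      using \<phi>(1,2) by (simp add: image_image field_simps)
    then show ?thesis using \<phi>(3) by simp
  qed
  ultimately have "((\<lambda>s. \<bar>\<beta>\<bar> * speed A g \<gamma> (\<phi> s)) has_integral \<bar>\<beta>\<bar> * ((1 / \<bar>\<beta>\<bar>) * i)) {a'..b'}"
    using \<phi>(1) by (intro has_integral_mult_right) (simp add: add.commute)
  then have "((\<lambda>s. \<bar>\<beta>\<bar> * speed A g \<gamma> (\<phi> s)) has_integral i) {a'..b'}" using \<phi>(2) by simp
  moreover have "finite (\<phi> -` S)"
    using S(1) \<phi>(1,2) by (intro finite_vimageI) (auto simp: inj_on_def)
  moreover have "speed A g (\<gamma> \<circ> \<phi>) s = \<bar>\<beta>\<bar> * speed A g \<gamma> (\<phi> s)" if s: "s \<in> {a'..b'} - \<phi> -` S" for s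
  proof -
    let ?c = "chart_at (\<gamma> (\<phi> s))"
    have "\<phi> s \<in> {a..b} - S" using s \<phi>(3) by auto
    then have "(coord ?c \<circ> \<gamma>) differentiable (at (\<phi> s))" by (rule S(2))
    then have d: "((coord ?c \<circ> \<gamma>) has_vector_derivative vector_derivative (coord ?c \<circ> \<gamma>) (at (\<phi> s))) (at (\<phi> s))"
      by (simp add: vector_derivative_works)
    have "((\<lambda>s. \<alpha> + \<beta> * s) has_vector_derivative \<beta>) (at s)"
      by (auto intro!: derivative_eq_intros simp: has_vector_derivative_def)
    moreover have "\<phi> = (\<lambda>s. \<alpha> + \<beta> * s)" using \<phi>(1) by auto
    ultimately have "(\<phi> has_vector_derivative \<beta>) (at s)" by simp
    from vector_diff_chain_at[OF this d]
    have "vector_derivative (coord ?c \<circ> (\<gamma> \<circ> \<phi>)) (at s) = \<beta> *\<^sub>R vector_derivative (coord ?c \<circ> \<gamma>) (at (\<phi> s))"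
      by (intro vector_derivative_at) (simp add: o_def)
    then show ?thesis
      by (simp add: speed_eq gnorm_def matrix_vector_mult_scaleR real_sqrt_mult mult.assoc[symmetric])
  qed
  ultimately show ?thesis by (rule has_integral_spike_finite[rotated 2]) auto
qed


section \<open>Distance as an infimum over chains of curves\<close>

text \<open>\<open>reach p q L\<close>: a chain of \<open>C1\<close> curves of total length \<open>L\<close>, each on its own parameter interval,
  leads from \<open>p\<close> to \<open>q\<close>. This avoids reparametrising over \<open>[0, 1]\<close> when curves are cut or joined.\<close>

inductive reach :: "'a \<Rightarrow> 'a \<Rightarrow> real \<Rightarrow> bool" where
  stay: "reach p p 0"
| extend: "reach p (\<gamma> a) L \<Longrightarrow> a < b \<Longrightarrow> C1_curve_on A a b \<gamma> \<Longrightarrow>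
    reach p (\<gamma> b) (L + integral {a..b} (speed A g \<gamma>))"

lemma reach_nonneg: "reach p q L \<Longrightarrow> 0 \<le> L"
  by (induction rule: reach.induct) (auto intro: add_nonneg_nonneg speed_integral_nonneg)

lemma reach_piece: "a < b \<Longrightarrow> C1_curve_on A a b \<gamma> \<Longrightarrow> reach (\<gamma> a) (\<gamma> b) (integral {a..b} (speed A g \<gamma>))"
  using reach.extend[OF reach.stay] by fastforce

lemma reach_trans:
  assumes "reach z q L2" "reach p z L1" shows "reach p q (L1 + L2)"
  using assms
proof (induction rule: reach.induct)
  case (extend p' \<gamma> a L b)
  from reach.extend[OF extend.IH[OF extend.prems] extend.hyps(2,3)] show ?case by (simp add: add.assoc)
qed simp

text \<open>Every piece is run backwards by s -> a + b - s, and the reversed pieces are joined in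
  the opposite order.\<close>

lemma reach_sym: "reach p q L \<Longrightarrow> reach q p L"
proof (induction rule: reach.induct)
  case (extend p \<gamma> a L b)
  define \<phi> where "\<phi> s = (a + b) + - 1 * s" for s :: real
  have im: "\<phi> ` {a..b} = {a..b}" by (force simp: \<phi>_def image_iff)
  have C1: "C1_curve_on A a b (\<gamma> \<circ> \<phi>)"
    by (rule C1_curve_on_affine[OF extend.hyps(3) \<phi>_def]) (simp add: im)
  have "(speed A g (\<gamma> \<circ> \<phi>) has_integral integral {a..b} (speed A g \<gamma>)) {a..b}"
  proof (rule speed_affine_has_integral[OF \<phi>_def _ im, of "{a, b}"])
    show "(coord (chart_at (\<gamma> t)) \<circ> \<gamma>) differentiable (at t)" if "t \<in> {a..b} - {a, b}" for t
      using that by (intro coord_curve_differentiable[OF extend.hyps(2,3)] chart_at) auto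
    show "(speed A g \<gamma> has_integral integral {a..b} (speed A g \<gamma>)) {a..b}"
      using speed_integrable[OF extend.hyps(2,3)] by (rule integrable_integral)
  qed auto
  then have "reach (\<gamma> b) (\<gamma> a) (integral {a..b} (speed A g \<gamma>))"
    using reach_piece[OF extend.hyps(2) C1] by (simp add: \<phi>_def integral_unique)
  from reach_trans[OF extend.IH this] show ?case by (simp add: add.commute)
qed (rule reach.stay)

text \<open>The length along a piece is continuous in its endpoint, so the intermediate value
  theorem yields a point dividing the chain at any prescribed length. In the compactness proof this
  takes the place of minimal geodesics.\<close>

lemma reach_split:
  assumes "reach p q L" "0 \<le> l" "l \<le> L"
  shows "\<exists>z. reach p z l \<and> reach z q (L - l)"
  using assms
proof (induction arbitrary: l rule: reach.induct)
  case (stay p)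
  then show ?case by (metis diff_zero order_antisym reach.stay)
next
  case (extend p \<gamma> a L b)
  note C = extend.hyps(2,3)
  show ?case
  proof (cases "l \<le> L")
    case True
    with extend.IH[of l] extend.prems obtain z where z: "reach p z l" "reach z (\<gamma> a) (L - l)" by auto
    from reach.extend[OF z(2) C] z(1) show ?thesis by (auto simp: algebra_simps)
  next
    case False
    let ?F = "\<lambda>t. integral {a..t} (speed A g \<gamma>)"
    have cont: "continuous_on {a..b} ?F"
      by (rule indefinite_integral_continuous_1[OF speed_integrable[OF C]])
    have "?F a \<le> l - L" "l - L \<le> ?F b" using False extend.prems by auto
    then obtain t where t: "a \<le> t" "t \<le> b" "?F t = l - L"
      using IVT'[of ?F a "l - L" b] cont C(1) by auto
    \<comment> \<open>A piece needs an interval of positive length. A cut at \<open>a\<close> would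
      give l = L, contrary to the case at hand; a cut at \<open>b\<close> is settled by
      \<open>stay\<close> below.\<close>
    have "a \<noteq> t" using t(3) False by auto
    then have at: "a < t" using t by simp
    have 1: "reach p (\<gamma> t) l"
      using reach.extend[OF extend.hyps(1) at C1_curve_on_subinterval[OF C(2)]] t by simp
    have comb: "?F t + integral {t..b} (speed A g \<gamma>) = ?F b"
      using t speed_integrable[OF C] by (intro Henstock_Kurzweil_Integration.integral_combine) auto
    have 2: "reach (\<gamma> t) (\<gamma> b) (L + ?F b - l)"
    proof (cases "t = b")
      case True
      then show ?thesis using t(3) by (simp add: reach.stay)
    next
      case False
      then have tb: "t < b" using t by simp
      have "reach (\<gamma> t) (\<gamma> b) (integral {t..b} (speed A g \<gamma>))"
        using t by (intro reach_piece tb C1_curve_on_subinterval[OF C(2)]) auto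
      moreover have "integral {t..b} (speed A g \<gamma>) = L + ?F b - l" using comb t(3) by simp
      ultimately show ?thesis by simp
    qed
    from 1 2 show ?thesis by blast
  qed
qed

lemma reach_C1_fun_bound:
  assumes u: "C1_fun u" and C: "\<And>p. sqrt (gpair u u p) \<le> C" and r: "reach p q L"
  shows "\<bar>u q - u p\<bar> \<le> C * L"
  using r
proof (induction rule: reach.induct)
  case (extend p \<gamma> a L b)
  from extend.IH C1_fun_curve_bound[OF extend.hyps(2,3) u C] show ?case by (simp add: distrib_left)
qed simp

section \<open>From piecewise C1 curves to chains, and back\<close>

lemma partition_piece:
  assumes S: "finite S" "{0, 1} \<subseteq> S" "S \<subseteq> {0..1 :: real}" and t: "t \<in> {0..1} - S"
  obtains a b where "a \<in> S" "b \<in> S" "a < t" "t < b" "{a<..<b} \<inter> S = {}"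
proof -
  define a where "a = Max {s \<in> S. s < t}"
  define b where "b = Min {s \<in> S. t < s}"
  have "0 < t" "t < 1" using S(2) t by (auto simp: less_le)
  then have ne: "{s \<in> S. s < t} \<noteq> {}" "{s \<in> S. t < s} \<noteq> {}" using S(2) by auto
  have a: "a \<in> {s \<in> S. s < t}" and b: "b \<in> {s \<in> S. t < s}"
    unfolding a_def b_def using S(1) ne by (intro Max_in Min_in; simp)+
  have "s \<le> a" if "s \<in> S" "s < t" for s using S(1) that by (auto simp: a_def intro!: Max_ge)
  moreover have "b \<le> s" if "s \<in> S" "t < s" for s using S(1) that by (auto simp: b_def intro!: Min_le)
  ultimately have "{a<..<b} \<inter> S = {}" using t by fastforce
  then show thesis using a b by (intro that[of a b]) auto
qed

lemma piecewise_curve_differentiable: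
  assumes S: "finite S" "{0, 1} \<subseteq> S" "S \<subseteq> {0..1}"
    and C1: "\<And>a b. a \<in> S \<Longrightarrow> b \<in> S \<Longrightarrow> a < b \<Longrightarrow> {a<..<b} \<inter> S = {} \<Longrightarrow> C1_curve_on A a b \<gamma>"
    and t: "t \<in> {0..1} - S"
  shows "(coord (chart_at (\<gamma> t)) \<circ> \<gamma>) differentiable (at t)"
proof -
  obtain a b where ab: "a \<in> S" "b \<in> S" "a < t" "t < b" "{a<..<b} \<inter> S = {}"
    using partition_piece[OF S t] .
  show ?thesis
    by (rule coord_curve_differentiable[OF _ C1[OF ab(1,2) _ ab(5)] _ chart_at]) (use ab in auto)
qed

text \<open>Induction on the number of division points to the left of \<open>s\<close>, peeling off
  the last piece.\<close>

lemma piecewise_curve_reach: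
  assumes S: "finite S" "{0, 1} \<subseteq> S" "S \<subseteq> {0..1}"
    and C1: "\<And>a b. a \<in> S \<Longrightarrow> b \<in> S \<Longrightarrow> a < b \<Longrightarrow> {a<..<b} \<inter> S = {} \<Longrightarrow> C1_curve_on A a b \<gamma>"
    and s: "s \<in> S"
  shows "reach (\<gamma> 0) (\<gamma> s) (integral {0..s} (speed A g \<gamma>)) \<and> speed A g \<gamma> integrable_on {0..s}"
  using s
proof (induction "card (S \<inter> {..<s})" arbitrary: s rule: less_induct)
  case less
  show ?case
  proof (cases "s = 0")
    case False
    define a where "a = Max (S \<inter> {..<s})"
    have fin: "finite (S \<inter> {..<s})" using S(1) by simp
    have "0 < s" using False less.prems S(3) by force
    then have "0 \<in> S \<inter> {..<s}" using S(2) by auto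
    then have a: "a \<in> S \<inter> {..<s}" unfolding a_def using fin by (intro Max_in) auto
    have "y \<le> a" if "y \<in> S" "y < s" for y unfolding a_def using fin that by (intro Max_ge) auto
    then have gap: "{a<..<s} \<inter> S = {}" by fastforce
    have a0: "0 \<le> a" using a S(3) by auto
    have "S \<inter> {..<a} \<subset> S \<inter> {..<s}" using a by auto
    then have IH: "reach (\<gamma> 0) (\<gamma> a) (integral {0..a} (speed A g \<gamma>))" "speed A g \<gamma> integrable_on {0..a}"
      using less.hyps[of a] a psubset_card_mono[OF fin] by auto
    have as: "a < s" "C1_curve_on A a s \<gamma>" using a C1[OF _ less.prems _ gap] by auto
    have int: "speed A g \<gamma> integrable_on {0..s}"
      using a0 as(1) IH(2) speed_integrable[OF as]
      by (intro Henstock_Kurzweil_Integration.integrable_combine[of 0 a s]) auto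
    have "integral {0..a} (speed A g \<gamma>) + integral {a..s} (speed A g \<gamma>) = integral {0..s} (speed A g \<gamma>)"
      using a0 as(1) int by (intro Henstock_Kurzweil_Integration.integral_combine) auto
    with reach.extend[OF IH(1) as] int show ?thesis by simp
  qed (use integrable_on_refl[of "speed A g \<gamma>" 0] in \<open>auto simp: reach.stay\<close>)
qed

end

context riemannian_manifold
begin

text \<open>At each extension the curve built so far is compressed into [0, 1/2] and the new piece
  is placed on [1/2, 1]; the lengths are unchanged by
  \<open>speed_affine_has_integral\<close>.\<close>

lemma reach_imp_curve:
  assumes "reach p q L"
  shows "\<exists>\<gamma>. piecewise_C1_curve A \<gamma> \<and> \<gamma> 0 = p \<and> \<gamma> 1 = q \<and> (speed A g \<gamma> has_integral L) {0..1}"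
  using assms
proof (induction rule: reach.induct)
  case (stay p)
  have "C1_curve_on A a b (\<lambda>_. p)" for a b
    unfolding C1_curve_on_def by (auto simp: o_def intro!: exI[of _ "\<lambda>_. 0"])
  then have "piecewise_C1_curve A (\<lambda>_. p)"
    unfolding piecewise_C1_curve_def by (intro exI[of _ "{0, 1}"]) auto
  moreover have "speed A g (\<lambda>_. p) = (\<lambda>_. 0)"
    by (simp add: fun_eq_iff speed_eq gnorm_def o_def)
  ultimately show ?case by (intro exI[of _ "\<lambda>_. p"]) simp
next
  case (extend p \<delta> a L b)
  from extend.IH obtain \<gamma>1 where \<gamma>1: "piecewise_C1_curve A \<gamma>1" "\<gamma>1 0 = p" "\<gamma>1 1 = \<delta> a"
    "(speed A g \<gamma>1 has_integral L) {0..1}" by blast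
  obtain S where S: "finite S" "{0, 1} \<subseteq> S" "S \<subseteq> {0..1}"
    and C1: "\<And>a b. a \<in> S \<Longrightarrow> b \<in> S \<Longrightarrow> a < b \<Longrightarrow> {a<..<b} \<inter> S = {} \<Longrightarrow> C1_curve_on A a b \<gamma>1"
    using piecewise_C1_curveE[OF \<gamma>1(1)] by blast
  \<comment> \<open>Both substitutions are written in the pattern \<alpha> + \<beta> s of the lemmas
    on affine changes of parameter; \<psi> sends 1/2 to \<open>a\<close> and 1 to
    \<open>b\<close>.\<close>
  define \<phi> where "\<phi> s = 0 + 2 * s" for s :: real
  define \<psi> where "\<psi> s = (2 * a - b) + (2 * (b - a)) * s" for s
  define \<gamma> where "\<gamma> s = (if s \<le> 1/2 then (\<gamma>1 \<circ> \<phi>) s else (\<delta> \<circ> \<psi>) s)" for s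
  have \<psi>_ends: "\<psi> (1/2) = a" "\<psi> 1 = b" by (auto simp: \<psi>_def field_simps)
  have \<gamma>_right: "\<gamma> s = (\<delta> \<circ> \<psi>) s" if "s \<in> {1/2..1}" for s
  proof (cases "s = 1/2")
    case True
    show ?thesis unfolding True using \<psi>_ends(1) \<gamma>1(3) by (simp add: \<gamma>_def \<phi>_def)
  next
    case False
    then show ?thesis using that by (simp add: \<gamma>_def)
  qed
  have ab: "a < b" by fact
  have im\<phi>: "\<phi> ` {0..1/2} = {0..1}"
  proof
    show "{0..1} \<subseteq> \<phi> ` {0..1/2}" by (rule subsetI, rule_tac x = "x / 2" in image_eqI) (auto simp: \<phi>_def)
  qed (auto simp: \<phi>_def)
  have \<psi>_mono: "\<psi> x \<le> \<psi> y \<longleftrightarrow> x \<le> y" for x y using ab by (simp add: \<psi>_def)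
  have im\<psi>: "\<psi> ` {1/2..1} = {a..b}"
  proof
    show "\<psi> ` {1/2..1} \<subseteq> {a..b}" using \<psi>_mono[of "1/2"] \<psi>_mono[of _ 1] by (auto simp: \<psi>_ends)
    show "{a..b} \<subseteq> \<psi> ` {1/2..1}"
    proof
      fix y assume y: "y \<in> {a..b}"
      define x where "x = (y - (2 * a - b)) / (2 * (b - a))"
      have "\<psi> x = y" using ab by (simp add: x_def \<psi>_def)
      then show "y \<in> \<psi> ` {1/2..1}" using y \<psi>_mono[of "1/2" x] \<psi>_mono[of x 1] by (auto simp: \<psi>_ends)
    qed
  qed
  have "piecewise_C1_curve A \<gamma>"
    unfolding piecewise_C1_curve_def
  \<comment> \<open>The old division points are halved along with the curve; 1/2 is among them as
    the image of 1, and the endpoint 1 is added anew.\<close>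
  proof (intro exI[of _ "insert 1 ((\<lambda>s. s / 2) ` S)"] conjI ballI impI)
    show "finite (insert 1 ((\<lambda>s. s / 2) ` S))" using S by simp
    show "{0, 1} \<subseteq> insert 1 ((\<lambda>s. s / 2) ` S)" using S(2) by force
    show "insert 1 ((\<lambda>s. s / 2) ` S) \<subseteq> {0..1}" using S(3) by force
    fix x y assume x: "x \<in> insert 1 ((\<lambda>s. s / 2) ` S)" and y: "y \<in> insert 1 ((\<lambda>s. s / 2) ` S)"
      and gap: "x < y \<and> {x<..<y} \<inter> insert 1 ((\<lambda>s. s / 2) ` S) = {}"
    have half: "1/2 \<in> (\<lambda>s. s / 2) ` S" using S(2) by auto
    show "C1_curve_on A x y \<gamma>"
    proof (cases "y = 1")
      case False
      then obtain y' where y': "y' \<in> S" "y = y' / 2" using y by auto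
      then have "x \<noteq> 1" using S(3) gap by force
      then obtain x' where x': "x' \<in> S" "x = x' / 2" using x by auto
      have "{x'<..<y'} \<inter> S = {}"
      proof (rule ccontr)
        assume "{x'<..<y'} \<inter> S \<noteq> {}"
        then obtain s where "s \<in> S" "x' < s" "s < y'" by auto
        then have "s / 2 \<in> {x<..<y} \<inter> insert 1 ((\<lambda>s. s / 2) ` S)" using x' y' by auto
        then show False using gap by blast
      qed
      then have "C1_curve_on A x' y' \<gamma>1" using x' y' gap by (intro C1) auto
      then have "C1_curve_on A x y (\<gamma>1 \<circ> \<phi>)"
        by (rule C1_curve_on_affine[OF _ \<phi>_def]) (auto simp: \<phi>_def x' y')
      moreover have "y \<le> 1/2" using y' S(3) by auto
      ultimately show ?thesis by (auto simp: \<gamma>_def intro: C1_curve_on_cong)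
    next
      case True
      have "1/2 \<le> x"
      proof (rule ccontr)
        assume "\<not> 1/2 \<le> x"
        then have "1/2 \<in> {x<..<y} \<inter> insert 1 ((\<lambda>s. s / 2) ` S)" using half True by auto
        then show False using gap by blast
      qed
      then have sub: "{x..y} \<subseteq> {1/2..1}" using True by auto
      have "C1_curve_on A x y (\<delta> \<circ> \<psi>)"
        by (rule C1_curve_on_affine[OF extend.hyps(3) \<psi>_def]) (use sub im\<psi> in blast)
      then show ?thesis
        by (rule C1_curve_on_cong) (use sub \<gamma>_right in blast)
    qed
  qed
  moreover have "(speed A g \<gamma> has_integral L + integral {a..b} (speed A g \<delta>)) {0..1}"
  proof (rule has_integral_combine[of 0 "1/2" 1])
    have "(speed A g (\<gamma>1 \<circ> \<phi>) has_integral L) {0..1/2}"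
      by (rule speed_affine_has_integral[OF \<phi>_def _ im\<phi> S(1) piecewise_curve_differentiable[OF S C1] \<gamma>1(4)]) auto
    then show "(speed A g \<gamma> has_integral L) {0..1/2}"
    proof (rule has_integral_spike_finite[of "{1/2}", rotated 2])
      show "speed A g \<gamma> t = speed A g (\<gamma>1 \<circ> \<phi>) t" if "t \<in> {0..1/2} - {1/2}" for t
        by (rule speed_cong[of "{..<1/2}"]) (use that in \<open>auto simp: \<gamma>_def\<close>)
    qed simp
    have "(speed A g (\<delta> \<circ> \<psi>) has_integral integral {a..b} (speed A g \<delta>)) {1/2..1}"
    proof (rule speed_affine_has_integral[OF \<psi>_def _ im\<psi>, of "{a, b}"])
      show "(coord (chart_at (\<delta> t)) \<circ> \<delta>) differentiable (at t)" if "t \<in> {a..b} - {a, b}" for t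
        using that by (intro coord_curve_differentiable[OF extend.hyps(2,3)] chart_at) auto
      show "(speed A g \<delta> has_integral integral {a..b} (speed A g \<delta>)) {a..b}"
        using speed_integrable[OF extend.hyps(2,3)] by (rule integrable_integral)
    qed (use ab in auto)
    then show "(speed A g \<gamma> has_integral integral {a..b} (speed A g \<delta>)) {1/2..1}"
    proof (rule has_integral_spike_finite[of "{1/2}", rotated 2])
      show "speed A g \<gamma> t = speed A g (\<delta> \<circ> \<psi>) t" if "t \<in> {1/2..1} - {1/2}" for t
        by (rule speed_cong[of "{1/2<..}"]) (use that in \<open>auto simp: \<gamma>_def\<close>)
    qed simp
  qed auto
  moreover have "\<gamma> 0 = p" "\<gamma> 1 = \<delta> b"
    using \<gamma>1(2) by (auto simp: \<gamma>_def \<phi>_def \<psi>_ends)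
  ultimately show ?case by blast
qed

lemma rdist_eq: "rdist A g p q = Inf {L. reach p q L}"
proof -
  have "{curve_length A g \<gamma> | \<gamma>. piecewise_C1_curve A \<gamma> \<and> \<gamma> 0 = p \<and> \<gamma> 1 = q} = {L. reach p q L}"
  proof (intro equalityI subsetI)
    fix L assume "L \<in> {curve_length A g \<gamma> | \<gamma>. piecewise_C1_curve A \<gamma> \<and> \<gamma> 0 = p \<and> \<gamma> 1 = q}"
    then obtain \<gamma> where \<gamma>: "L = integral {0..1} (speed A g \<gamma>)" "piecewise_C1_curve A \<gamma>" "\<gamma> 0 = p" "\<gamma> 1 = q"
      by (auto simp: curve_length_def)
    obtain S where S: "finite S" "{0, 1} \<subseteq> S" "S \<subseteq> {0..1}"
      "\<And>a b. a \<in> S \<Longrightarrow> b \<in> S \<Longrightarrow> a < b \<Longrightarrow> {a<..<b} \<inter> S = {} \<Longrightarrow> C1_curve_on A a b \<gamma>"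
      using piecewise_C1_curveE[OF \<gamma>(2)] by blast
    have "1 \<in> S" using S(2) by simp
    then have "reach (\<gamma> 0) (\<gamma> 1) (integral {0..1} (speed A g \<gamma>))"
      using piecewise_curve_reach[OF S] by blast
    then show "L \<in> {L. reach p q L}" using \<gamma> by simp
  next
    fix L assume "L \<in> {L. reach p q L}"
    then obtain \<gamma> where "piecewise_C1_curve A \<gamma>" "\<gamma> 0 = p" "\<gamma> 1 = q" "(speed A g \<gamma> has_integral L) {0..1}"
      using reach_imp_curve by blast
    then show "L \<in> {curve_length A g \<gamma> | \<gamma>. piecewise_C1_curve A \<gamma> \<and> \<gamma> 0 = p \<and> \<gamma> 1 = q}"
      by (auto simp: curve_length_def integral_unique intro!: exI[of _ \<gamma>])
  qed
  then show ?thesis by (simp add: rdist_def)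
qed

lemma rdist_le: "reach p q L \<Longrightarrow> rdist A g p q \<le> L"
  unfolding rdist_eq by (rule cInf_lower) (auto intro!: bdd_belowI[of _ 0] reach_nonneg)

end

section \<open>The distance is a metric inducing the manifold topology\<close>

lemma sqrt_four_mult: "sqrt (4 * x) = 2 * sqrt x"
  by (simp add: real_sqrt_mult)

context riemannian_manifold
begin

lemma gnorm_scaleR: "gnorm c x (t *\<^sub>R v) = \<bar>t\<bar> * gnorm c x v"
  by (simp add: gnorm_def matrix_vector_mult_scaleR real_sqrt_mult mult.assoc[symmetric])

text \<open>If the entries of the two matrices differ by less than \<mu> / 2 in total, the quadratic
  forms differ by at most half the form at \<open>x0\<close>. The ratios of lengths are then at most
  sqrt (3/2) and sqrt 2, both rounded up to 2.\<close>

lemma gnorm_locally_comparable: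
  assumes c: "c \<in> A" and x0: "x0 \<in> chart_cod c" and X: "open X" "x0 \<in> X"
  obtains \<delta> where "\<delta> > 0" "cball x0 \<delta> \<subseteq> chart_cod c \<inter> X"
    "\<And>x v. x \<in> cball x0 \<delta> \<Longrightarrow> gnorm c x v \<le> 2 * gnorm c x0 v"
    "\<And>x v. x \<in> cball x0 \<delta> \<Longrightarrow> gnorm c x0 v \<le> 2 * gnorm c x v"
proof -
  interpret euclidean_metric "chart_cod c" "g c" by (rule euclidean_metric_chart[OF c])
  obtain \<mu> where \<mu>: "\<mu> > 0" "\<And>w. \<mu> * (norm w)\<^sup>2 \<le> w \<bullet> (g c x0 *v w)"
    using pos_def_bound[of "g c x0"] pos_def[OF x0] by blast
  define E where "E x = (\<Sum>a\<in>UNIV. \<Sum>b\<in>UNIV. \<bar>g c x $ a $ b - g c x0 $ a $ b\<bar>)" for x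
  have "continuous_on (chart_cod c) E"
    unfolding E_def[abs_def] using C1_on_continuous[OF G]
    by (intro continuous_on_sum continuous_on_rabs continuous_on_diff continuous_on_const)
  then have "open (chart_cod c \<inter> E -` {..<\<mu> / 2})"
    by (rule continuous_open_preimage[OF _ S]) simp
  then have "open (chart_cod c \<inter> E -` {..<\<mu> / 2} \<inter> X)" using X(1) by blast
  moreover have "x0 \<in> chart_cod c \<inter> E -` {..<\<mu> / 2} \<inter> X" using x0 X(2) \<mu>(1) by (simp add: E_def)
  ultimately obtain \<delta> where \<delta>: "\<delta> > 0" "cball x0 \<delta> \<subseteq> chart_cod c \<inter> E -` {..<\<mu> / 2} \<inter> X"
    by (meson open_contains_cball)
  have diff: "\<bar>v \<bullet> (g c x *v v) - v \<bullet> (g c x0 *v v)\<bar> \<le> 1/2 * (v \<bullet> (g c x0 *v v))" if x: "x \<in> cball x0 \<delta>" for x v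
  proof -
    have "v \<bullet> (g c x *v v) - v \<bullet> (g c x0 *v v) =
        (\<Sum>a\<in>UNIV. \<Sum>b\<in>UNIV. (g c x $ a $ b - g c x0 $ a $ b) * (v $ a * v $ b))"
      by (simp add: inner_vec_def matrix_vector_mult_def sum_subtractf[symmetric] sum_distrib_left algebra_simps)
    also have "\<bar>\<dots>\<bar> \<le> (\<Sum>a\<in>UNIV. \<Sum>b\<in>UNIV. \<bar>g c x $ a $ b - g c x0 $ a $ b\<bar> * (norm v)\<^sup>2)"
    proof (intro order_trans[OF sum_abs] sum_mono)
      fix a b
      have "\<bar>v $ a\<bar> * \<bar>v $ b\<bar> \<le> norm v * norm v" by (intro mult_mono component_le_norm_cart) auto
      then show "\<bar>(g c x $ a $ b - g c x0 $ a $ b) * (v $ a * v $ b)\<bar> \<le> \<bar>g c x $ a $ b - g c x0 $ a $ b\<bar> * (norm v)\<^sup>2"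
        unfolding abs_mult power2_eq_square by (intro mult_left_mono) auto
    qed
    also have "\<dots> = E x * (norm v)\<^sup>2" by (simp add: E_def sum_distrib_right)
    also have "\<dots> \<le> \<mu> / 2 * (norm v)\<^sup>2"
      using \<delta>(2) x by (intro mult_right_mono) auto
    also have "\<dots> \<le> 1/2 * (v \<bullet> (g c x0 *v v))" using \<mu>(2)[of v] by simp
    finally show ?thesis .
  qed
  have nonneg: "0 \<le> v \<bullet> (g c x0 *v v)" for v by (rule gnorm_nonneg(1)[OF c x0])
  show thesis
  proof (rule that[OF \<delta>(1)])
    show "cball x0 \<delta> \<subseteq> chart_cod c \<inter> X" using \<delta>(2) by auto
    show "gnorm c x v \<le> 2 * gnorm c x0 v" if "x \<in> cball x0 \<delta>" for x v
      unfolding gnorm_def sqrt_four_mult[symmetric]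
      using diff[OF that, of v] nonneg[of v] by (intro real_sqrt_le_mono) linarith
    show "gnorm c x0 v \<le> 2 * gnorm c x v" if "x \<in> cball x0 \<delta>" for x v
      unfolding gnorm_def sqrt_four_mult[symmetric]
      using diff[OF that, of v] nonneg[of v] by (intro real_sqrt_le_mono) linarith
  qed
qed

text \<open>A straight segment in a chart has constant coordinate velocity y - x, so
  \<open>B\<close> bounds the speed over a parameter interval of length 1. That the curve is C1 in
  all other charts comes from the transition maps.\<close>

lemma reach_segment:
  assumes c: "c \<in> A" and seg: "closed_segment x y \<subseteq> chart_cod c"
    and B: "\<And>z. z \<in> closed_segment x y \<Longrightarrow> gnorm c z (y - x) \<le> B"
  shows "\<exists>L\<le>B. reach (chart_inv c x) (chart_inv c y) L"
proof -
  define \<gamma> where "\<gamma> = chart_inv c \<circ> linepath x y"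
  have lp: "linepath x y t \<in> chart_cod c" "linepath x y t \<in> closed_segment x y" if "t \<in> {0..1}" for t
    using that seg linepath_in_path[of t x y] by auto
  have \<gamma>_dom: "\<gamma> t \<in> chart_dom c" if "t \<in> {0..1}" for t
    using lp(1)[OF that] by (simp add: \<gamma>_def inv_in[OF c])
  have c\<gamma>: "(coord c \<circ> \<gamma>) t = linepath x y t" if "t \<in> {0..1}" for t
    using lp(1)[OF that] by (simp add: \<gamma>_def coord_inv[OF c])
  have dlp: "(linepath x y has_vector_derivative (y - x)) (at t within X)" for t X
    unfolding linepath_def has_vector_derivative_def
    by (auto intro!: derivative_eq_intros simp: algebra_simps)
  have C1: "C1_curve_on A 0 1 \<gamma>"
    unfolding C1_curve_on_def
  proof (intro conjI ballI)
    show "continuous_on {0..1} \<gamma>"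
      unfolding \<gamma>_def using lp by (intro continuous_on_compose continuous_on_linepath continuous_on_subset[OF cont_inv[OF c]]) auto
    fix c' assume c': "c' \<in> A"
    let ?T = "{t \<in> {0..1}. \<gamma> t \<in> chart_dom c'}"
    define D where "D t = transition_jacobian c c' (linepath x y t) *v (y - x)" for t
    have im: "linepath x y t \<in> coord c ` (chart_dom c \<inter> chart_dom c')" if "t \<in> ?T" for t
      using that c\<gamma>[of t] \<gamma>_dom[of t] by (auto simp: image_iff intro!: bexI[of _ "\<gamma> t"])
    have "continuous_on ?T D"
    proof -
      have "continuous_on ?T (\<lambda>t. transition_jacobian c c' (linepath x y t) $ k $ i)" for k i
      proof -
        have "continuous_on ?T (\<lambda>t. pd i (\<lambda>x. coord c' (chart_inv c x) $ k) (linepath x y t))"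
          by (rule continuous_on_compose2[OF C1_onD(2)[OF transition_C1[OF c c']]])
             (auto intro: continuous_on_linepath im)
        then show ?thesis
          by (rule continuous_on_eq) (simp add: transition_jacobian_entry[OF c c' im])
      qed
      then show ?thesis
        unfolding D_def matrix_vector_mult_def
        by (intro continuous_on_vec_lambda continuous_on_sum continuous_on_mult continuous_on_const)
    qed
    moreover have "((coord c' \<circ> \<gamma>) has_vector_derivative D t) (at t within {0..1})" if "t \<in> {0..1}" "\<gamma> t \<in> chart_dom c'" for t
    proof -
      have t: "t \<in> ?T" using that by simp
      have "((coord c' \<circ> chart_inv c) has_derivative (*v) (transition_jacobian c c' (linepath x y t))) (at (linepath x y t))"
        using transition_jacobian_works[OF c c' im[OF t]] by simp
      from vector_derivative_diff_chain_within[OF dlp has_derivative_at_withinI[OF this]]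
      show ?thesis by (simp add: \<gamma>_def D_def o_def)
    qed
    ultimately show "\<exists>D. continuous_on ?T D \<and> (\<forall>t\<in>{0..1}. \<gamma> t \<in> chart_dom c' \<longrightarrow>
        ((coord c' \<circ> \<gamma>) has_vector_derivative D t) (at t within {0..1}))" by blast
  qed
  have "integral {0..1} (speed A g \<gamma>) = integral {0..1} (speed_on 0 1 \<gamma>)"
    by (rule speed_integral_eq[OF _ C1]) simp
  also have "\<dots> \<le> integral {0..1::real} (\<lambda>_. B)"
  proof (rule integral_le)
    show "speed_on 0 1 \<gamma> integrable_on {0..1}"
      by (intro integrable_continuous_interval speed_on_continuous C1) simp
    fix t :: real assume t: "t \<in> {0..1}"
    have "vector_derivative (coord c \<circ> \<gamma>) (at t within {0..1}) = y - x"
    proof (rule vector_derivative_within_closed_interval)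
      show "((coord c \<circ> \<gamma>) has_vector_derivative (y - x)) (at t within {0..1})"
        using dlp by (rule has_vector_derivative_transform[OF t, rotated]) (simp only: c\<gamma>)
    qed (use t in auto)
    then show "speed_on 0 1 \<gamma> t \<le> B"
      using B[OF lp(2)[OF t]] c\<gamma>[OF t] speed_on_eq[OF _ C1 c t \<gamma>_dom[OF t]] by simp
  qed auto
  finally have "integral {0..1} (speed A g \<gamma>) \<le> B" by simp
  moreover have "reach (chart_inv c x) (chart_inv c y) (integral {0..1} (speed A g \<gamma>))"
    using reach_piece[OF _ C1] by (simp add: \<gamma>_def linepath_0' linepath_1')
  ultimately show ?thesis by blast
qed

lemma reach_nearby:
  assumes \<epsilon>: "\<epsilon> > 0"
  obtains W where "open W" "p \<in> W" "\<And>q. q \<in> W \<Longrightarrow> \<exists>L<\<epsilon>. reach p q L"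
proof -
  let ?c = "chart_at p" and ?x = "coord (chart_at p) p"
  note c = chart_at[of p]
  obtain \<delta> where \<delta>: "\<delta> > 0" "cball ?x \<delta> \<subseteq> chart_cod ?c \<inter> UNIV"
    "\<And>x v. x \<in> cball ?x \<delta> \<Longrightarrow> gnorm ?c x v \<le> 2 * gnorm ?c ?x v"
    "\<And>x v. x \<in> cball ?x \<delta> \<Longrightarrow> gnorm ?c ?x v \<le> 2 * gnorm ?c x v"
    by (rule gnorm_locally_comparable[OF c(1) coord_in[OF c] open_UNIV UNIV_I]) (rule that)
  define Y where "Y = ball ?x \<delta> \<inter> {y. 2 * gnorm ?c ?x (y - ?x) < \<epsilon>}"
  have "open Y"
    unfolding Y_def gnorm_def
    by (intro open_Int open_ball open_Collect_less continuous_intros linear_continuous_on_compose[OF _ matrix_vector_mul_linear])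
  moreover have "Y \<subseteq> chart_cod ?c" using \<delta>(2) by (auto simp: Y_def)
  ultimately have "open (chart_inv ?c ` Y)" by (intro open_chart_inv_image c)
  moreover have "?x \<in> Y" using \<delta>(1) \<epsilon> by (simp add: Y_def gnorm_def)
  then have "p \<in> chart_inv ?c ` Y" using inv_coord[OF c] by (force simp: image_iff)
  moreover have "\<exists>L<\<epsilon>. reach p q L" if q: "q \<in> chart_inv ?c ` Y" for q
  proof -
    from q obtain y where y: "y \<in> Y" "q = chart_inv ?c y" by blast
    have seg: "closed_segment ?x y \<subseteq> cball ?x \<delta>"
      using y(1) \<delta>(1) by (intro closed_segment_subset) (auto simp: Y_def)
    have "\<exists>L\<le>2 * gnorm ?c ?x (y - ?x). reach (chart_inv ?c ?x) (chart_inv ?c y) L"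
      by (rule reach_segment[OF c(1)]) (use seg \<delta> in auto)
    then show ?thesis using y by (auto simp: Y_def inv_coord[OF c] intro: order.strict_trans1)
  qed
  ultimately show thesis using that by blast
qed

end

locale connected_riemannian_manifold = riemannian_manifold A g
  for A :: "('a::{t2_space, second_countable_topology}, 'n::finite) chart set" and g +
  assumes connected: "connected (UNIV :: 'a set)"
begin

abbreviation dst :: "'a \<Rightarrow> 'a \<Rightarrow> real" where "dst \<equiv> rdist A g"

text \<open>The set reachable from \<open>p\<close> is open and closed. In particular
  \<open>rdist\<close> is never an infimum over the empty set.\<close>

lemma reach_total: "\<exists>L. reach p q L"
proof -
  define T where "T = {q. \<exists>L. reach p q L}"
  have "open T"
  proof (subst open_subopen, intro ballI)
    fix q assume "q \<in> T"
    then obtain L where L: "reach p q L" by (auto simp: T_def)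
    obtain W where W: "open W" "q \<in> W" "\<And>z. z \<in> W \<Longrightarrow> \<exists>L<1. reach q z L"
      by (rule reach_nearby[of 1 q]) (simp, rule that)
    note W(1,2)
    moreover have "z \<in> T" if "z \<in> W" for z
    proof -
      obtain L' where "reach q z L'" using W(3)[OF \<open>z \<in> W\<close>] by blast
      from reach_trans[OF this L] show ?thesis by (auto simp: T_def)
    qed
    ultimately show "\<exists>W. open W \<and> q \<in> W \<and> W \<subseteq> T" by blast
  qed
  moreover have "open (- T)"
  proof (subst open_subopen, intro ballI)
    fix q assume q: "q \<in> - T"
    obtain W where W: "open W" "q \<in> W" "\<And>z. z \<in> W \<Longrightarrow> \<exists>L<1. reach q z L"
      by (rule reach_nearby[of 1 q]) (simp, rule that)
    have "z \<notin> T" if "z \<in> W" for z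
    proof
      assume "z \<in> T"
      then obtain L1 where L1: "reach p z L1" by (auto simp: T_def)
      obtain L2 where "reach q z L2" using W(3)[OF \<open>z \<in> W\<close>] by blast
      from reach_trans[OF reach_sym[OF this] L1] show False using q by (auto simp: T_def)
    qed
    then show "\<exists>W. open W \<and> q \<in> W \<and> W \<subseteq> - T" using W by blast
  qed
  moreover have "p \<in> T" using reach.stay by (auto simp: T_def)
  ultimately have "- T = {}" using connectedD[OF connected, of T "- T"] by auto
  then show ?thesis by (auto simp: T_def)
qed

lemma dst_lessD: "dst p q < L \<Longrightarrow> \<exists>L'<L. reach p q L'"
  unfolding rdist_eq using cInf_lessD[of "{L. reach p q L}" L] reach_total by auto

lemma dst_greatest: "(\<And>L. reach p q L \<Longrightarrow> B \<le> L) \<Longrightarrow> B \<le> dst p q"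
  unfolding rdist_eq using reach_total by (intro cInf_greatest) auto

lemma dst_nonneg: "0 \<le> dst p q"
  by (rule dst_greatest) (rule reach_nonneg)

lemma dst_commute: "dst p q = dst q p"
proof -
  have "{L. reach p q L} = {L. reach q p L}" using reach_sym by blast
  then show ?thesis by (simp add: rdist_eq)
qed

lemma dst_triangle: "dst p r \<le> dst p q + dst q r"
proof -
  have "dst p r - dst q r \<le> dst p q"
  proof (rule dst_greatest)
    fix L1 assume 1: "reach p q L1"
    have "dst p r - L1 \<le> dst q r"
    proof (rule dst_greatest)
      fix L2 assume "reach q r L2"
      from rdist_le[OF reach_trans[OF this 1]] show "dst p r - L1 \<le> L2" by simp
    qed
    then show "dst p r - dst q r \<le> L1" by simp
  qed
  then show ?thesis by simp
qed

lemma C1_fun_lipschitz: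
  assumes u: "C1_fun u" and C: "\<And>p. sqrt (gpair u u p) \<le> C"
  shows "\<bar>u q - u p\<bar> \<le> C * dst p q"
proof -
  have bound: "\<bar>u q - u p\<bar> \<le> C * L" if "reach p q L" for L
    by (rule reach_C1_fun_bound[OF u C that])
  have "0 \<le> C" using C[of p] gpair_nonneg[OF u] by (meson order_trans real_sqrt_ge_zero)
  show ?thesis
  proof (cases "C = 0")
    case True
    then show ?thesis using reach_total bound by auto
  next
    case False
    with \<open>0 \<le> C\<close> have "C > 0" by simp
    then have "\<bar>u q - u p\<bar> / C \<le> dst p q"
      using bound by (intro dst_greatest) (simp add: divide_le_eq mult.commute)
    then show ?thesis using \<open>C > 0\<close> by (simp add: divide_le_eq mult.commute)
  qed
qed

text \<open>A bump function supported in \<open>U\<close> drops from 1 at \<open>p\<close> to 0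
  outside \<open>U\<close> and is Lipschitz with constant \<open>C\<close>, so leaving
  \<open>U\<close> costs a definite distance. The 1 added to \<open>C\<close> avoids a division by
  0.\<close>

lemma dst_ball_subset:
  assumes "open U" "p \<in> U"
  obtains \<epsilon> where "\<epsilon> > 0" "\<And>q. dst p q < \<epsilon> \<Longrightarrow> q \<in> U"
proof -
  obtain H W K where HW: "C1_fun H" "\<And>q. 0 \<le> H q" "\<And>q. H q \<le> 1" "open W" "p \<in> W" "\<And>q. q \<in> W \<Longrightarrow> H q = 1"
    "compact K" "K \<subseteq> U \<inter> chart_dom (chart_at p)" "\<And>q. q \<notin> K \<Longrightarrow> H q = 0"
    by (rule bump_function[OF assms chart_at(2,1)]) (rule that)
  note H = HW(1,5,6,7,8,9)
  obtain C where C: "0 \<le> C" "\<And>p. sqrt (gpair H H p) \<le> C"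
    by (rule gradient_bounded[OF H(1,4)], erule H(6), rule that)
  show thesis
  proof (rule that[of "1 / (C + 1)"])
    fix q assume q: "dst p q < 1 / (C + 1)"
    show "q \<in> U"
    proof (rule ccontr)
      assume "q \<notin> U"
      then have "H q = 0" using H(5,6) by blast
      moreover have "H p = 1" using H(2,3) by blast
      ultimately have "1 \<le> C * dst p q" using C1_fun_lipschitz[OF H(1) C(2), of q p] by simp
      also have "\<dots> \<le> (C + 1) * dst p q" using dst_nonneg by (intro mult_right_mono) auto
      also have "\<dots> < 1" using q C(1) by (simp add: field_simps)
      finally show False by simp
    qed
  qed (use C(1) in simp)
qed

lemma dst_nearby:
  assumes "\<epsilon> > 0"
  obtains W where "open W" "p \<in> W" "\<And>q. q \<in> W \<Longrightarrow> dst p q < \<epsilon>"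
proof -
  obtain W where W: "open W" "p \<in> W" "\<And>q. q \<in> W \<Longrightarrow> \<exists>L<\<epsilon>. reach p q L"
    by (rule reach_nearby[OF assms, of p]) (rule that)
  show thesis
  proof (rule that[OF W(1,2)])
    show "dst p q < \<epsilon>" if "q \<in> W" for q
    proof -
      obtain L where "L < \<epsilon>" "reach p q L" using W(3)[OF \<open>q \<in> W\<close>] by blast
      then show ?thesis using rdist_le[of p q L] by simp
    qed
  qed
qed

lemma dst_zero_iff: "dst p q = 0 \<longleftrightarrow> p = q"
proof
  show "p = q" if "dst p q = 0"
  proof (rule ccontr)
    assume "p \<noteq> q"
    then have "open (- {q})" "p \<in> - {q}" by auto
    then obtain \<epsilon> where "\<epsilon> > 0" "\<And>z. dst p z < \<epsilon> \<Longrightarrow> z \<in> - {q}"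
      by (rule dst_ball_subset) (rule that)
    from this(2)[of q] this(1) \<open>dst p q = 0\<close> show False by simp
  qed
  show "dst p q = 0" if "p = q" using rdist_le[OF reach.stay, of p] dst_nonneg[of p p] that by simp
qed

sublocale M: Metric_space UNIV dst
  by unfold_locales (auto simp: dst_nonneg dst_commute dst_zero_iff dst_triangle)

text \<open>Carries results on abstract metric spaces, in which completeness is formulated, over to
  compactness in the given topology.\<close>

lemma mtopology_eq: "M.mtopology = euclidean"
proof (rule topology_eq[THEN iffD2], intro allI iffI)
  fix U
  show "openin euclidean U" if "openin M.mtopology U"
  proof -
    have "\<exists>W. open W \<and> p \<in> W \<and> W \<subseteq> U" if p: "p \<in> U" for p
    proof -
      from \<open>openin M.mtopology U\<close> p obtain r where r: "r > 0" "M.mball p r \<subseteq> U"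
        unfolding M.openin_mtopology by blast
      obtain W where "open W" "p \<in> W" "\<And>q. q \<in> W \<Longrightarrow> dst p q < r"
        by (rule dst_nearby[OF r(1), of p]) (rule that)
      then show ?thesis using r(2) by (intro exI[of _ W]) auto
    qed
    then have "open U" by (subst open_subopen) blast
    then show ?thesis by simp
  qed
  show "openin M.mtopology U" if "openin euclidean U"
    unfolding M.openin_mtopology
  proof (intro conjI allI impI)
    fix p assume "p \<in> U"
    have "open U" using \<open>openin euclidean U\<close> by simp
    then obtain \<epsilon> where "\<epsilon> > 0" "\<And>q. dst p q < \<epsilon> \<Longrightarrow> q \<in> U"
      by (rule dst_ball_subset[OF _ \<open>p \<in> U\<close>]) (rule that)
    then show "\<exists>r>0. M.mball p r \<subseteq> U" by (intro exI[of _ \<epsilon>]) auto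
  qed simp
qed

lemma dst_continuous: "continuous_on UNIV (dst q)"
proof (rule continuous_at_imp_continuous_on, intro ballI)
  fix p
  show "isCont (dst q) p"
    unfolding isCont_def tendsto_iff
  proof (intro allI impI)
    fix e :: real assume "e > 0"
    then obtain W where W: "open W" "p \<in> W" "\<And>z. z \<in> W \<Longrightarrow> dst p z < e"
      by (rule dst_nearby[of e p]) (rule that)
    have "dist (dst q z) (dst q p) < e" if "z \<in> W" for z
      using W(3)[OF that] dst_triangle[of q z p] dst_triangle[of q p z] dst_commute[of p z]
      by (auto simp: dist_real_def)
    then show "\<forall>\<^sub>F z in at p. dist (dst q z) (dst q p) < e"
      using W unfolding eventually_at_topological by blast
  qed
qed

lemma dst_ball_open: "open {p. dst q p < r}"
  by (intro open_Collect_less dst_continuous continuous_on_const)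

lemma dst_cball_closed: "closed {p. dst q p \<le> r}"
  by (intro closed_Collect_le dst_continuous continuous_on_const)

section \<open>Closed balls in a complete manifold are compact\<close>

text \<open>Each point has a ball of radius 2 \<epsilon> inside a compact set, and finitely many of
  the balls of radius \<epsilon> cover the compact ball. A point slightly beyond radius
  \<open>r\<close> is, by \<open>reach_split\<close>, close to a point of that ball, hence in one of
  the doubled balls.\<close>

lemma compact_cball_extend:
  assumes K: "compact {p. dst q p \<le> r}" and r: "0 \<le> r"
  obtains \<delta> where "\<delta> > 0" "compact {p. dst q p \<le> r + \<delta>}"
proof -
  have "\<exists>\<epsilon> K. \<epsilon> > 0 \<and> compact K \<and> (\<forall>z. dst p z < 2 * \<epsilon> \<longrightarrow> z \<in> K)" for p
  proof -
    obtain W K where W: "open W" "p \<in> W" "compact K" "W \<subseteq> K"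
    proof -
      obtain H W K where H: "C1_fun H" "\<And>q. 0 \<le> H q" "\<And>q. H q \<le> 1" "open W" "p \<in> W" "\<And>q. q \<in> W \<Longrightarrow> H q = 1"
        "compact K" "K \<subseteq> UNIV \<inter> chart_dom (chart_at p)" "\<And>q. q \<notin> K \<Longrightarrow> H q = 0"
        by (rule bump_function[OF open_UNIV UNIV_I chart_at(2,1), of p]) (rule that)
      have "W \<subseteq> K" using H(6,9) by force
      then show thesis by (rule that[OF H(4,5,7)])
    qed
    obtain \<epsilon> where "\<epsilon> > 0" "\<And>q. dst p q < \<epsilon> \<Longrightarrow> q \<in> W"
      by (rule dst_ball_subset[OF W(1,2)]) (rule that)
    then show ?thesis using W(3,4) by (intro exI[of _ "\<epsilon> / 2"] exI[of _ K]) auto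
  qed
  then obtain \<epsilon> C where C: "\<And>p. \<epsilon> p > 0" "\<And>p. compact (C p)" "\<And>p z. dst p z < 2 * \<epsilon> p \<Longrightarrow> z \<in> C p"
    by metis
  obtain F where F: "finite F" "F \<subseteq> {p. dst q p \<le> r}" "{p. dst q p \<le> r} \<subseteq> (\<Union>p\<in>F. {z. dst p z < \<epsilon> p})"
    by (rule compactE_image[OF K, of "{p. dst q p \<le> r}" "\<lambda>p. {z. dst p z < \<epsilon> p}"])
       (use C(1) in \<open>auto simp: dst_ball_open\<close>)
  have "q \<in> {p. dst q p \<le> r}" using r by (simp add: dst_zero_iff[THEN iffD2])
  then have Fne: "F \<noteq> {}" using F(3) by blast
  define e where "e = Min (\<epsilon> ` F)"
  have e: "e > 0" "\<And>p. p \<in> F \<Longrightarrow> e \<le> \<epsilon> p" using F(1) Fne C(1) by (auto simp: e_def)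
  have "{p. dst q p \<le> r + e / 2} \<subseteq> (\<Union>p\<in>F. C p)"
  proof
    fix z assume "z \<in> {p. dst q p \<le> r + e / 2}"
    \<comment> \<open>The radius grows by e / 2 only, which leaves room for a chain of length below
      r + e; its part beyond length \<open>r\<close> is then shorter than \<open>e\<close>.\<close>
    then have "dst q z < r + e" using e(1) by simp
    then obtain L where L: "L < r + e" "reach q z L" using dst_lessD by blast
    have "0 \<le> L" by (rule reach_nonneg[OF L(2)])
    then obtain w where w: "reach q w (min r L)" "reach w z (L - min r L)"
      using reach_split[OF L(2), of "min r L"] r by auto
    have "dst q w \<le> r" using rdist_le[OF w(1)] by simp
    then obtain p where p: "p \<in> F" "dst p w < \<epsilon> p" using F(3) by blast
    have "dst w z < e" using rdist_le[OF w(2)] L(1) e(1) by (auto simp: min_def split: if_splits)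
    then have "dst p z < 2 * \<epsilon> p" using dst_triangle[of p z w] p e(2)[OF p(1)] by simp
    then show "z \<in> (\<Union>p\<in>F. C p)" using C(3) p(1) by blast
  qed
  moreover have "compact (\<Union>p\<in>F. C p)" using F(1) C(2) by (intro compact_UN) auto
  ultimately have "compact {p. dst q p \<le> r + e / 2}"
    using dst_cball_closed compact_Int_closed[of "\<Union>p\<in>F. C p"] by (metis inf.absorb_iff2)
  then show thesis using that[of "e / 2"] e(1) by simp
qed

text \<open>The ball of radius r - d is compact and comes within 2 d of every point of the ball of
  radius \<open>r\<close>, so a finite net of the former is a coarser net of the latter. Total
  boundedness, closedness and completeness give compactness.\<close>

lemma compact_cball_limit:
  assumes complete: "M.mcomplete" and r: "0 < r" and K: "\<And>s. 0 \<le> s \<Longrightarrow> s < r \<Longrightarrow> compact {p. dst q p \<le> s}"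
  shows "compact {p. dst q p \<le> r}"
proof -
  have "M.mtotally_bounded {p. dst q p \<le> r}"
    unfolding M.mtotally_bounded_def
  proof (intro allI impI)
    fix \<epsilon> :: real assume \<epsilon>: "\<epsilon> > 0"
    \<comment> \<open>\<epsilon> / 2 for the net and 2 d \<le> \<epsilon> / 2 for the remaining
      chain add up to \<epsilon>; d \<le> r / 2 keeps the inner radius nonnegative.\<close>
    define d where "d = min (\<epsilon> / 4) (r / 2)"
    have d: "d > 0" "d \<le> \<epsilon> / 4" "0 \<le> r - d" "r - d < r" using \<epsilon> r by (auto simp: d_def)
    obtain F where F: "finite F" "F \<subseteq> {p. dst q p \<le> r - d}"
      "{p. dst q p \<le> r - d} \<subseteq> (\<Union>p\<in>F. {z. dst p z < \<epsilon> / 2})"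
      by (rule compactE_image[OF K[OF d(3,4)], of "{p. dst q p \<le> r - d}" "\<lambda>p. {z. dst p z < \<epsilon> / 2}"])
         (use \<epsilon> dst_ball_open[of _ "\<epsilon> / 2"] in auto)
    have "{p. dst q p \<le> r} \<subseteq> (\<Union>x\<in>F. M.mball x \<epsilon>)"
    proof
      fix z assume "z \<in> {p. dst q p \<le> r}"
      then have "dst q z < r + d" using d(1) by simp
      then obtain L where L: "L < r + d" "reach q z L" using dst_lessD by blast
      have "0 \<le> L" by (rule reach_nonneg[OF L(2)])
      then obtain w where w: "reach q w (min (r - d) L)" "reach w z (L - min (r - d) L)"
        using reach_split[OF L(2), of "min (r - d) L"] d(3) by auto
      have "dst q w \<le> r - d" using rdist_le[OF w(1)] by simp
      then obtain p where p: "p \<in> F" "dst p w < \<epsilon> / 2" using F(3) by blast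
      have "dst w z < 2 * d" using rdist_le[OF w(2)] L(1) d(1) by (auto simp: min_def split: if_splits)
      then have "dst p z < \<epsilon>" using dst_triangle[of p z w] p d(2) by simp
      then show "z \<in> (\<Union>x\<in>F. M.mball x \<epsilon>)" using p(1) by auto
    qed
    then show "\<exists>K. finite K \<and> K \<subseteq> {p. dst q p \<le> r} \<and> {p. dst q p \<le> r} \<subseteq> (\<Union>x\<in>K. M.mball x \<epsilon>)"
      using F(1,2) d(4) by (intro exI[of _ F]) auto
  qed
  then have "compactin M.mtopology (M.mtopology closure_of {p. dst q p \<le> r})"
    using M.mtotally_bounded_eq_compact_closure_of[OF complete] by blast
  moreover have "M.mtopology closure_of {p. dst q p \<le> r} = {p. dst q p \<le> r}"
    using dst_cball_closed[of q r] by (simp add: mtopology_eq)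
  ultimately show ?thesis by (simp add: mtopology_eq)
qed

text \<open>Hopf-Rinow without geodesics: at the infimum \<open>R\<close> of the radii with
  non-compact balls, \<open>compact_cball_limit\<close> makes the ball compact, and
  \<open>compact_cball_extend\<close> pushes compactness beyond \<open>R\<close>.\<close>

theorem compact_cball:
  assumes complete: "complete_riemannian A g"
  shows "compact {p. dst q p \<le> r}"
proof (rule ccontr)
  assume nc: "\<not> compact {p. dst q p \<le> r}"
  define T where "T = {s. 0 \<le> s \<and> \<not> compact {p. dst q p \<le> s}}"
  have mono: "compact {p. dst q p \<le> s}" if "compact {p. dst q p \<le> t}" "s \<le> t" for s t
  proof -
    have "{p. dst q p \<le> s} = {p. dst q p \<le> t} \<inter> {p. dst q p \<le> s}" using that(2) by auto
    then show ?thesis using compact_Int_closed[OF that(1) dst_cball_closed[of q s]] by simp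
  qed
  have "0 \<le> r"
  proof (rule ccontr)
    assume "\<not> 0 \<le> r"
    then have "{p. dst q p \<le> r} = {}" by (auto dest: order_trans[OF dst_nonneg])
    then show False using nc by simp
  qed
  then have rT: "r \<in> T" using nc by (simp add: T_def)
  have bdd: "bdd_below T" by (rule bdd_belowI[of _ 0]) (simp add: T_def)
  define R where "R = Inf T"
  have R0: "0 \<le> R" unfolding R_def using rT by (intro cInf_greatest) (auto simp: T_def)
  have below: "compact {p. dst q p \<le> s}" if "0 \<le> s" "s < R" for s
    using that cInf_lower[OF _ bdd, of s] by (force simp: R_def T_def)
  have "compact {p. dst q p \<le> R}"
  proof (cases "R = 0")
    case True
    have "{p. dst q p \<le> R} = {q}" using dst_nonneg dst_zero_iff by (auto simp: True order_antisym_conv)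
    then show ?thesis by simp
  next
    case False
    show ?thesis
    proof (rule compact_cball_limit)
      show "M.mcomplete" using complete by (simp add: complete_riemannian_def)
      show "0 < R" using False R0 by simp
    qed (rule below)
  qed
  then obtain \<delta> where \<delta>: "\<delta> > 0" "compact {p. dst q p \<le> R + \<delta>}"
    by (rule compact_cball_extend[OF _ R0]) (rule that)
  have "R + \<delta> \<le> R" unfolding R_def
  proof (rule cInf_greatest)
    show "T \<noteq> {}" using rT by auto
    show "Inf T + \<delta> \<le> s" if "s \<in> T" for s
      using that mono[OF \<delta>(2), of s] by (force simp: T_def R_def)
  qed
  then show False using \<delta>(1) by simp
qed

end

section \<open>Existence and uniqueness of the Riemannian volume\<close>

context riemannian_manifold
begin

text \<open>Extended by 0 because the component matrices are arbitrary outside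
  \<open>chart_cod c\<close>; the extension is measurable on the whole space.\<close>

definition vol_density :: "('a, 'n) chart \<Rightarrow> real^'n \<Rightarrow> real" where
  "vol_density c x = (if x \<in> chart_cod c then sqrt (det (g c x)) else 0)"

lemma vol_density_nonneg: "c \<in> A \<Longrightarrow> 0 \<le> vol_density c x"
  by (auto simp: vol_density_def intro!: less_imp_le euclidean_metric.det_pos[OF euclidean_metric_chart])

lemma vol_density_measurable [measurable]:
  assumes c: "c \<in> A"
  shows "vol_density c \<in> borel_measurable borel"
proof -
  interpret euclidean_metric "chart_cod c" "g c" by (rule euclidean_metric_chart[OF c])
  have "continuous_on (chart_cod c) (\<lambda>x. sqrt (det (g c x)))"
    using C1_on_continuous[OF vol_C1] by (simp add: vol_def)
  then show ?thesis
    unfolding vol_density_def using open_cod[OF c]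
    by (intro borel_measurable_continuous_on_if) auto
qed

text \<open>A push-forward under the inverse coordinate map, which is well behaved only on
  \<open>chart_cod c\<close>; hence the restricted space.\<close>

definition chart_measure :: "('a, 'n) chart \<Rightarrow> 'a measure" where
  "chart_measure c = distr (density (restrict_space lborel (chart_cod c)) (\<lambda>x. ennreal (vol_density c x))) borel (chart_inv c)"

context
  fixes c assumes c: "c \<in> A"
begin

lemma cod_measurable [measurable]: "chart_cod c \<in> sets borel"
  using open_cod[OF c] by simp

lemma dom_measurable [measurable]: "chart_dom c \<in> sets borel"
  using open_dom[OF c] by simp

lemma chart_inv_measurable: "chart_inv c \<in> measurable (restrict_space borel (chart_cod c)) borel"
  by (rule borel_measurable_continuous_on_restrict[OF cont_inv[OF c]])

lemma chart_inv_measurable': "chart_inv c \<in> measurable (density (restrict_space lborel (chart_cod c)) h) borel"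
proof -
  have "sets (restrict_space lborel (chart_cod c)) = sets (restrict_space borel (chart_cod c))"
    by (rule sets_restrict_space_cong) simp
  then have "measurable (restrict_space lborel (chart_cod c)) borel = measurable (restrict_space borel (chart_cod c)) (borel :: 'a measure)"
    by (rule measurable_cong_sets) simp
  then show ?thesis using chart_inv_measurable by simp
qed

lemma chart_preimage_measurable:
  assumes "E \<in> sets borel" shows "chart_cod c \<inter> chart_inv c -` E \<in> sets borel"
proof -
  have "chart_inv c -` E \<inter> space (restrict_space borel (chart_cod c)) \<in> sets (restrict_space borel (chart_cod c))"
    by (rule measurable_sets[OF chart_inv_measurable assms])
  then show ?thesis
    by (subst (asm) sets_restrict_space_iff) (auto simp: space_restrict_space Int_commute)
qed

lemma chart_image_measurable:
  assumes "E \<in> sets borel" shows "coord c ` (chart_dom c \<inter> E) \<in> sets borel"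
  unfolding chart_image_eq[OF c] by (rule chart_preimage_measurable[OF assms])

lemma emeasure_chart_measure:
  assumes E: "E \<in> sets borel"
  shows "emeasure (chart_measure c) E = (\<integral>\<^sup>+x\<in>coord c ` (chart_dom c \<inter> E). ennreal (vol_density c x) \<partial>lborel)"
proof -
  let ?R = "restrict_space lborel (chart_cod c)"
  have sp: "space (density ?R (\<lambda>x. ennreal (vol_density c x))) = chart_cod c"
    by (simp add: space_restrict_space)
  have X: "chart_inv c -` E \<inter> chart_cod c \<in> sets ?R"
    using chart_preimage_measurable[OF E] by (subst sets_restrict_space_iff) (auto simp: Int_commute)
  have dm: "(\<lambda>x. ennreal (vol_density c x)) \<in> borel_measurable ?R"
    by (rule measurable_restrict_space1) (use vol_density_measurable[OF c] in auto)
  have "emeasure (chart_measure c) E =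
      emeasure (density ?R (\<lambda>x. ennreal (vol_density c x))) (chart_inv c -` E \<inter> chart_cod c)"
    unfolding chart_measure_def using emeasure_distr[OF chart_inv_measurable' E] sp by simp
  also have "\<dots> = (\<integral>\<^sup>+x. ennreal (vol_density c x) * indicator (chart_inv c -` E \<inter> chart_cod c) x \<partial>?R)"
    by (rule emeasure_density[OF dm X])
  also have "\<dots> = (\<integral>\<^sup>+x. ennreal (vol_density c x) * indicator (chart_inv c -` E \<inter> chart_cod c) x * indicator (chart_cod c) x \<partial>lborel)"
    by (rule nn_integral_restrict_space) simp
  also have "\<dots> = (\<integral>\<^sup>+x\<in>coord c ` (chart_dom c \<inter> E). ennreal (vol_density c x) \<partial>lborel)"
    unfolding chart_image_eq[OF c] by (intro nn_integral_cong) (auto simp: indicator_def)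
  finally show ?thesis .
qed

lemma sets_chart_measure [simp]: "sets (chart_measure c) = sets borel"
  by (simp add: chart_measure_def)

lemma space_chart_measure [simp]: "space (chart_measure c) = UNIV"
  by (simp add: chart_measure_def)

end

text \<open>The transformation law of the metric multiplies its determinant by the square of the
  Jacobian determinant, so the square roots absorb exactly the factor from the change of
  variables.\<close>

lemma chart_measure_consistent:
  assumes c: "c \<in> A" "c' \<in> A" and E: "E \<in> sets borel" "E \<subseteq> chart_dom c" "E \<subseteq> chart_dom c'"
  shows "emeasure (chart_measure c) E = emeasure (chart_measure c') E"
proof -
  define T where "T = coord c' \<circ> chart_inv c"
  have int: "chart_dom c \<inter> E = E" "chart_dom c' \<inter> E = E" using E by auto
  have TS: "T ` coord c ` E = coord c' ` E"
    unfolding T_def image_comp using E(2) by (intro image_cong) (auto simp: inv_coord[OF c(1)])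
  have S: "coord c ` E \<in> sets borel" "coord c' ` E \<in> sets borel"
    using chart_image_measurable[OF c(1) E(1)] chart_image_measurable[OF c(2) E(1)] int by simp_all
  have sub: "coord c ` E \<subseteq> coord c ` (chart_dom c \<inter> chart_dom c')" using E by auto
  have "(\<integral>\<^sup>+y\<in>T ` coord c ` E. ennreal (vol_density c' y) \<partial>lborel) = (\<integral>\<^sup>+x\<in>coord c ` E. ennreal (vol_density c x) \<partial>lborel)"
  proof (rule nn_integral_change_of_variables[where T' = "\<lambda>x v. transition_jacobian c c' x *v v"])
    show "T ` coord c ` E \<in> sets borel" unfolding TS by (rule S)
    show "(T has_derivative (*v) (transition_jacobian c c' x)) (at x within coord c ` E)" if "x \<in> coord c ` E" for x
      unfolding T_def
      by (rule has_derivative_at_withinI[OF transition_jacobian_works[OF c]]) (use sub that in blast)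
    show "inj_on T (coord c ` E)"
    proof (rule inj_onI)
      fix x y assume "x \<in> coord c ` E" "y \<in> coord c ` E" "T x = T y"
      then obtain p q where pq: "x = coord c p" "p \<in> E" "y = coord c q" "q \<in> E" by blast
      have d: "p \<in> chart_dom c" "q \<in> chart_dom c" "p \<in> chart_dom c'" "q \<in> chart_dom c'"
        using pq(2,4) E(2,3) by auto
      then have "coord c' p = coord c' q"
        using \<open>T x = T y\<close> by (simp add: pq T_def inv_coord[OF c(1)])
      then have "p = q" using inv_coord[OF c(2) d(3)] inv_coord[OF c(2) d(4)] by metis
      then show "x = y" using pq by simp
    qed
    show "vol_density c x = \<bar>det (matrix ((*v) (transition_jacobian c c' x)))\<bar> * vol_density c' (T x)" if x: "x \<in> coord c ` E" for x
    proof -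
      obtain p where p: "x = coord c p" "p \<in> E" using x by blast
      then have d: "p \<in> chart_dom c" "p \<in> chart_dom c'" using E by auto
      have Tx: "T x = coord c' p" using d by (simp add: T_def p inv_coord[OF c(1)])
      have "det (g c x) = (det (transition_jacobian c c' x))\<^sup>2 * det (g c' (T x))"
        unfolding Tx using metric_tensorial[OF c, of p] d by (simp add: p(1) det_mul power2_eq_square)
      then show ?thesis
        unfolding Tx using d by (simp add: vol_density_def p(1) coord_in c real_sqrt_mult)
    qed
    show "coord c ` E \<in> sets borel" by (rule S)
    show "vol_density c \<in> borel_measurable borel" "vol_density c' \<in> borel_measurable borel"
      by (rule vol_density_measurable, rule c)+
    show "0 \<le> vol_density c x" "0 \<le> vol_density c' x" for x
      by (rule vol_density_nonneg, rule c)+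
  qed
  then show ?thesis
    unfolding TS by (simp add: emeasure_chart_measure c E(1) int)
qed

lemma countable_chart_cover:
  obtains cs :: "nat \<Rightarrow> ('a, 'n) chart" where "\<And>n. cs n \<in> A" "(\<Union>n. chart_dom (cs n)) = UNIV"
proof -
  obtain F where F: "F \<subseteq> chart_dom ` A" "countable F" "\<Union>F = \<Union>(chart_dom ` A)"
    by (rule Lindelof[of "chart_dom ` A"], (auto simp: open_dom)[1], rule that)
  have cov: "\<Union>F = UNIV" using F(3) cover by simp
  then have "F \<noteq> {}" by auto
  then have rng: "range (from_nat_into F) = F" using F(2) by (rule range_from_nat_into)
  have "\<exists>c. c \<in> A \<and> chart_dom c = from_nat_into F n" for n
  proof -
    have "from_nat_into F n \<in> chart_dom ` A" using F(1) rng by blast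
    then show ?thesis by force
  qed
  then obtain cs where cs: "\<And>n. cs n \<in> A" "\<And>n. chart_dom (cs n) = from_nat_into F n" by metis
  have "(\<Union>n. chart_dom (cs n)) = UNIV" unfolding cs(2) using rng cov by simp
  then show thesis using that cs(1) by blast
qed

text \<open>A countable cover by charts is made disjoint, and the chart measures of the pieces are
  summed; \<open>chart_measure_consistent\<close> gives the required density in every chart. The
  same decomposition shows that two such measures agree. This gives meaning to the definite
  description in \<open>riemannian_volume\<close>.\<close>

lemma riemannian_volume_exists_unique: "\<exists>!\<mu>. is_riemannian_volume A g \<mu>"
proof -
  obtain cs :: "nat \<Rightarrow> ('a, 'n) chart" where cs: "\<And>n. cs n \<in> A" "(\<Union>n. chart_dom (cs n)) = UNIV"
    by (rule countable_chart_cover) (rule that)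
  define D where "D = disjointed (\<lambda>n. chart_dom (cs n))"
  have D: "D n \<subseteq> chart_dom (cs n)" for n unfolding D_def by (rule disjointed_subset)
  have D_UN: "(\<Union>n. D n) = UNIV" unfolding D_def UN_disjointed_eq by (rule cs(2))
  have D_disj: "disjoint_family D" unfolding D_def by (rule disjoint_family_disjointed)
  have D_sets: "D n \<in> sets borel" for n
  proof -
    have "range D \<subseteq> sets borel"
      unfolding D_def by (rule sets.range_disjointed_sets) (use open_dom cs(1) in auto)
    then show ?thesis by auto
  qed
  have split: "emeasure \<nu> E = (\<Sum>n. emeasure \<nu> (E \<inter> D n))" if "sets \<nu> = sets borel" "E \<in> sets borel" for \<nu> E
  proof -
    have "disjoint_family (\<lambda>n. E \<inter> D n)" using D_disj by (rule disjoint_family_subset) auto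
    then have "(\<Sum>n. emeasure \<nu> (E \<inter> D n)) = emeasure \<nu> (\<Union>n. E \<inter> D n)"
      by (intro suminf_emeasure) (use that D_sets in auto)
    also have "(\<Union>n. E \<inter> D n) = E" using D_UN by blast
    finally show ?thesis by simp
  qed
  have vol_iff: "is_riemannian_volume A g \<mu> \<longleftrightarrow> sets \<mu> = sets borel \<and>
      (\<forall>c\<in>A. \<forall>E\<in>sets borel. E \<subseteq> chart_dom c \<longrightarrow> emeasure \<mu> E = emeasure (chart_measure c) E)" for \<mu>
  proof -
    have "emeasure (chart_measure c) E = (\<integral>\<^sup>+x\<in>coord c ` E. ennreal (sqrt (det (g c x))) \<partial>lborel)"
      if "c \<in> A" "E \<in> sets borel" "E \<subseteq> chart_dom c" for c E
    proof -
      have "chart_dom c \<inter> E = E" using that(3) by blast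
      then show ?thesis
        unfolding emeasure_chart_measure[OF that(1,2)] using that(3) coord_in[OF that(1)]
        by (intro nn_integral_cong) (auto simp: indicator_def vol_density_def)
    qed
    then show ?thesis unfolding is_riemannian_volume_def by auto
  qed
  define \<mu> where "\<mu> = measure_of UNIV (sets borel) (\<lambda>E. \<Sum>n. emeasure (chart_measure (cs n)) (E \<inter> D n))"
  have sets_\<mu>: "sets \<mu> = sets borel" unfolding \<mu>_def by (simp add: sets.sets_measure_of_eq[of borel, simplified])
  have em_\<mu>: "emeasure \<mu> E = (\<Sum>n. emeasure (chart_measure (cs n)) (E \<inter> D n))" if E: "E \<in> sets borel" for E
  proof (rule emeasure_measure_of[OF \<mu>_def])
    show "positive (sets \<mu>) (\<lambda>E. \<Sum>n. emeasure (chart_measure (cs n)) (E \<inter> D n))"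
      by (simp add: positive_def)
    show "countably_additive (sets \<mu>) (\<lambda>E. \<Sum>n. emeasure (chart_measure (cs n)) (E \<inter> D n))"
      unfolding countably_additive_def sets_\<mu>
    proof (intro allI impI)
      fix X :: "nat \<Rightarrow> 'a set" assume X: "range X \<subseteq> sets borel" "disjoint_family X"
      \<comment> \<open>The two sums are interchanged by reading the inner one as an integral over
        the counting measure.\<close>
      have "(\<Sum>i. \<Sum>n. emeasure (chart_measure (cs n)) (X i \<inter> D n)) =
          (\<Sum>i. \<integral>\<^sup>+n. emeasure (chart_measure (cs n)) (X i \<inter> D n) \<partial>count_space UNIV)"
        by (simp add: nn_integral_count_space_nat)
      also have "\<dots> = (\<integral>\<^sup>+n. (\<Sum>i. emeasure (chart_measure (cs n)) (X i \<inter> D n)) \<partial>count_space UNIV)"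
        by (rule nn_integral_suminf[symmetric]) simp
      also have "\<dots> = (\<Sum>n. \<Sum>i. emeasure (chart_measure (cs n)) (X i \<inter> D n))"
        by (simp add: nn_integral_count_space_nat)
      also have "\<dots> = (\<Sum>n. emeasure (chart_measure (cs n)) ((\<Union>i. X i) \<inter> D n))"
      proof (rule suminf_cong)
        fix n
        have "disjoint_family (\<lambda>i. X i \<inter> D n)" using X(2) by (rule disjoint_family_subset) auto
        then have "(\<Sum>i. emeasure (chart_measure (cs n)) (X i \<inter> D n)) = emeasure (chart_measure (cs n)) (\<Union>i. X i \<inter> D n)"
          by (intro suminf_emeasure) (use X D_sets cs(1) in auto)
        then show "(\<Sum>i. emeasure (chart_measure (cs n)) (X i \<inter> D n)) = emeasure (chart_measure (cs n)) ((\<Union>i. X i) \<inter> D n)"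
          by simp
      qed
      finally show "(\<Sum>i. \<Sum>n. emeasure (chart_measure (cs n)) (X i \<inter> D n)) =
          (\<Sum>n. emeasure (chart_measure (cs n)) (\<Union> (range X) \<inter> D n))" .
    qed
  qed (use E sets_\<mu> in auto)
  have "is_riemannian_volume A g \<mu>"
    unfolding vol_iff
  proof (intro conjI sets_\<mu> ballI impI)
    fix c E assume c: "c \<in> A" and E: "E \<in> sets borel" "E \<subseteq> chart_dom c"
    have "emeasure (chart_measure (cs n)) (E \<inter> D n) = emeasure (chart_measure c) (E \<inter> D n)" for n
      by (rule chart_measure_consistent[OF cs(1) c]) (use E D[of n] D_sets in auto)
    then show "emeasure \<mu> E = emeasure (chart_measure c) E"
      using split[OF sets_chart_measure[OF c] E(1)] by (simp add: em_\<mu>[OF E(1)])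
  qed
  moreover have "\<mu>1 = \<mu>2" if "is_riemannian_volume A g \<mu>1" "is_riemannian_volume A g \<mu>2" for \<mu>1 \<mu>2
  proof (rule measure_eqI)
    show "sets \<mu>1 = sets \<mu>2" using that by (simp add: vol_iff)
    fix E assume "E \<in> sets \<mu>1"
    then have E: "E \<in> sets borel" using that by (simp add: vol_iff)
    have "emeasure \<mu>1 (E \<inter> D n) = emeasure \<mu>2 (E \<inter> D n)" for n
    proof -
      have "E \<inter> D n \<in> sets borel" "E \<inter> D n \<subseteq> chart_dom (cs n)" using E D_sets D[of n] by auto
      then show ?thesis using that cs(1)[of n] unfolding vol_iff by simp
    qed
    then show "emeasure \<mu>1 E = emeasure \<mu>2 E"
      using split[of \<mu>1 E] split[of \<mu>2 E] that E by (simp add: vol_iff)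
  qed
  ultimately show ?thesis by blast
qed

section \<open>Integration with respect to the Riemannian volume\<close>

abbreviation \<mu>\<^sub>g :: "'a measure" where "\<mu>\<^sub>g \<equiv> riemannian_volume A g"

lemma is_riemannian_volume: "is_riemannian_volume A g \<mu>\<^sub>g"
  unfolding riemannian_volume_def using riemannian_volume_exists_unique by (rule theI')

lemma sets_volume [measurable_cong, simp]: "sets \<mu>\<^sub>g = sets borel"
  using is_riemannian_volume by (simp add: is_riemannian_volume_def)

lemma space_volume [simp]: "space \<mu>\<^sub>g = UNIV"
  using sets_eq_imp_space_eq[OF sets_volume] by simp

lemma volume_chart:
  assumes c: "c \<in> A"
  shows "density \<mu>\<^sub>g (\<lambda>p. ennreal (indicator (chart_dom c) p)) = chart_measure c"
proof (rule measure_eqI)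
  show "sets (density \<mu>\<^sub>g (\<lambda>p. ennreal (indicator (chart_dom c) p))) = sets (chart_measure c)"
    by (simp add: sets_chart_measure[OF c])
  fix E assume "E \<in> sets (density \<mu>\<^sub>g (\<lambda>p. ennreal (indicator (chart_dom c) p)))"
  then have E: "E \<in> sets borel" by simp
  have "emeasure (density \<mu>\<^sub>g (\<lambda>p. ennreal (indicator (chart_dom c) p))) E =
      (\<integral>\<^sup>+p. ennreal (indicator (chart_dom c) p) * indicator E p \<partial>\<mu>\<^sub>g)"
    by (rule emeasure_density) (use E dom_measurable[OF c] in auto)
  also have "\<dots> = (\<integral>\<^sup>+p. indicator (chart_dom c \<inter> E) p \<partial>\<mu>\<^sub>g)"
    by (intro nn_integral_cong) (auto simp: indicator_def)
  also have "\<dots> = emeasure \<mu>\<^sub>g (chart_dom c \<inter> E)"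
    using E dom_measurable[OF c] by (intro nn_integral_indicator) simp
  also have "\<dots> = (\<integral>\<^sup>+x\<in>coord c ` (chart_dom c \<inter> E). ennreal (sqrt (det (g c x))) \<partial>lborel)"
    using is_riemannian_volume c E dom_measurable[OF c] by (simp add: is_riemannian_volume_def)
  also have "\<dots> = emeasure (chart_measure c) E"
    unfolding emeasure_chart_measure[OF c E] using coord_in[OF c]
    by (intro nn_integral_cong) (auto simp: indicator_def vol_density_def)
  finally show "emeasure (density \<mu>\<^sub>g (\<lambda>p. ennreal (indicator (chart_dom c) p))) E = emeasure (chart_measure c) E" .
qed

lemma integral_volume_chart:
  fixes u :: "'a \<Rightarrow> real"
  assumes c: "c \<in> A" and u: "u \<in> borel_measurable borel" "\<And>p. p \<notin> chart_dom c \<Longrightarrow> u p = 0"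
  shows "(\<integral>p. u p \<partial>\<mu>\<^sub>g) = (\<integral>x. vol_density c x * u (chart_inv c x) \<partial>lborel)"
proof -
  let ?R = "restrict_space lborel (chart_cod c)"
  have "(\<integral>p. u p \<partial>\<mu>\<^sub>g) = (\<integral>p. indicator (chart_dom c) p *\<^sub>R u p \<partial>\<mu>\<^sub>g)"
    using u(2) by (intro Bochner_Integration.integral_cong) (auto simp: indicator_def)
  also have "\<dots> = (\<integral>p. u p \<partial>(density \<mu>\<^sub>g (\<lambda>p. ennreal (indicator (chart_dom c) p))))"
    by (rule integral_density[symmetric]) (use u(1) dom_measurable[OF c] in auto)
  also have "\<dots> = (\<integral>x. u (chart_inv c x) \<partial>(density ?R (\<lambda>x. ennreal (vol_density c x))))"
    unfolding volume_chart[OF c] chart_measure_def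
    by (rule integral_distr[OF chart_inv_measurable'[OF c] u(1)])
  also have "\<dots> = (\<integral>x. vol_density c x *\<^sub>R u (chart_inv c x) \<partial>?R)"
  proof (rule integral_density)
    show "(\<lambda>x. u (chart_inv c x)) \<in> borel_measurable ?R"
      using chart_inv_measurable'[OF c, of "\<lambda>_. 1"] u(1) by (auto intro: measurable_compose)
    show "vol_density c \<in> borel_measurable ?R"
      by (rule measurable_restrict_space1) (use vol_density_measurable[OF c] in auto)
  qed (use vol_density_nonneg[OF c] in auto)
  also have "\<dots> = (\<integral>x. indicator (chart_cod c) x *\<^sub>R (vol_density c x *\<^sub>R u (chart_inv c x)) \<partial>lborel)"
    by (rule integral_restrict_space) (use cod_measurable[OF c] in simp)
  also have "\<dots> = (\<integral>x. vol_density c x * u (chart_inv c x) \<partial>lborel)"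
    by (intro Bochner_Integration.integral_cong) (auto simp: indicator_def vol_density_def)
  finally show ?thesis .
qed

text \<open>The density is positive, so a null open set would have a Lebesgue-null open image in a
  chart. The final contradiction rests on this.\<close>

lemma volume_open_pos:
  assumes "open U" "U \<noteq> {}"
  shows "emeasure \<mu>\<^sub>g U \<noteq> 0"
proof
  assume 0: "emeasure \<mu>\<^sub>g U = 0"
  obtain p where p: "p \<in> U" using assms(2) by blast
  define c where "c = chart_at p"
  have c: "c \<in> A" "p \<in> chart_dom c" by (simp_all add: c_def chart_at)
  define X where "X = coord c ` (chart_dom c \<inter> U)"
  have X: "open X" unfolding X_def by (rule open_chart_image[OF c(1) assms(1)])
  have Xb: "X \<in> sets borel" using X by simp
  have "emeasure \<mu>\<^sub>g (chart_dom c \<inter> U) \<le> emeasure \<mu>\<^sub>g U"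
    by (rule emeasure_mono) (use assms(1) in auto)
  then have "emeasure \<mu>\<^sub>g (chart_dom c \<inter> U) = 0" using 0 by simp
  moreover have "emeasure \<mu>\<^sub>g (chart_dom c \<inter> U) = (\<integral>\<^sup>+x\<in>X. ennreal (sqrt (det (g c x))) \<partial>lborel)"
    using is_riemannian_volume c(1) open_dom[OF c(1)] assms(1)
    by (simp add: is_riemannian_volume_def X_def)
  moreover have "\<dots> = (\<integral>\<^sup>+x. ennreal (vol_density c x) * indicator X x \<partial>lborel)"
    by (intro nn_integral_cong) (auto simp: indicator_def vol_density_def X_def coord_in[OF c(1)])
  ultimately have "(\<integral>\<^sup>+x. ennreal (vol_density c x) * indicator X x \<partial>lborel) = 0" by simp
  moreover have meas: "(\<lambda>x. ennreal (vol_density c x) * indicator X x) \<in> borel_measurable lborel"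
    using vol_density_measurable[OF c(1)] Xb by auto
  ultimately have "AE x in lborel. ennreal (vol_density c x) * indicator X x = 0"
    by (simp add: nn_integral_0_iff_AE)
  moreover have "ennreal (vol_density c x) * indicator X x \<noteq> 0" if "x \<in> X" for x
  proof -
    have x: "x \<in> chart_cod c" using that by (auto simp: X_def coord_in[OF c(1)])
    then show ?thesis
      using that euclidean_metric.det_pos[OF euclidean_metric_chart[OF c(1)] x]
      by (auto simp: vol_density_def)
  qed
  ultimately have "AE x in lborel. x \<notin> X" by (auto elim!: eventually_mono)
  then have "X \<in> null_sets lborel" using Xb by (subst (asm) AE_iff_null_sets[symmetric]) auto
  then have "negligible X" using negligible_iff_null_sets null_sets_completionI by blast
  moreover have "X \<noteq> {}" using p c(2) by (auto simp: X_def)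
  ultimately show False using open_not_negligible[OF X] by blast
qed

end

section \<open>Integration by parts against Lipschitz functions\<close>

context connected_riemannian_manifold
begin

text \<open>A relation rather than a function: that the trace of the Hessian takes the same value in
  all charts is part of the condition, and the quasi-Einstein equation supplies a right-hand side
  free of charts.\<close>

definition is_laplacian :: "('a \<Rightarrow> real) \<Rightarrow> ('a \<Rightarrow> real) \<Rightarrow> bool" where
  "is_laplacian f \<Lambda> \<longleftrightarrow> (\<forall>c\<in>A. \<forall>p\<in>chart_dom c.
     (\<Sum>i\<in>UNIV. \<Sum>j\<in>UNIV. matrix_inv (g c (coord c p)) $ i $ j *
        hessian (g c) (f \<circ> chart_inv c) (coord c p) $ i $ j) = \<Lambda> p)"

text \<open>Local finiteness of the volume enters as the hypothesis \<open>fin\<close>; the growth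
  of balls provides it later.\<close>

lemma integrable_volume:
  assumes fin: "\<And>K. compact K \<Longrightarrow> emeasure \<mu>\<^sub>g K < \<infinity>"
    and u: "continuous_on UNIV u" and K: "compact K" "\<And>p. p \<notin> K \<Longrightarrow> u p = 0"
  shows "integrable \<mu>\<^sub>g (u :: 'a \<Rightarrow> real)"
proof -
  have "bounded (u ` K)"
    using u K(1) by (intro compact_imp_bounded compact_continuous_image) (auto intro: continuous_on_subset)
  then obtain C where C: "\<And>p. p \<in> K \<Longrightarrow> \<bar>u p\<bar> \<le> C" by (auto simp: bounded_iff)
  have Kb: "K \<in> sets borel" using K(1) by (simp add: compact_imp_closed)
  show ?thesis
  proof (rule Bochner_Integration.integrable_bound[where f = "\<lambda>p. C * indicator K p"])
    show "integrable \<mu>\<^sub>g (\<lambda>p. C * indicator K p :: real)"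
      using fin[OF K(1)] Kb by (intro integrable_mult_right integrable_real_indicator) (auto simp: top.not_eq_extremum)
    show "u \<in> borel_measurable \<mu>\<^sub>g" using borel_measurable_continuous_onI[OF u] by simp
    have "norm (u p) \<le> norm (C * indicator K p)" for p
      using C[of p] K(2)[of p] by (cases "p \<in> K") auto
    then show "AE p in \<mu>\<^sub>g. norm (u p) \<le> norm (C * indicator K p)" by simp
  qed
qed

lemma gpair_zero_outside:
  assumes "compact K" "\<And>q. q \<notin> K \<Longrightarrow> \<psi> q = 0" "p \<notin> K"
  shows "gpair \<psi> v p = 0"
  by (rule gpair_local[of "- K" _ _ 0]) (use assms in \<open>auto simp: compact_imp_closed open_Compl\<close>)

context
  fixes f \<Lambda> \<phi> :: "'a \<Rightarrow> real" and \<kappa> :: real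
  assumes f: "smooth_fun A f" and lap: "is_laplacian f \<Lambda>" and \<Lambda>_cont: "continuous_on UNIV \<Lambda>"
    and \<phi>_cont: "continuous_on UNIV \<phi>" and \<phi>_range: "\<And>p. 0 \<le> \<phi> p" "\<And>p. \<phi> p \<le> 1"
    and \<kappa>: "0 \<le> \<kappa>" and \<phi>_lip: "\<And>p q. \<bar>\<phi> p - \<phi> q\<bar> \<le> \<kappa> * dst p q"
begin

lemma f_C1: "C1_fun f" by (rule smooth_fun_C1[OF f])

text \<open>\<open>\<phi>\<^sup>2\<close> times the divergence of \<open>\<psi> \<nabla>f\<close>.\<close>

definition weak_integrand :: "('a \<Rightarrow> real) \<Rightarrow> 'a \<Rightarrow> real" where
  "weak_integrand \<psi> p = (\<phi> p)\<^sup>2 * (\<psi> p * \<Lambda> p + gpair \<psi> f p)"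

text \<open>For nonnegative \<psi>, this is \<phi> times the length of the field \<psi> \<nabla>f:
  up to the factor 2 \<kappa>, a bound for the derivative of \<phi>^2 along that field.\<close>

definition gradient_integrand :: "('a \<Rightarrow> real) \<Rightarrow> 'a \<Rightarrow> real" where
  "gradient_integrand \<psi> p = \<phi> p * (\<psi> p * sqrt (gpair f f p))"

lemma integrand_continuous:
  assumes "C1_fun \<psi>"
  shows "continuous_on UNIV (weak_integrand \<psi>)" "continuous_on UNIV (gradient_integrand \<psi>)"
  unfolding weak_integrand_def[abs_def] gradient_integrand_def[abs_def]
  by (intro continuous_intros \<phi>_cont \<Lambda>_cont C1_fun_continuous gpair_continuous assms f_C1)+

lemma integrand_zero:
  assumes "compact K" "\<And>q. q \<notin> K \<Longrightarrow> \<psi> q = 0" "p \<notin> K"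
  shows "weak_integrand \<psi> p = 0" "gradient_integrand \<psi> p = 0"
  using assms(2)[OF assms(3)] gpair_zero_outside[OF assms]
  by (auto simp: weak_integrand_def gradient_integrand_def)

text \<open>The factor of \<phi>^2 in the integrand, times the volume density, is the coordinate
  divergence of the field \<open>Y\<close>, which is \<psi> \<nabla>f times that density. So
  \<open>integral_divergence_bound\<close> applies with \<phi>^2 for \<open>H\<close> and the metric
  at the centre \<open>x0\<close> for \<open>B\<close>. Of the constant 8, a factor 4 sits in
  \<open>a\<close> and a factor 2 comes from measuring \<open>Y\<close> at \<open>x0\<close> instead
  of \<open>x\<close>.\<close>

lemma local_estimate:
  assumes c: "c \<in> A" and x0: "x0 \<in> chart_cod c" and \<delta>: "\<delta> > 0" "cball x0 \<delta> \<subseteq> chart_cod c"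
    and cmp: "\<And>x v. x \<in> cball x0 \<delta> \<Longrightarrow> gnorm c x v \<le> 2 * gnorm c x0 v"
      "\<And>x v. x \<in> cball x0 \<delta> \<Longrightarrow> gnorm c x0 v \<le> 2 * gnorm c x v"
    and K: "compact K" "K \<subseteq> chart_inv c ` cball x0 (\<delta> / 2)"
    and \<psi>: "C1_fun \<psi>" "\<And>p. 0 \<le> \<psi> p" "\<And>p. p \<notin> K \<Longrightarrow> \<psi> p = 0"
  shows "\<bar>\<integral>p. weak_integrand \<psi> p \<partial>\<mu>\<^sub>g\<bar> \<le> 8 * CARD('n) * \<kappa> * (\<integral>p. gradient_integrand \<psi> p \<partial>\<mu>\<^sub>g)"
proof -
  interpret euclidean_metric "chart_cod c" "g c" by (rule euclidean_metric_chart[OF c])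
  define F where "F = f \<circ> chart_inv c"
  have F: "C1_on (chart_cod c) (pd j F)" for j
    using f c smooth_on_pd_C1 by (auto simp: smooth_fun_def F_def)
  define \<Psi> where "\<Psi> x = \<psi> (chart_inv c x)" for x
  have \<Psi>: "C1_on (chart_cod c) \<Psi>" unfolding \<Psi>_def[abs_def] by (rule C1_funD[OF \<psi>(1) c])
  have sub2: "cball x0 (\<delta> / 2) \<subseteq> cball x0 \<delta>" using \<delta>(1) by (intro subset_cball) simp
  have K_dom: "K \<subseteq> chart_dom c" using K(2) sub2 \<delta>(2) inv_in[OF c] by blast
  define X where "X = coord c ` K"
  have X: "compact X" unfolding X_def
    using K(1) cont_coord[OF c] K_dom by (intro compact_continuous_image) (auto intro: continuous_on_subset)
  have X_sub: "X \<subseteq> cball x0 (\<delta> / 2)"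
  proof
    fix x assume "x \<in> X"
    then obtain p where p: "p \<in> K" "x = coord c p" by (auto simp: X_def)
    then obtain y where y: "y \<in> cball x0 (\<delta> / 2)" "p = chart_inv c y" using K(2) by blast
    then have "y \<in> chart_cod c" using sub2 \<delta>(2) by blast
    then show "x \<in> cball x0 (\<delta> / 2)" using y p by (simp only: coord_inv[OF c])
  qed
  have X_cod: "X \<subseteq> chart_cod c" using X_sub sub2 \<delta>(2) by blast
  have out: "chart_inv c x \<notin> K" if x: "x \<in> chart_cod c" "x \<notin> X" for x
  proof
    assume "chart_inv c x \<in> K"
    then have "coord c (chart_inv c x) \<in> X" by (simp add: X_def)
    then show False using x by (simp add: coord_inv[OF c])
  qed
  have \<Psi>0: "\<Psi> x = 0" if "x \<in> chart_cod c" "x \<notin> X" for x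
    using out[OF that] \<psi>(3) by (simp add: \<Psi>_def)
  \<comment> \<open>The extension by 0 is C1 on the whole space, since \<psi> is supported in a
    compact part of the chart.\<close>
  define Y where "Y i x = (if x \<in> chart_cod c then \<Psi> x * flux F i x else 0)" for i x
  have Y0: "Y i x = 0" if "x \<notin> X" for i x using \<Psi>0 that by (simp add: Y_def)
  have Y_C1: "C1_on UNIV (Y i)" for i
  proof -
    have "C1_on (chart_cod c) (Y i)"
      by (rule C1_on_cong[OF S C1_on_mult[OF \<Psi> flux_C1[OF F, of i]]]) (simp add: Y_def)
    moreover have oX: "open (- X)" using X by (simp add: compact_imp_closed open_Compl)
    moreover have "C1_on (- X) (Y i)"
      by (rule C1_on_cong[OF oX C1_on_const[of _ 0]]) (simp add: Y0)
    ultimately have "C1_on (chart_cod c \<union> - X) (Y i)" using S by (intro C1_on_Un)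
    moreover have "chart_cod c \<union> - X = UNIV" using X_cod by blast
    ultimately show ?thesis by simp
  qed
  define z where "z x = matrix_inv (g c x) *v gradv c f (chart_inv c x)" for x
  have z: "z x $ i = (\<Sum>j\<in>UNIV. h i j x * pd j F x)" if "x \<in> chart_cod c" for x i
    by (simp add: z_def matrix_vector_mult_def gradv_def F_def coord_inv[OF c that])
  have pair: "gpair u f (chart_inv c x) = gradv c u (chart_inv c x) \<bullet> z x" if "C1_fun u" "x \<in> chart_cod c" for u x
    using gpair_eq[OF that(1) f_C1 c inv_in[OF c that(2)]] by (simp add: z_def coord_inv[OF c that(2)])
  have vol_eq: "vol_density c x = vol x" if "x \<in> chart_cod c" for x
    using that by (simp add: vol_density_def vol_def)
  have div: "(\<Sum>i\<in>UNIV. pd i (Y i) x) = vol x * (\<psi> (chart_inv c x) * \<Lambda> (chart_inv c x) + gpair \<psi> f (chart_inv c x))"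
    if x: "x \<in> chart_cod c" for x
  proof -
    have "pd i (Y i) x = \<Psi> x * pd i (flux F i) x + pd i \<Psi> x * flux F i x" for i
    proof -
      have "pd i (Y i) x = pd i (\<lambda>x. \<Psi> x * flux F i x) x"
        by (rule pd_cong[OF S x]) (simp add: Y_def)
      also have "\<dots> = \<Psi> x * pd i (flux F i) x + pd i \<Psi> x * flux F i x"
        by (rule pd_mult[OF C1_onD(1)[OF \<Psi> x] C1_onD(1)[OF flux_C1[OF F] x]])
      finally show ?thesis .
    qed
    then have "(\<Sum>i\<in>UNIV. pd i (Y i) x) = \<Psi> x * (\<Sum>i\<in>UNIV. pd i (flux F i) x) + (\<Sum>i\<in>UNIV. pd i \<Psi> x * flux F i x)"
      by (simp add: sum.distrib sum_distrib_left)
    also have "(\<Sum>i\<in>UNIV. pd i (flux F i) x) = vol x * \<Lambda> (chart_inv c x)"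
    proof -
      have "(\<Sum>i\<in>UNIV. \<Sum>j\<in>UNIV. h i j (coord c (chart_inv c x)) *
          hessian (g c) F (coord c (chart_inv c x)) $ i $ j) = \<Lambda> (chart_inv c x)"
        using lap c inv_in[OF c x] unfolding is_laplacian_def F_def by blast
      then show ?thesis unfolding divergence_flux[OF F x] coord_inv[OF c x] by simp
    qed
    also have "(\<Sum>i\<in>UNIV. pd i \<Psi> x * flux F i x) = vol x * gpair \<psi> f (chart_inv c x)"
      unfolding pair[OF \<psi>(1) x]
      by (simp add: flux_def inner_vec_def z[OF x] gradv_def coord_inv[OF c x] \<Psi>_def[abs_def] o_def sum_distrib_left mult_ac)
    finally show ?thesis by (simp add: \<Psi>_def algebra_simps)
  qed
  define H where "H x = (if x \<in> chart_cod c then (\<phi> (chart_inv c x))\<^sup>2 else 0)" for x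
  \<comment> \<open>2 \<phi> from the square, \<kappa> from the Lipschitz bound, and a further 2
    because a displacement of length t for the metric at \<open>x0\<close> moves a point by distance
    at most 2 t.\<close>
  define a where "a x = (if x \<in> chart_cod c then 4 * \<kappa> * \<phi> (chart_inv c x) else 0)" for x
  have \<phi>i: "continuous_on (chart_cod c) (\<lambda>x. \<phi> (chart_inv c x))"
    by (rule continuous_on_compose2[OF \<phi>_cont cont_inv[OF c]]) simp
  have Hm: "H \<in> borel_measurable borel" and am: "a \<in> borel_measurable borel"
    unfolding H_def[abs_def] a_def[abs_def]
    by (rule borel_measurable_continuous_on_if; use S in \<open>auto intro!: continuous_intros \<phi>i\<close>)+
  obtain \<mu> where \<mu>: "\<mu> > 0" "\<And>w. \<mu> * (norm w)\<^sup>2 \<le> w \<bullet> (g c x0 *v w)"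
    by (rule pos_def_bound[of "g c x0", OF pos_def[OF x0]], assumption, rule that)
  \<comment> \<open>A vector of length at most 1 at \<open>x0\<close> has Euclidean norm at most 1 /
    sqrt \<mu>. So steps up to \<open>t0\<close> move points of the half ball by at most \<delta> /
    2, and the segment stays where the metrics are comparable.\<close>
  define t0 where "t0 = \<delta> / 2 * sqrt \<mu>"
  have t0: "t0 > 0" using \<delta>(1) \<mu>(1) by (simp add: t0_def)
  have dq: "\<bar>H (x + t *\<^sub>R E) - H x\<bar> \<le> \<bar>t\<bar> * (a x + (4 * \<kappa>\<^sup>2) * \<bar>t\<bar>)"
    if x: "x \<in> X" and t: "\<bar>t\<bar> \<le> t0" and E: "E \<bullet> (g c x0 *v E) \<le> 1" for x t E
  proof -
    have "\<mu> * (norm E)\<^sup>2 \<le> 1" using \<mu>(2)[of E] E by linarith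
    then have "(sqrt \<mu> * norm E)\<^sup>2 \<le> 1\<^sup>2" using \<mu>(1) by (simp add: power_mult_distrib)
    then have nE: "sqrt \<mu> * norm E \<le> 1" by (rule power2_le_imp_le) simp
    have "norm (t *\<^sub>R E) \<le> t0 * norm E" using t by (simp add: mult_right_mono)
    also have "\<dots> \<le> \<delta> / 2" using nE \<delta>(1) mult_left_mono[OF nE, of "\<delta> / 2"] by (simp add: t0_def mult_ac)
    finally have small: "norm (t *\<^sub>R E) \<le> \<delta> / 2" .
    define y where "y = x + t *\<^sub>R E"
    have x2: "dist x0 x \<le> \<delta> / 2" using x X_sub by auto
    have "dist x0 y \<le> dist x0 x + norm (t *\<^sub>R E)"
      using dist_triangle[of x0 y x] by (simp add: y_def dist_norm)
    then have y: "y \<in> cball x0 \<delta>" using x2 small by simp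
    have x': "x \<in> cball x0 \<delta>" using x2 \<delta>(1) by simp
    have seg: "closed_segment x y \<subseteq> cball x0 \<delta>" using x' y by (intro closed_segment_subset) auto
    have "\<exists>L\<le>2 * \<bar>t\<bar>. reach (chart_inv c x) (chart_inv c y) L"
    proof (rule reach_segment[OF c])
      show "closed_segment x y \<subseteq> chart_cod c" using seg \<delta>(2) by blast
      fix w assume "w \<in> closed_segment x y"
      then have w: "w \<in> cball x0 \<delta>" using seg by blast
      have "gnorm c x0 E \<le> 1" using E by (simp add: gnorm_def)
      then have "\<bar>t\<bar> * gnorm c x0 E \<le> \<bar>t\<bar> * 1" by (intro mult_left_mono) auto
      then show "gnorm c w (y - x) \<le> 2 * \<bar>t\<bar>"
        using cmp(1)[OF w, of "t *\<^sub>R E"] by (simp add: y_def gnorm_scaleR)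
    qed
    then obtain L where "L \<le> 2 * \<bar>t\<bar>" "reach (chart_inv c x) (chart_inv c y) L" by blast
    then have d: "dst (chart_inv c x) (chart_inv c y) \<le> 2 * \<bar>t\<bar>" using rdist_le by (meson order_trans)
    define \<alpha> where "\<alpha> = \<phi> (chart_inv c x)"
    define \<beta> where "\<beta> = \<phi> (chart_inv c y)"
    have "\<bar>\<alpha> - \<beta>\<bar> \<le> \<kappa> * dst (chart_inv c x) (chart_inv c y)" unfolding \<alpha>_def \<beta>_def by (rule \<phi>_lip)
    also have "\<dots> \<le> \<kappa> * (2 * \<bar>t\<bar>)" by (rule mult_left_mono[OF d \<kappa>])
    finally have ab: "\<bar>\<beta> - \<alpha>\<bar> \<le> 2 * \<kappa> * \<bar>t\<bar>" by simp
    have nn: "0 \<le> \<alpha>" "0 \<le> \<beta>" by (simp_all add: \<alpha>_def \<beta>_def \<phi>_range)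
    \<comment> \<open>A difference of squares, whose second factor is at most 2 \<alpha> plus the
      increment: this gives the term in \<open>a\<close> and an error quadratic in
      \<open>t\<close>.\<close>
    have "\<bar>\<beta>\<^sup>2 - \<alpha>\<^sup>2\<bar> = \<bar>\<beta> - \<alpha>\<bar> * \<bar>\<beta> + \<alpha>\<bar>"
      by (simp add: abs_mult[symmetric] power2_eq_square algebra_simps)
    also have "\<dots> \<le> (2 * \<kappa> * \<bar>t\<bar>) * (2 * \<alpha> + 2 * \<kappa> * \<bar>t\<bar>)"
      using ab nn \<kappa> by (intro mult_mono) auto
    also have "\<dots> = \<bar>t\<bar> * (4 * \<kappa> * \<alpha> + (4 * \<kappa>\<^sup>2) * \<bar>t\<bar>)" by (simp add: power2_eq_square algebra_simps)
    finally have fin: "\<bar>\<beta>\<^sup>2 - \<alpha>\<^sup>2\<bar> \<le> \<bar>t\<bar> * (4 * \<kappa> * \<alpha> + (4 * \<kappa>\<^sup>2) * \<bar>t\<bar>)" .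
    have "x \<in> chart_cod c" "y \<in> chart_cod c" using x' y \<delta>(2) by auto
    then have "H x = \<alpha>\<^sup>2" "H y = \<beta>\<^sup>2" "a x = 4 * \<kappa> * \<alpha>" by (simp_all add: H_def a_def \<alpha>_def \<beta>_def)
    then show ?thesis using fin unfolding y_def[symmetric] by simp
  qed
  define N where "N x = sqrt ((\<chi> i. Y i x) \<bullet> (g c x0 *v (\<chi> i. Y i x)))" for x
  have est: "\<bar>\<integral>x. H x * (\<Sum>i\<in>UNIV. pd i (Y i) x) \<partial>lborel\<bar> \<le> CARD('n) * (\<integral>x. a x * N x \<partial>lborel)"
    unfolding N_def
  proof (rule integral_divergence_bound[OF pos_def[OF x0] Y_C1 X Y0 Hm _ am _ _ t0 dq])
    show "\<bar>H x\<bar> \<le> 1" for x using \<phi>_range by (simp add: H_def power_le_one)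
    show "0 \<le> a x" for x using \<phi>_range \<kappa> by (simp add: a_def)
    show "a x \<le> 4 * \<kappa>" for x using \<phi>_range(2)[of "chart_inv c x"] \<kappa> by (simp add: a_def mult_left_le)
  qed
  have meas: "weak_integrand \<psi> \<in> borel_measurable borel" "gradient_integrand \<psi> \<in> borel_measurable borel"
    using integrand_continuous[OF \<psi>(1)] by (auto intro: borel_measurable_continuous_onI)
  have zK: "weak_integrand \<psi> p = 0" "gradient_integrand \<psi> p = 0" if "p \<notin> K" for p
    by (rule integrand_zero(1)[OF K(1) _ that], erule \<psi>(3), rule integrand_zero(2)[OF K(1) _ that], erule \<psi>(3))
  have zero: "weak_integrand \<psi> p = 0" "gradient_integrand \<psi> p = 0" if "p \<notin> chart_dom c" for p
    using zK[of p] that K_dom by blast+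
  have lhs: "(\<integral>p. weak_integrand \<psi> p \<partial>\<mu>\<^sub>g) = (\<integral>x. H x * (\<Sum>i\<in>UNIV. pd i (Y i) x) \<partial>lborel)"
  proof (rule trans[OF integral_volume_chart[OF c meas(1) zero(1)] Bochner_Integration.integral_cong[OF refl]])
    fix x
    show "vol_density c x * weak_integrand \<psi> (chart_inv c x) = H x * (\<Sum>i\<in>UNIV. pd i (Y i) x)"
    proof (cases "x \<in> chart_cod c")
      case True
      then show ?thesis by (simp add: div vol_eq H_def weak_integrand_def)
    qed (simp add: vol_density_def H_def)
  qed
  define V where "V x = vol_density c x * gradient_integrand \<psi> (chart_inv c x)" for x
  have V_zero: "V x = 0" if "x \<notin> X" for x
    using zK(2)[of "chart_inv c x"] out[of x] that
    by (cases "x \<in> chart_cod c") (auto simp: V_def vol_density_def)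
  have V_cont: "continuous_on (chart_cod c) (\<lambda>x. vol x * gradient_integrand \<psi> (chart_inv c x))"
    by (intro continuous_on_mult C1_on_continuous[OF vol_C1]
        continuous_on_compose2[OF integrand_continuous(2)[OF \<psi>(1)] cont_inv[OF c]]) simp
  have V_if: "V = (\<lambda>x. if x \<in> chart_cod c then vol x * gradient_integrand \<psi> (chart_inv c x) else 0)"
  proof
    show "V x = (if x \<in> chart_cod c then vol x * gradient_integrand \<psi> (chart_inv c x) else 0)" for x
      using vol_eq[of x] by (cases "x \<in> chart_cod c") (simp_all add: V_def, simp add: vol_density_def)
  qed
  have V_int: "integrable lborel V"
  proof -
    have "bounded ((\<lambda>x. vol x * gradient_integrand \<psi> (chart_inv c x)) ` X)"
      using V_cont X X_cod by (intro compact_imp_bounded compact_continuous_image) (auto intro: continuous_on_subset)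
    then obtain C where C: "\<And>x. x \<in> X \<Longrightarrow> \<bar>vol x * gradient_integrand \<psi> (chart_inv c x)\<bar> \<le> C" by (auto simp: bounded_iff)
    show ?thesis
    proof (rule integrable_compact_support[OF _ X V_zero])
      show "V \<in> borel_measurable borel" unfolding V_if
        by (rule borel_measurable_continuous_on_if) (use S V_cont in auto)
      show "\<bar>V x\<bar> \<le> C" if "x \<in> X" for x using C[OF that] X_cod that by (auto simp: V_if)
    qed
  qed
  have grad_nonneg: "0 \<le> gradient_integrand \<psi> p" for p
    using \<phi>_range(1) \<psi>(2) gpair_nonneg[OF f_C1] by (simp add: gradient_integrand_def)
  have "(\<integral>x. a x * N x \<partial>lborel) \<le> (\<integral>x. 8 * \<kappa> * V x \<partial>lborel)"
  proof (rule integral_mono')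
    show "integrable lborel (\<lambda>x. 8 * \<kappa> * V x)" using V_int by simp
    show "0 \<le> 8 * \<kappa> * V x" for x
      using \<kappa> grad_nonneg vol_density_nonneg[OF c] by (simp add: V_def)
    show "a x * N x \<le> 8 * \<kappa> * V x" for x
    proof (cases "x \<in> X")
      case True
      then have xc: "x \<in> chart_cod c" and xb: "x \<in> cball x0 \<delta>" using X_cod X_sub sub2 by auto
      have Yz: "(\<chi> i. Y i x) = (\<Psi> x * vol x) *\<^sub>R z x"
        using xc by (simp add: vec_eq_iff Y_def flux_def z)
      have Gz: "g c x *v z x = gradv c f (chart_inv c x)"
        by (simp add: z_def matrix_vector_mul_assoc matrix_inv_mult det_nz[OF xc])
      \<comment> \<open>Raising the index preserves length: \<open>z x\<close> is the gradient
        vector of \<open>f\<close>, and its norm is that of the differential.\<close>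
      have gz: "gnorm c x (z x) = sqrt (gpair f f (chart_inv c x))"
        unfolding gnorm_def Gz pair[OF f_C1 xc] by (simp add: inner_commute)
      have nn: "0 \<le> \<Psi> x * vol x" using \<psi>(2) vol_pos[OF xc] by (simp add: \<Psi>_def)
      have "N x = gnorm c x0 (\<chi> i. Y i x)" by (simp add: N_def gnorm_def)
      also have "\<dots> \<le> 2 * gnorm c x (\<chi> i. Y i x)" by (rule cmp(2)[OF xb])
      also have "\<dots> = 2 * (\<Psi> x * vol x * sqrt (gpair f f (chart_inv c x)))"
        unfolding Yz gnorm_scaleR gz using nn by simp
      finally have "a x * N x \<le> a x * (2 * (\<Psi> x * vol x * sqrt (gpair f f (chart_inv c x))))"
        using \<phi>_range(1) \<kappa> by (intro mult_left_mono) (auto simp: a_def)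
      then show ?thesis
        using xc by (simp add: V_def vol_eq a_def gradient_integrand_def \<Psi>_def mult_ac)
    next
      case False
      then show ?thesis by (simp add: V_zero N_def Y0 zero_vec_def[symmetric])
    qed
  qed
  also have "\<dots> = 8 * \<kappa> * (\<integral>p. gradient_integrand \<psi> p \<partial>\<mu>\<^sub>g)"
    using integral_volume_chart[OF c meas(2) zero(2)] by (simp add: V_def)
  finally have "CARD('n) * (\<integral>x. a x * N x \<partial>lborel) \<le> CARD('n) * (8 * \<kappa> * (\<integral>p. gradient_integrand \<psi> p \<partial>\<mu>\<^sub>g))"
    by (rule mult_left_mono) simp
  with est have "\<bar>\<integral>x. H x * (\<Sum>i\<in>UNIV. pd i (Y i) x) \<partial>lborel\<bar> \<le>
      CARD('n) * (8 * \<kappa> * (\<integral>p. gradient_integrand \<psi> p \<partial>\<mu>\<^sub>g))" by (rule order_trans)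
  also have "\<dots> = 8 * CARD('n) * \<kappa> * (\<integral>p. gradient_integrand \<psi> p \<partial>\<mu>\<^sub>g)" by simp
  finally show ?thesis unfolding lhs .
qed

text \<open>This estimate is linear enough in \<open>\<psi>\<close> to be summed over a partition of unity: the terms
  \<open>|\<psi>\<^sub>i \<nabla>f|\<close> add up to \<open>|\<nabla>f|\<close>, and the gradients of the \<open>\<psi>\<^sub>i\<close> cancel. The partition of unity is
  obtained by telescoping \<open>1 - (1 - H\<^sub>1) \<dots> (1 - H\<^sub>k)\<close> for cutoff functions \<open>H\<^sub>i\<close> of small charts.\<close>

definition admissible :: "('a \<Rightarrow> real) \<Rightarrow> bool" where
  "admissible \<psi> \<longleftrightarrow> C1_fun \<psi> \<and> (\<forall>p. 0 \<le> \<psi> p) \<and> (\<exists>K. compact K \<and> (\<forall>p. p \<notin> K \<longrightarrow> \<psi> p = 0)) \<and>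
     \<bar>\<integral>p. weak_integrand \<psi> p \<partial>\<mu>\<^sub>g\<bar> \<le> 8 * CARD('n) * \<kappa> * (\<integral>p. gradient_integrand \<psi> p \<partial>\<mu>\<^sub>g)"

lemma admissible_add:
  assumes fin: "\<And>K. compact K \<Longrightarrow> emeasure \<mu>\<^sub>g K < \<infinity>" and 1: "admissible \<psi>1" and 2: "admissible \<psi>2"
  shows "admissible (\<lambda>p. \<psi>1 p + \<psi>2 p)"
proof -
  have C1: "C1_fun \<psi>1" "C1_fun \<psi>2" using 1 2 by (auto simp: admissible_def)
  obtain K1 where K1: "compact K1" "\<And>p. p \<notin> K1 \<Longrightarrow> \<psi>1 p = 0" using 1 by (auto simp: admissible_def)
  obtain K2 where K2: "compact K2" "\<And>p. p \<notin> K2 \<Longrightarrow> \<psi>2 p = 0" using 2 by (auto simp: admissible_def)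
  have int1: "integrable \<mu>\<^sub>g (weak_integrand \<psi>1)" "integrable \<mu>\<^sub>g (gradient_integrand \<psi>1)"
  proof -
    show "integrable \<mu>\<^sub>g (weak_integrand \<psi>1)"
      by (rule integrable_volume[OF fin integrand_continuous(1)[OF C1(1)] K1(1)], assumption)
         (rule integrand_zero(1)[OF K1])
    show "integrable \<mu>\<^sub>g (gradient_integrand \<psi>1)"
      by (rule integrable_volume[OF fin integrand_continuous(2)[OF C1(1)] K1(1)], assumption)
         (rule integrand_zero(2)[OF K1])
  qed
  have int2: "integrable \<mu>\<^sub>g (weak_integrand \<psi>2)" "integrable \<mu>\<^sub>g (gradient_integrand \<psi>2)"
  proof -
    show "integrable \<mu>\<^sub>g (weak_integrand \<psi>2)"
      by (rule integrable_volume[OF fin integrand_continuous(1)[OF C1(2)] K2(1)], assumption)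
         (rule integrand_zero(1)[OF K2])
    show "integrable \<mu>\<^sub>g (gradient_integrand \<psi>2)"
      by (rule integrable_volume[OF fin integrand_continuous(2)[OF C1(2)] K2(1)], assumption)
         (rule integrand_zero(2)[OF K2])
  qed
  have w: "weak_integrand (\<lambda>p. \<psi>1 p + \<psi>2 p) = (\<lambda>p. weak_integrand \<psi>1 p + weak_integrand \<psi>2 p)"
    by (simp add: fun_eq_iff weak_integrand_def gpair_add[OF C1] algebra_simps)
  have gr: "gradient_integrand (\<lambda>p. \<psi>1 p + \<psi>2 p) = (\<lambda>p. gradient_integrand \<psi>1 p + gradient_integrand \<psi>2 p)"
    by (simp add: fun_eq_iff gradient_integrand_def algebra_simps)
  have "\<bar>\<integral>p. weak_integrand (\<lambda>p. \<psi>1 p + \<psi>2 p) p \<partial>\<mu>\<^sub>g\<bar> \<le>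
      8 * CARD('n) * \<kappa> * (\<integral>p. gradient_integrand (\<lambda>p. \<psi>1 p + \<psi>2 p) p \<partial>\<mu>\<^sub>g)"
  proof -
    have b1: "\<bar>\<integral>p. weak_integrand \<psi>1 p \<partial>\<mu>\<^sub>g\<bar> \<le> 8 * CARD('n) * \<kappa> * (\<integral>p. gradient_integrand \<psi>1 p \<partial>\<mu>\<^sub>g)"
      using 1 by (simp add: admissible_def)
    have b2: "\<bar>\<integral>p. weak_integrand \<psi>2 p \<partial>\<mu>\<^sub>g\<bar> \<le> 8 * CARD('n) * \<kappa> * (\<integral>p. gradient_integrand \<psi>2 p \<partial>\<mu>\<^sub>g)"
      using 2 by (simp add: admissible_def)
    show ?thesis
      unfolding w gr Bochner_Integration.integral_add[OF int1(1) int2(1)]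
        Bochner_Integration.integral_add[OF int1(2) int2(2)] distrib_left
      by (rule order_trans[OF abs_triangle_ineq add_mono[OF b1 b2]])
  qed
  moreover have "\<exists>K. compact K \<and> (\<forall>p. p \<notin> K \<longrightarrow> \<psi>1 p + \<psi>2 p = 0)"
    using K1 K2 by (intro exI[of _ "K1 \<union> K2"]) auto
  ultimately show ?thesis using 1 2 C1_fun_add[OF C1] by (simp add: admissible_def)
qed

text \<open>The factor \<open>P\<close> is what the telescoping requires: its terms are a cutoff of
  one small chart times factors 1 - H from other charts. The cutoff is supported in the half ball,
  which leaves room for difference quotients. The existential form suits a simultaneous choice for
  all points.\<close>

lemma local_cutoff:
  "\<exists>H W. C1_fun H \<and> (\<forall>q. 0 \<le> H q \<and> H q \<le> 1) \<and> open W \<and> p \<in> W \<and> (\<forall>q\<in>W. H q = 1) \<and>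
     (\<forall>P. C1_fun P \<longrightarrow> (\<forall>q. 0 \<le> P q) \<longrightarrow> admissible (\<lambda>q. H q * P q))"
proof -
  let ?c = "chart_at p" and ?x = "coord (chart_at p) p"
  note c = chart_at[of p]
  have x: "?x \<in> chart_cod ?c" by (rule coord_in[OF c])
  obtain \<delta> where \<delta>: "\<delta> > 0" "cball ?x \<delta> \<subseteq> chart_cod ?c \<inter> UNIV"
    "\<And>x v. x \<in> cball ?x \<delta> \<Longrightarrow> gnorm ?c x v \<le> 2 * gnorm ?c ?x v"
    "\<And>x v. x \<in> cball ?x \<delta> \<Longrightarrow> gnorm ?c ?x v \<le> 2 * gnorm ?c x v"
    by (rule gnorm_locally_comparable[OF c(1) x open_UNIV UNIV_I]) (rule that)
  define U where "U = chart_inv ?c ` ball ?x (\<delta> / 2)"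
  have "ball ?x (\<delta> / 2) \<subseteq> cball ?x \<delta>" using \<delta>(1) by (intro order_trans[OF ball_subset_cball] subset_cball) simp
  then have "open U" unfolding U_def using \<delta>(2) by (intro open_chart_inv_image c) auto
  moreover have "p \<in> U" unfolding U_def using \<delta>(1) inv_coord[OF c] by (intro image_eqI[of _ _ ?x]) auto
  ultimately obtain H W K where H: "C1_fun H" "\<And>q. 0 \<le> H q" "\<And>q. H q \<le> 1" "open W" "p \<in> W"
    "\<And>q. q \<in> W \<Longrightarrow> H q = 1" "compact K" "K \<subseteq> U \<inter> chart_dom ?c" "\<And>q. q \<notin> K \<Longrightarrow> H q = 0"
    by (rule bump_function[OF _ _ c(2,1)]) (rule that)
  have K: "K \<subseteq> chart_inv ?c ` cball ?x (\<delta> / 2)" using H(8) ball_subset_cball by (auto simp: U_def)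
  have "admissible (\<lambda>q. H q * P q)" if P: "C1_fun P" "\<And>q. 0 \<le> P q" for P
  proof -
    have \<psi>: "C1_fun (\<lambda>q. H q * P q)" "\<And>q. 0 \<le> H q * P q" "\<And>q. q \<notin> K \<Longrightarrow> H q * P q = 0"
      using C1_fun_mult[OF H(1) P(1)] H(2,9) P(2) by auto
    have "cball ?x \<delta> \<subseteq> chart_cod ?c" using \<delta>(2) by simp
    from local_estimate[OF c(1) x \<delta>(1) this \<delta>(3,4) H(7) K \<psi>]
    show ?thesis using \<psi> H(7) unfolding admissible_def by blast
  qed
  then show ?thesis using H(1-6) by blast
qed

text \<open>The partition of unity sums to 1 on a neighbourhood of the support of \<phi>, so the
  gradient of the sum vanishes there and \<open>weak_integrand\<close> reduces to \<phi>^2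
  \<Lambda>.\<close>

lemma integral_laplacian_bound:
  assumes fin: "\<And>K. compact K \<Longrightarrow> emeasure \<mu>\<^sub>g K < \<infinity>" and K: "compact K" "\<And>p. p \<notin> K \<Longrightarrow> \<phi> p = 0"
  shows "(\<integral>p. (\<phi> p)\<^sup>2 * \<Lambda> p \<partial>\<mu>\<^sub>g) \<le> 8 * CARD('n) * \<kappa> * (\<integral>p. \<phi> p * sqrt (gpair f f p) \<partial>\<mu>\<^sub>g)"
proof -
  obtain H W where HW: "\<And>p. C1_fun (H p)" "\<And>p q. 0 \<le> H p q" "\<And>p q. H p q \<le> 1" "\<And>p. open (W p)"
    "\<And>p. p \<in> W p" "\<And>p q. q \<in> W p \<Longrightarrow> H p q = 1"
    "\<And>p P. C1_fun P \<Longrightarrow> (\<And>q. 0 \<le> P q) \<Longrightarrow> admissible (\<lambda>q. H p q * P q)"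
  proof -
    \<comment> \<open>Cutoff and neighbourhood are packed into a pair, so that one application of
      choice gives both.\<close>
    have "\<forall>p. \<exists>HW. C1_fun (fst HW) \<and> (\<forall>q. 0 \<le> fst HW q \<and> fst HW q \<le> 1) \<and> open (snd HW) \<and> p \<in> snd HW \<and>
        (\<forall>q\<in>snd HW. fst HW q = 1) \<and> (\<forall>P. C1_fun P \<longrightarrow> (\<forall>q. 0 \<le> P q) \<longrightarrow> admissible (\<lambda>q. fst HW q * P q))"
      using local_cutoff by simp
    then obtain HW where "\<forall>p. C1_fun (fst (HW p)) \<and> (\<forall>q. 0 \<le> fst (HW p) q \<and> fst (HW p) q \<le> 1) \<and> open (snd (HW p)) \<and> p \<in> snd (HW p) \<and>
        (\<forall>q\<in>snd (HW p). fst (HW p) q = 1) \<and> (\<forall>P. C1_fun P \<longrightarrow> (\<forall>q. 0 \<le> P q) \<longrightarrow> admissible (\<lambda>q. fst (HW p) q * P q))"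
      by (rule choice[THEN exE])
    then show thesis by (intro that[of "\<lambda>p. fst (HW p)" "\<lambda>p. snd (HW p)"]) auto
  qed
  obtain F where F: "finite F" "K \<subseteq> (\<Union>p\<in>F. W p)"
    by (rule compactE_image[OF K(1), of UNIV W], rule HW(4), use HW(5) in blast, rule that)
  define Q where "Q G q = (\<Prod>p\<in>G. 1 - H p q)" for G q
  have Q: "C1_fun (Q G) \<and> (\<forall>q. 0 \<le> Q G q) \<and> admissible (\<lambda>q. 1 - Q G q)" if "finite G" for G
    using that
  proof (induction G rule: finite_induct)
    case empty
    have "admissible (\<lambda>_. 0)"
      using HW(7)[OF C1_fun_const[of 0]] by simp
    then show ?case by (simp add: Q_def C1_fun_const)
  next
    case (insert p G)
    have ins: "Q (insert p G) q = (1 - H p q) * Q G q" for q using insert by (simp add: Q_def)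
    have "C1_fun (\<lambda>q. (1 - H p q) * Q G q)"
      using insert.IH by (intro C1_fun_mult C1_fun_diff C1_fun_const HW(1)) auto
    moreover have "0 \<le> (1 - H p q) * Q G q" for q using insert.IH HW(3)[of p q] by simp
    \<comment> \<open>1 - (1 - H) Q = (1 - Q) + H Q: the new term is a cutoff times a nonnegative C1
      function, as \<open>local_cutoff\<close> allows.\<close>
    moreover have "admissible (\<lambda>q. (1 - Q G q) + H p q * Q G q)"
      using insert.IH HW(7)[of "Q G" p] by (intro admissible_add[OF fin]) auto
    ultimately show ?case by (simp add: ins algebra_simps)
  qed
  define \<psi> where "\<psi> q = 1 - Q F q" for q
  \<comment> \<open>Openness of this set is what lets \<open>gpair_local\<close> conclude that the
    gradient of \<psi> vanishes on \<open>K\<close>.\<close>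
  define W' where "W' = (\<Union>p\<in>F. W p)"
  have W': "open W'" "K \<subseteq> W'" using HW(4) F(2) by (auto simp: W'_def)
  have \<psi>1: "\<psi> q = 1" if q: "q \<in> W'" for q
  proof -
    obtain p where "p \<in> F" "q \<in> W p" using q by (auto simp: W'_def)
    then have "Q F q = 0" unfolding Q_def using F(1) HW(6)[of q p] by (intro prod_zero) auto
    then show ?thesis by (simp add: \<psi>_def)
  qed
  have w: "weak_integrand \<psi> p = (\<phi> p)\<^sup>2 * \<Lambda> p" for p
  proof (cases "p \<in> K")
    case True
    then have "p \<in> W'" using W' by blast
    then show ?thesis using gpair_local[OF W'(1) _ \<psi>1, of p] \<psi>1 by (simp add: weak_integrand_def)
  qed (simp add: weak_integrand_def K(2))
  have gr: "gradient_integrand \<psi> p = \<phi> p * sqrt (gpair f f p)" for p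
  proof (cases "p \<in> K")
    case True
    then have "p \<in> W'" using W' by blast
    then show ?thesis using \<psi>1 by (simp add: gradient_integrand_def)
  qed (simp add: gradient_integrand_def K(2))
  have "admissible \<psi>" using Q[OF F(1)] by (simp add: \<psi>_def[abs_def])
  then show ?thesis unfolding admissible_def w gr by linarith
qed

end

section \<open>The Laplacian of a quasi-Einstein potential and the contradiction\<close>

text \<open>Contraction with the inverse metric; expressing the gradient term by
  \<open>gpair\<close> makes the right-hand side independent of the chart, as
  \<open>is_laplacian\<close> demands.\<close>

lemma quasi_einstein_trace:
  fixes f lam :: "'a \<Rightarrow> real" and m R :: real
  assumes f: "smooth_fun A f" and qe: "generalized_quasi_einstein A g m f lam"
    and R: "constant_scalar_curvature A g R"
  shows "is_laplacian f (\<lambda>p. CARD('n) * lam p - R + 1 / m * gpair f f p)"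
  unfolding is_laplacian_def
proof (intro ballI)
  fix c p assume c: "c \<in> A" "p \<in> chart_dom c"
  interpret euclidean_metric "chart_cod c" "g c" by (rule euclidean_metric_chart[OF c(1)])
  define x where "x = coord c p"
  define F where "F = f \<circ> chart_inv c"
  have x: "x \<in> chart_cod c" unfolding x_def by (rule coord_in[OF c])
  have eq: "ricci (g c) x $ i $ j + hessian (g c) F x $ i $ j - 1 / m * d_tensor_d F x $ i $ j = lam p * g c x $ i $ j" for i j
  proof -
    have "ricci (g c) x + hessian (g c) F x - (1/m) *\<^sub>R d_tensor_d F x = lam p *\<^sub>R g c x"
      using qe c by (auto simp: generalized_quasi_einstein_def Let_def x_def F_def)
    from arg_cong[OF this, of "\<lambda>M. M $ i $ j"] show ?thesis by simp
  qed
  have "(\<Sum>i\<in>UNIV. \<Sum>j\<in>UNIV. h i j x * hessian (g c) F x $ i $ j) =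
    (\<Sum>i\<in>UNIV. \<Sum>j\<in>UNIV. lam p * (h i j x * g c x $ i $ j) - h i j x * ricci (g c) x $ i $ j
      + 1 / m * (h i j x * d_tensor_d F x $ i $ j))"
  proof (rule sum.cong[OF refl], rule sum.cong[OF refl])
    fix i j
    have hs: "hessian (g c) F x $ i $ j = lam p * g c x $ i $ j - ricci (g c) x $ i $ j + 1 / m * d_tensor_d F x $ i $ j"
      using eq[of i j] by linarith
    show "h i j x * hessian (g c) F x $ i $ j = lam p * (h i j x * g c x $ i $ j) - h i j x * ricci (g c) x $ i $ j
      + 1 / m * (h i j x * d_tensor_d F x $ i $ j)"
      unfolding hs by (simp add: algebra_simps)
  qed
  also have "\<dots> = lam p * (\<Sum>i\<in>UNIV. \<Sum>j\<in>UNIV. h i j x * g c x $ i $ j)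
      - (\<Sum>i\<in>UNIV. \<Sum>j\<in>UNIV. h i j x * ricci (g c) x $ i $ j)
      + 1 / m * (\<Sum>i\<in>UNIV. \<Sum>j\<in>UNIV. h i j x * d_tensor_d F x $ i $ j)"
    by (simp add: sum.distrib sum_subtractf sum_distrib_left)
  also have "(\<Sum>i\<in>UNIV. \<Sum>j\<in>UNIV. h i j x * g c x $ i $ j) = CARD('n)"
  proof -
    have "(\<Sum>j\<in>UNIV. h i j x * g c x $ i $ j) = 1" for i
    proof -
      have "(\<Sum>j\<in>UNIV. h i j x * g c x $ i $ j) = (matrix_inv (g c x) ** g c x) $ i $ i"
        unfolding matrix_matrix_mult_def by (simp add: G_sym[OF x, of i])
      then show ?thesis by (simp add: matrix_inv_mult(2)[OF det_nz[OF x]] mat_def)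
    qed
    then show ?thesis by simp
  qed
  also have "(\<Sum>i\<in>UNIV. \<Sum>j\<in>UNIV. h i j x * ricci (g c) x $ i $ j) = R"
    using R c(1) x by (simp add: constant_scalar_curvature_def scalar_curvature_def)
  also have "(\<Sum>i\<in>UNIV. \<Sum>j\<in>UNIV. h i j x * d_tensor_d F x $ i $ j) = gpair f f p"
    unfolding gpair_eq[OF smooth_fun_C1[OF f] smooth_fun_C1[OF f] c]
    by (simp add: d_tensor_d_def gradv_def F_def[symmetric] x_def[symmetric] inner_vec_def
        matrix_vector_mult_def sum_distrib_left mult_ac)
  finally have trace: "(\<Sum>i\<in>UNIV. \<Sum>j\<in>UNIV. h i j x * hessian (g c) F x $ i $ j) =
      lam p * real CARD('n) - R + 1 / m * gpair f f p" .
  show "(\<Sum>i\<in>UNIV. \<Sum>j\<in>UNIV. matrix_inv (g c (coord c p)) $ i $ j *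
      hessian (g c) (f \<circ> chart_inv c) (coord c p) $ i $ j) = real CARD('n) * lam p - R + 1 / m * gpair f f p"
    unfolding x_def[symmetric] F_def[symmetric] trace by simp
qed

text \<open>In terms of u = exp (-f / m) the hypothesis \<open>lap\<close> reads \<Delta>u =
  -(\<rho> / m) u; this is the superharmonic function of the name.\<close>

lemma no_superharmonic_under_linear_growth:
  assumes complete: "complete_riemannian A g" and f: "smooth_fun A f" and m: "m > 0"
    and lap: "is_laplacian f (\<lambda>p. \<rho> p + 1 / m * gpair f f p)"
    and \<rho>: "continuous_on UNIV \<rho>" "\<And>p. \<rho> p > 0"
    and growth: "\<And>r. r > 0 \<Longrightarrow> emeasure \<mu>\<^sub>g (geodesic_ball A g q r) \<le> ennreal (C * r)" and C: "C > 0"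
  shows False
proof -
  have ball: "geodesic_ball A g q r = {p. dst q p < r}" for r
    by (auto simp: geodesic_ball_def)
  have fin: "emeasure \<mu>\<^sub>g K < \<infinity>" if K: "compact K" for K
  proof -
    have "bounded (dst q ` K)"
      using dst_continuous K by (intro compact_imp_bounded compact_continuous_image) (auto intro: continuous_on_subset)
    then obtain B where B: "\<And>p. p \<in> K \<Longrightarrow> \<bar>dst q p\<bar> \<le> B" by (auto simp: bounded_iff)
    have "dst q p < \<bar>B\<bar> + 1" if "p \<in> K" for p using B[OF that] by linarith
    then have "K \<subseteq> {p. dst q p < \<bar>B\<bar> + 1}" by blast
    then have "emeasure \<mu>\<^sub>g K \<le> emeasure \<mu>\<^sub>g {p. dst q p < \<bar>B\<bar> + 1}"
      by (rule emeasure_mono) (simp add: dst_ball_open)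
    also have "\<dots> \<le> ennreal (C * (\<bar>B\<bar> + 1))" using growth[of "\<bar>B\<bar> + 1"] unfolding ball by simp
    also have "\<dots> < \<infinity>" by simp
    finally show ?thesis .
  qed
  define \<phi> where "\<phi> r p = max 0 (min 1 (2 - dst q p / r))" for r p
  have \<phi>_cont: "continuous_on UNIV (\<phi> r)" for r
    unfolding \<phi>_def[abs_def] divide_inverse by (intro continuous_intros dst_continuous)
  have \<phi>_range: "0 \<le> \<phi> r p" "\<phi> r p \<le> 1" for r p by (auto simp: \<phi>_def)
  have K: "compact {p. dst q p \<le> 2 * r}" for r by (rule compact_cball[OF complete])
  have \<phi>0: "\<phi> r p = 0" if "r > 0" "p \<notin> {p. dst q p \<le> 2 * r}" for r p
    using that by (auto simp: \<phi>_def max_def min_def field_simps)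
  define N where "N p = sqrt (gpair f f p)" for p
  have f1: "C1_fun f" by (rule smooth_fun_C1[OF f])
  have N: "continuous_on UNIV N" unfolding N_def[abs_def] by (intro continuous_intros gpair_continuous f1)
  have N2: "gpair f f p = (N p)\<^sup>2" for p unfolding N_def using gpair_nonneg[OF f1] by simp
  define I where "I r = (\<integral>p. (\<phi> r p)\<^sup>2 * \<rho> p \<partial>\<mu>\<^sub>g)" for r
  have int\<rho>: "integrable \<mu>\<^sub>g (\<lambda>p. (\<phi> r p)\<^sup>2 * \<rho> p)" if "r > 0" for r
    by (rule integrable_volume[OF fin _ K[of r]]) (auto intro!: continuous_intros \<phi>_cont \<rho>(1) simp: \<phi>0[OF that])
  have bound: "I r \<le> 48 * (real CARD('n))\<^sup>2 * m * C / r" if r: "r > 0" for r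
  proof -
    define B where "B = {p. dst q p \<le> 2 * r}"
    define k where "k = real (8 * CARD('n)) * (1 / r)"
    have B_closed: "B \<in> sets borel" unfolding B_def using dst_cball_closed by simp
    have lip: "\<bar>\<phi> r p - \<phi> r p'\<bar> \<le> 1 / r * dst p p'" for p p'
    proof -
      have "\<bar>dst q p - dst q p'\<bar> \<le> dst p p'"
        using dst_triangle[of q p p'] dst_triangle[of q p' p] dst_commute[of p p'] by (simp add: abs_le_iff)
      then have "\<bar>dst q p / r - dst q p' / r\<bar> \<le> 1 / r * dst p p'"
        using r by (simp add: diff_divide_distrib[symmetric] divide_right_mono)
      then show ?thesis unfolding \<phi>_def by (auto simp: max_def min_def abs_le_iff)
    qed
    have "(\<integral>p. (\<phi> r p)\<^sup>2 * (\<rho> p + 1 / m * gpair f f p) \<partial>\<mu>\<^sub>g) \<le>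
        8 * CARD('n) * (1 / r) * (\<integral>p. \<phi> r p * sqrt (gpair f f p) \<partial>\<mu>\<^sub>g)"
    proof (rule integral_laplacian_bound[OF f lap])
      show "continuous_on UNIV (\<phi> r)" by (rule \<phi>_cont)
      show "0 \<le> \<phi> r p" "\<phi> r p \<le> 1" for p by (rule \<phi>_range)+
      show "\<bar>\<phi> r p - \<phi> r p'\<bar> \<le> 1 / r * dst p p'" for p p' by (rule lip)
      show "emeasure \<mu>\<^sub>g K < \<infinity>" if "compact K" for K by (rule fin[OF that])
      show "compact {p. dst q p \<le> 2 * r}" by (rule K)
      show "\<phi> r p = 0" if "p \<notin> {p. dst q p \<le> 2 * r}" for p by (rule \<phi>0[OF r that])
      show "continuous_on UNIV (\<lambda>p. \<rho> p + 1 / m * gpair f f p)"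
        by (intro continuous_intros \<rho>(1) gpair_continuous f1)
      show "0 \<le> 1 / r" using r by simp
    qed
    moreover have "(\<integral>p. (\<phi> r p)\<^sup>2 * (\<rho> p + 1 / m * gpair f f p) \<partial>\<mu>\<^sub>g) =
        (\<integral>p. (\<phi> r p)\<^sup>2 * \<rho> p + 1 / m * ((\<phi> r p)\<^sup>2 * (N p)\<^sup>2) \<partial>\<mu>\<^sub>g)"
      by (simp add: N2 algebra_simps)
    moreover have "8 * CARD('n) * (1 / r) * (\<integral>p. \<phi> r p * sqrt (gpair f f p) \<partial>\<mu>\<^sub>g) = (\<integral>p. k * (\<phi> r p * N p) \<partial>\<mu>\<^sub>g)"
      unfolding k_def N_def by (rule integral_mult_right_zero[symmetric])
    ultimately have est: "(\<integral>p. (\<phi> r p)\<^sup>2 * \<rho> p + 1 / m * ((\<phi> r p)\<^sup>2 * (N p)\<^sup>2) \<partial>\<mu>\<^sub>g) \<le> (\<integral>p. k * (\<phi> r p * N p) \<partial>\<mu>\<^sub>g)"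
      by (simp only:)
    have intN2: "integrable \<mu>\<^sub>g (\<lambda>p. 1 / m * ((\<phi> r p)\<^sup>2 * (N p)\<^sup>2))"
    proof (rule integrable_volume[OF fin _ K[of r]])
      show "continuous_on UNIV (\<lambda>p. 1 / m * ((\<phi> r p)\<^sup>2 * (N p)\<^sup>2))"
        by (intro continuous_on_mult continuous_on_const continuous_on_power \<phi>_cont N)
    qed (simp_all add: \<phi>0[OF r])
    \<comment> \<open>The growth hypothesis concerns open balls, while \<phi> is supported in the
      closed ball of radius 2 r; radius 3 r encloses it.\<close>
    have "emeasure \<mu>\<^sub>g B \<le> emeasure \<mu>\<^sub>g {p. dst q p < 3 * r}"
      by (rule emeasure_mono) (use r in \<open>auto simp: B_def dst_ball_open\<close>)
    also have "\<dots> \<le> ennreal (C * (3 * r))" using growth[of "3 * r"] r unfolding ball by simp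
    finally have emB: "emeasure \<mu>\<^sub>g B \<le> ennreal (C * (3 * r))" .
    then have mB: "measure \<mu>\<^sub>g B \<le> C * (3 * r)"
      unfolding measure_def using C r by (intro enn2real_leI) auto
    have intB: "integrable \<mu>\<^sub>g (\<lambda>p. k\<^sup>2 * m / 4 * indicator B p)"
      using emB B_closed by (intro integrable_mult_right integrable_real_indicator)
        (auto simp: top.not_eq_extremum intro: order.strict_trans1)
    have "(\<integral>p. k * (\<phi> r p * N p) \<partial>\<mu>\<^sub>g) \<le> (\<integral>p. 1 / m * ((\<phi> r p)\<^sup>2 * (N p)\<^sup>2) + k\<^sup>2 * m / 4 * indicator B p \<partial>\<mu>\<^sub>g)"
    proof (rule integral_mono)
      show "integrable \<mu>\<^sub>g (\<lambda>p. k * (\<phi> r p * N p))"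
        by (rule integrable_volume[OF fin _ K[of r]]) (auto intro!: continuous_intros \<phi>_cont N simp: \<phi>0[OF r])
      show "integrable \<mu>\<^sub>g (\<lambda>p. 1 / m * ((\<phi> r p)\<^sup>2 * (N p)\<^sup>2) + k\<^sup>2 * m / 4 * indicator B p)"
        by (rule Bochner_Integration.integrable_add[OF intN2 intB])
      fix p
      show "k * (\<phi> r p * N p) \<le> 1 / m * ((\<phi> r p)\<^sup>2 * (N p)\<^sup>2) + k\<^sup>2 * m / 4 * indicator B p"
      proof (cases "p \<in> B")
        case True
        \<comment> \<open>Young's inequality as a completed square, with the weights chosen so that
          the quadratic term is exactly the gradient term already on the left.\<close>
        have "0 \<le> 1 / m * (\<phi> r p * N p - k * m / 2)\<^sup>2" using m by simp
        also have "\<dots> = 1 / m * ((\<phi> r p)\<^sup>2 * (N p)\<^sup>2) + k\<^sup>2 * m / 4 - k * (\<phi> r p * N p)"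
          using m by (simp add: field_simps power2_eq_square)
        finally show ?thesis using True by simp
      qed (simp add: \<phi>0[OF r] B_def)
    qed
    also have "\<dots> = (\<integral>p. 1 / m * ((\<phi> r p)\<^sup>2 * (N p)\<^sup>2) \<partial>\<mu>\<^sub>g) + k\<^sup>2 * m / 4 * measure \<mu>\<^sub>g B"
      using Bochner_Integration.integral_add[OF intN2 intB] B_closed by simp
    finally have "I r + (\<integral>p. 1 / m * ((\<phi> r p)\<^sup>2 * (N p)\<^sup>2) \<partial>\<mu>\<^sub>g) \<le>
        (\<integral>p. 1 / m * ((\<phi> r p)\<^sup>2 * (N p)\<^sup>2) \<partial>\<mu>\<^sub>g) + k\<^sup>2 * m / 4 * measure \<mu>\<^sub>g B"
      using est Bochner_Integration.integral_add[OF int\<rho>[OF r] intN2] by (simp only: I_def)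
    then have "I r \<le> k\<^sup>2 * m / 4 * measure \<mu>\<^sub>g B" by simp
    also have "\<dots> \<le> k\<^sup>2 * m / 4 * (C * (3 * r))" using mB m by (intro mult_left_mono) auto
    \<comment> \<open>With k = 8 n / r this is 16 * 3 * n^2 m C / r: linear volume growth is beaten
      by the squared Lipschitz constant.\<close>
    also have "\<dots> = 48 * (real CARD('n))\<^sup>2 * m * C / r"
      using r by (simp add: k_def field_simps power2_eq_square)
    finally show ?thesis .
  qed
  have mono: "I 1 \<le> I r" if r: "r \<ge> 1" for r
    unfolding I_def
  proof (rule integral_mono)
    show "(\<phi> 1 p)\<^sup>2 * \<rho> p \<le> (\<phi> r p)\<^sup>2 * \<rho> p" for p
    proof -
      have "dst q p / r \<le> dst q p / 1" using r dst_nonneg by (intro divide_left_mono) auto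
      then have "\<phi> 1 p \<le> \<phi> r p" unfolding \<phi>_def by (auto simp: max_def min_def)
      then show ?thesis using \<rho>(2)[of p] \<phi>_range(1) by (intro mult_right_mono power_mono) auto
    qed
  qed (use int\<rho> r in auto)
  have "I 1 \<le> 0"
  proof (rule ccontr)
    assume "\<not> I 1 \<le> 0"
    then have pos: "I 1 > 0" by simp
    define c where "c = 48 * (real CARD('n))\<^sup>2 * m * C"
    \<comment> \<open>Large enough to bring c / r below \<open>I 1\<close>, and at least 1 so that
      monotonicity applies.\<close>
    define r where "r = max 1 (c / I 1 + 1)"
    have r: "1 \<le> r" "c / I 1 < r" by (auto simp: r_def)
    then have "r > 0" by simp
    with r(1) have "I 1 \<le> c / r" unfolding c_def by (rule order_trans[OF mono bound])
    then show False using pos r(2) \<open>r > 0\<close> by (simp add: field_simps)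
  qed
  moreover have "0 \<le> I 1" unfolding I_def using \<rho>(2) by (intro Bochner_Integration.integral_nonneg) (simp add: less_imp_le)
  ultimately have "I 1 = 0" by simp
  moreover have "AE p in \<mu>\<^sub>g. 0 \<le> (\<phi> 1 p)\<^sup>2 * \<rho> p" using \<rho>(2) by (simp add: less_imp_le)
  ultimately have "AE p in \<mu>\<^sub>g. (\<phi> 1 p)\<^sup>2 * \<rho> p = 0"
    unfolding I_def using integral_nonneg_eq_0_iff_AE[OF int\<rho>[of 1]] by simp
  \<comment> \<open>The cutoff is 1 on the unit ball, so the vanishing integral would make this
    nonempty open ball a null set.\<close>
  moreover have "(\<phi> 1 p)\<^sup>2 * \<rho> p \<noteq> 0" if "dst q p < 1" for p
    using that \<rho>(2)[of p] by (simp add: \<phi>_def)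
  ultimately have "AE p in \<mu>\<^sub>g. p \<notin> {p. dst q p < 1}" by (auto elim!: eventually_mono)
  then have "emeasure \<mu>\<^sub>g {p. dst q p < 1} = 0"
    using AE_iff_measurable[of "{p. dst q p < 1}" \<mu>\<^sub>g "\<lambda>p. p \<notin> {p. dst q p < 1}"] by (simp add: dst_ball_open)
  moreover have "q \<in> {p. dst q p < 1}" by (simp add: dst_zero_iff[THEN iffD2])
  ultimately show False using volume_open_pos[OF dst_ball_open[of q 1]] by blast
qed

end

theorem theorem6p1:
  fixes m :: real
  assumes "CARD('n::finite) \<ge> 3" and "m > 1"
  shows "\<not> (\<exists>(A :: ('a::{t2_space, second_countable_topology}, 'n) chart set) g f lam q.
      riemannian_manifold A g \<and> connected (UNIV :: 'a set) \<and> \<not> compact (UNIV :: 'a set) \<and>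
      complete_riemannian A g \<and> smooth_fun A f \<and> smooth_fun A lam \<and>
      generalized_quasi_einstein A g m f lam \<and>
      (\<exists>R. constant_scalar_curvature A g R \<and> R \<le> 0) \<and>
      (\<forall>p. lam p > 0) \<and>
      bdd_above (range (\<lambda>p. exp (- f p / m) * lam p)) \<and>
      (\<exists>C>0. \<forall>r>0. emeasure (riemannian_volume A g) (geodesic_ball A g q r) \<le> ennreal (C * r)))"
proof (rule notI, elim exE conjE)
  fix A :: "('a, 'n) chart set" and g f lam q R C
  assume M: "riemannian_manifold A g" "connected (UNIV :: 'a set)" "complete_riemannian A g" and
    f: "smooth_fun A f" "smooth_fun A lam" "generalized_quasi_einstein A g m f lam" and
    R: "constant_scalar_curvature A g R" "R \<le> 0" and "\<forall>p. lam p > 0" and C: "0 < C" and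
    growth: "\<forall>r>0. emeasure (riemannian_volume A g) (geodesic_ball A g q r) \<le> ennreal (C * r)"
  interpret connected_riemannian_manifold A g
    using M(1,2) by (simp add: connected_riemannian_manifold_def connected_riemannian_manifold_axioms_def)
  show False
  proof (rule no_superharmonic_under_linear_growth[OF M(3) f(1) _ quasi_einstein_trace[OF f(1,3) R(1)] _ _ _ C])
    show "m > 0" using assms(2) by simp
    show "continuous_on UNIV (\<lambda>p. real CARD('n) * lam p - R)"
      by (intro continuous_intros C1_fun_continuous smooth_fun_C1 f(2))
    show "real CARD('n) * lam p - R > 0" for p
    proof -
      have "real CARD('n) * lam p > 0" using \<open>\<forall>p. lam p > 0\<close> by (intro mult_pos_pos) auto
      then show ?thesis using R(2) by linarith
    qed
  qed (use growth in blast)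
qed

end
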